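(* Let $V$ be a finite dimensional complex symplectic vector space with symplectic form $\omega$, and let $G$ be a finite group acting faithfully, linearly and symplectically on $V$, such that the space of $G$-invariant skew-symmetric bilinear forms on $V$ is $\mathbb{C}\omega$. Let $S$ be the set of symplectic reflections in $G$, $c:S\to\mathbb{C}$ a $G$-invariant function, $t\in\mathbb{C}$, $H_{t,c}$ the corresponding symplectic reflection algebra and $B_{t,c}=\mathbf{e}H_{t,c}\mathbf{e}$ its spherical subalgebra. Then $B_{t,c}$ is commutative if and only if $t=0$.
   Context: A symplectic reflection in $G$ is an element $s$ such that $s-1$ has rank $2$ on $V$. For such $s$, $\omega_s(x,y)$ is $\omega$ applied to the projections of $x,y$ to the image of $1-s$ along the kernel of $1-s$. The symplectic reflection algebra $H_{t,c}=H_{t,c}[V,G]$ is the quotient of $\mathbb{C}[G]\ltimes\mathbf{T}(V)$ ($\mathbf{T}(V)$ the tensor algebra) by the relations $[x,y]=t\,\omega(x,y)-2\sum_{s\in S}c_s\,\omega_s(x,y)\,s$ for $x,y\in V$, where $c:S\to\mathbb{C}$ is conjugation invariant. $\mathbf{e}=\frac1{|G|}\sum_{g\in G}g$ is the symmetrizing idempotent; $\mathbf{e}H_{t,c}\mathbf{e}$ is an algebra with unit $\mathbf{e}$. *)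

theory Defs
  imports
    "HOL-Library.Poly_Mapping"
    "HOL-Algebra.Algebra"
    "HOL-Algebra.Algebraic_Closure_Type"
begin

section \<open>The tensor algebra\<close>

text \<open>
  Words over a set form the free monoid; writing it additively makes the type of finitely supported
  functions \<open>'v word \<Rightarrow>\<^sub>0 complex\<close>, with its convolution product, the free associative
  complex algebra on the set \<open>'v\<close>.
\<close>

datatype 'v word = Word (letters: "'v list")

instantiation word :: (type) monoid_add
begin

definition zero_word :: "'a word"
  where "0 = Word []"

definition plus_word :: "'a word \<Rightarrow> 'a word \<Rightarrow> 'a word"
  where "u + w = Word (letters u @ letters w)"

instance
  by standard (simp_all add: zero_word_def plus_word_def)

end

type_synonym 'v free_alg = "'v word \<Rightarrow>\<^sub>0 complex"

definition free_algebra :: "'v free_alg ring"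
  where "free_algebra = ring_of_type_algebra"

definition free_vec :: "'v \<Rightarrow> 'v free_alg"
  where "free_vec v = Poly_Mapping.single (Word [v]) 1"

definition free_scalar :: "complex \<Rightarrow> 'v free_alg"
  where "free_scalar z = Poly_Mapping.single 0 z"

definition free_map :: "('v \<Rightarrow> 'v) \<Rightarrow> 'v free_alg \<Rightarrow> 'v free_alg"
  where "free_map f p =
    (\<Sum>w \<in> Poly_Mapping.keys p.
       Poly_Mapping.single (map_word f w) (Poly_Mapping.lookup p w))"

text \<open>
  The tensor algebra of \<open>V\<close> is the free algebra on the underlying set of \<open>V\<close>, modulo the
  relations saying that the inclusion of generators is linear in \<open>V\<close>.
\<close>

definition linearity_relations :: "(complex \<Rightarrow> 'v \<Rightarrow> 'v) \<Rightarrow> 'v::ab_group_add free_alg set"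
  where "linearity_relations scale =
    {free_vec (x + y) - (free_vec x + free_vec y) | x y. True} \<union>
    {free_vec (scale a x) - free_scalar a * free_vec x | a x. True}"

definition tensor_ideal :: "(complex \<Rightarrow> 'v \<Rightarrow> 'v) \<Rightarrow> 'v::ab_group_add free_alg set"
  where "tensor_ideal scale = Idl\<^bsub>free_algebra\<^esub> (linearity_relations scale)"

definition tensor_algebra :: "(complex \<Rightarrow> 'v \<Rightarrow> 'v) \<Rightarrow> 'v::ab_group_add free_alg set ring"
  where "tensor_algebra scale = free_algebra Quot tensor_ideal scale"

definition tensor_vec :: "(complex \<Rightarrow> 'v \<Rightarrow> 'v) \<Rightarrow> 'v::ab_group_add \<Rightarrow> 'v free_alg set"
  where "tensor_vec scale v = tensor_ideal scale +>\<^bsub>free_algebra\<^esub> free_vec v"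

definition tensor_scalar :: "(complex \<Rightarrow> 'v \<Rightarrow> 'v) \<Rightarrow> complex \<Rightarrow> 'v::ab_group_add free_alg set"
  where "tensor_scalar scale z = tensor_ideal scale +>\<^bsub>free_algebra\<^esub> free_scalar z"

text \<open>
  For an invertible linear map \<open>f\<close> the induced automorphism of the free algebra preserves the
  ideal, so that the image of a coset is again a coset.
\<close>

definition tensor_map :: "('v \<Rightarrow> 'v) \<Rightarrow> 'v free_alg set \<Rightarrow> 'v free_alg set"
  where "tensor_map f C = free_map f ` C"


section \<open>Smash products with a finite group\<close>

text \<open>
  For a finite group \<open>G\<close> acting on a ring \<open>R\<close> by automorphisms \<open>\<alpha> g\<close>, the function \<open>f\<close>
  stands for \<open>\<Sum>g\<in>G. f g \<cdot> g\<close>, and the multiplication is determined by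
  \<open>g \<cdot> r = \<alpha> g r \<cdot> g\<close>.
\<close>

definition smash_product ::
    "('g, 'm) monoid_scheme \<Rightarrow> ('r, 'n) ring_scheme \<Rightarrow> ('g \<Rightarrow> 'r \<Rightarrow> 'r) \<Rightarrow> ('g \<Rightarrow> 'r) ring"
  where "smash_product G R \<alpha> =
    \<lparr>carrier = carrier G \<rightarrow>\<^sub>E carrier R,
     monoid.mult = (\<lambda>f f'. \<lambda>k\<in>carrier G.
       \<Oplus>\<^bsub>R\<^esub>g\<in>carrier G. f g \<otimes>\<^bsub>R\<^esub> \<alpha> g (f' (inv\<^bsub>G\<^esub> g \<otimes>\<^bsub>G\<^esub> k))),
     one = (\<lambda>k\<in>carrier G. if k = \<one>\<^bsub>G\<^esub> then \<one>\<^bsub>R\<^esub> else \<zero>\<^bsub>R\<^esub>),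
     ring.zero = (\<lambda>k\<in>carrier G. \<zero>\<^bsub>R\<^esub>),
     add = (\<lambda>f f'. \<lambda>k\<in>carrier G. f k \<oplus>\<^bsub>R\<^esub> f' k)\<rparr>"

definition smash_ring_elt ::
    "('g, 'm) monoid_scheme \<Rightarrow> ('r, 'n) ring_scheme \<Rightarrow> 'r \<Rightarrow> 'g \<Rightarrow> 'r"
  where "smash_ring_elt G R r = (\<lambda>k\<in>carrier G. if k = \<one>\<^bsub>G\<^esub> then r else \<zero>\<^bsub>R\<^esub>)"

definition smash_group_elt ::
    "('g, 'm) monoid_scheme \<Rightarrow> ('r, 'n) ring_scheme \<Rightarrow> 'g \<Rightarrow> 'g \<Rightarrow> 'r"
  where "smash_group_elt G R g = (\<lambda>k\<in>carrier G. if k = g then \<one>\<^bsub>R\<^esub> else \<zero>\<^bsub>R\<^esub>)"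


section \<open>Symplectic forms and symplectic reflections\<close>

definition skew_bilinear_form ::
    "(complex \<Rightarrow> 'v \<Rightarrow> 'v) \<Rightarrow> ('v::ab_group_add \<Rightarrow> 'v \<Rightarrow> complex) \<Rightarrow> bool"
  where "skew_bilinear_form scale B \<longleftrightarrow>
    (\<forall>y. Vector_Spaces.linear scale (*) (\<lambda>x. B x y)) \<and>
    (\<forall>x. Vector_Spaces.linear scale (*) (\<lambda>y. B x y)) \<and>
    (\<forall>x y. B x y = - B y x)"

definition symplectic_form ::
    "(complex \<Rightarrow> 'v \<Rightarrow> 'v) \<Rightarrow> ('v::ab_group_add \<Rightarrow> 'v \<Rightarrow> complex) \<Rightarrow> bool"
  where "symplectic_form scale \<omega> \<longleftrightarrow>
    skew_bilinear_form scale \<omega> \<and> (\<forall>x. (\<forall>y. \<omega> x y = 0) \<longrightarrow> x = 0)"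

definition invariant_form ::
    "('g, 'm) monoid_scheme \<Rightarrow> ('g \<Rightarrow> 'v \<Rightarrow> 'v) \<Rightarrow> ('v \<Rightarrow> 'v \<Rightarrow> complex) \<Rightarrow> bool"
  where "invariant_form G \<rho> B \<longleftrightarrow>
    (\<forall>g\<in>carrier G. \<forall>x y. B (\<rho> g x) (\<rho> g y) = B x y)"

definition symplectic_reflections ::
    "(complex \<Rightarrow> 'v \<Rightarrow> 'v) \<Rightarrow> ('g, 'm) monoid_scheme \<Rightarrow> ('g \<Rightarrow> 'v \<Rightarrow> 'v::ab_group_add) \<Rightarrow> 'g set"
  where "symplectic_reflections scale G \<rho> =
    {s \<in> carrier G. vector_space.dim scale (range (\<lambda>v. \<rho> s v - v)) = 2}"

definition proj_along :: "'v::ab_group_add set \<Rightarrow> 'v set \<Rightarrow> 'v \<Rightarrow> 'v"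
  where "proj_along U W x = (THE u. u \<in> U \<and> x - u \<in> W)"

text \<open>
  When \<open>\<rho> s\<close> has finite order, \<open>V\<close> is the direct sum of the image and the kernel of \<open>1 - s\<close>, so
  that the projection below is well defined.
\<close>

definition reflection_form ::
    "('v::ab_group_add \<Rightarrow> 'v \<Rightarrow> complex) \<Rightarrow> ('g \<Rightarrow> 'v \<Rightarrow> 'v) \<Rightarrow> 'g \<Rightarrow> 'v \<Rightarrow> 'v \<Rightarrow> complex"
  where "reflection_form \<omega> \<rho> s x y =
    (let p = proj_along (range (\<lambda>v. v - \<rho> s v)) {v. v - \<rho> s v = 0} in \<omega> (p x) (p y))"


section \<open>Symplectic reflection algebras and their spherical subalgebras\<close>

definition smash_tensor_algebra ::
    "(complex \<Rightarrow> 'v \<Rightarrow> 'v) \<Rightarrow> ('g, 'm) monoid_scheme \<Rightarrow> ('g \<Rightarrow> 'v \<Rightarrow> 'v)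
      \<Rightarrow> ('g \<Rightarrow> 'v::ab_group_add free_alg set) ring"
  where "smash_tensor_algebra scale G \<rho> =
    smash_product G (tensor_algebra scale) (\<lambda>g. tensor_map (\<rho> g))"

definition sra_vec ::
    "(complex \<Rightarrow> 'v \<Rightarrow> 'v) \<Rightarrow> ('g, 'm) monoid_scheme \<Rightarrow> 'v \<Rightarrow> 'g \<Rightarrow> 'v::ab_group_add free_alg set"
  where "sra_vec scale G v = smash_ring_elt G (tensor_algebra scale) (tensor_vec scale v)"

definition sra_scalar ::
    "(complex \<Rightarrow> 'v \<Rightarrow> 'v) \<Rightarrow> ('g, 'm) monoid_scheme \<Rightarrow> complex \<Rightarrow> 'g \<Rightarrow> 'v::ab_group_add free_alg set"
  where "sra_scalar scale G z = smash_ring_elt G (tensor_algebra scale) (tensor_scalar scale z)"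

definition sra_group ::
    "(complex \<Rightarrow> 'v \<Rightarrow> 'v) \<Rightarrow> ('g, 'm) monoid_scheme \<Rightarrow> 'g \<Rightarrow> 'g \<Rightarrow> 'v::ab_group_add free_alg set"
  where "sra_group scale G g = smash_group_elt G (tensor_algebra scale) g"

definition sra_relation ::
    "(complex \<Rightarrow> 'v \<Rightarrow> 'v) \<Rightarrow> ('v \<Rightarrow> 'v \<Rightarrow> complex) \<Rightarrow> ('g, 'm) monoid_scheme \<Rightarrow> ('g \<Rightarrow> 'v \<Rightarrow> 'v)
      \<Rightarrow> complex \<Rightarrow> ('g \<Rightarrow> complex) \<Rightarrow> 'v \<Rightarrow> 'v \<Rightarrow> 'g \<Rightarrow> 'v::ab_group_add free_alg set"
  where "sra_relation scale \<omega> G \<rho> t c x y =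
    (let A = smash_tensor_algebra scale G \<rho>; x' = sra_vec scale G x; y' = sra_vec scale G y
     in (x' \<otimes>\<^bsub>A\<^esub> y' \<ominus>\<^bsub>A\<^esub> y' \<otimes>\<^bsub>A\<^esub> x') \<ominus>\<^bsub>A\<^esub>
        (sra_scalar scale G (t * \<omega> x y) \<ominus>\<^bsub>A\<^esub>
         sra_scalar scale G 2 \<otimes>\<^bsub>A\<^esub>
           (\<Oplus>\<^bsub>A\<^esub>s\<in>symplectic_reflections scale G \<rho>.
              sra_scalar scale G (c s * reflection_form \<omega> \<rho> s x y) \<otimes>\<^bsub>A\<^esub> sra_group scale G s)))"

definition sra_ideal ::
    "(complex \<Rightarrow> 'v \<Rightarrow> 'v) \<Rightarrow> ('v \<Rightarrow> 'v \<Rightarrow> complex) \<Rightarrow> ('g, 'm) monoid_scheme \<Rightarrow> ('g \<Rightarrow> 'v \<Rightarrow> 'v)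
      \<Rightarrow> complex \<Rightarrow> ('g \<Rightarrow> complex) \<Rightarrow> ('g \<Rightarrow> 'v::ab_group_add free_alg set) set"
  where "sra_ideal scale \<omega> G \<rho> t c =
    Idl\<^bsub>smash_tensor_algebra scale G \<rho>\<^esub> {sra_relation scale \<omega> G \<rho> t c x y | x y. True}"

definition symplectic_reflection_algebra ::
    "(complex \<Rightarrow> 'v \<Rightarrow> 'v) \<Rightarrow> ('v \<Rightarrow> 'v \<Rightarrow> complex) \<Rightarrow> ('g, 'm) monoid_scheme \<Rightarrow> ('g \<Rightarrow> 'v \<Rightarrow> 'v)
      \<Rightarrow> complex \<Rightarrow> ('g \<Rightarrow> complex) \<Rightarrow> ('g \<Rightarrow> 'v::ab_group_add free_alg set) set ring"
  where "symplectic_reflection_algebra scale \<omega> G \<rho> t c =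
    smash_tensor_algebra scale G \<rho> Quot sra_ideal scale \<omega> G \<rho> t c"

definition symmetrizer ::
    "(complex \<Rightarrow> 'v \<Rightarrow> 'v) \<Rightarrow> ('v \<Rightarrow> 'v \<Rightarrow> complex) \<Rightarrow> ('g, 'm) monoid_scheme \<Rightarrow> ('g \<Rightarrow> 'v \<Rightarrow> 'v)
      \<Rightarrow> complex \<Rightarrow> ('g \<Rightarrow> complex) \<Rightarrow> ('g \<Rightarrow> 'v::ab_group_add free_alg set) set"
  where "symmetrizer scale \<omega> G \<rho> t c =
    (let A = smash_tensor_algebra scale G \<rho>
     in sra_ideal scale \<omega> G \<rho> t c +>\<^bsub>A\<^esub>
          (sra_scalar scale G (1 / of_nat (card (carrier G))) \<otimes>\<^bsub>A\<^esub>
             (\<Oplus>\<^bsub>A\<^esub>g\<in>carrier G. sra_group scale G g)))"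

definition corner_ring :: "('r, 'n) ring_scheme \<Rightarrow> 'r \<Rightarrow> 'r ring"
  where "corner_ring R e =
    \<lparr>carrier = {e \<otimes>\<^bsub>R\<^esub> x \<otimes>\<^bsub>R\<^esub> e | x. x \<in> carrier R},
     monoid.mult = monoid.mult R, one = e, ring.zero = ring.zero R, add = add R\<rparr>"

definition spherical_subalgebra ::
    "(complex \<Rightarrow> 'v \<Rightarrow> 'v) \<Rightarrow> ('v \<Rightarrow> 'v \<Rightarrow> complex) \<Rightarrow> ('g, 'm) monoid_scheme \<Rightarrow> ('g \<Rightarrow> 'v \<Rightarrow> 'v)
      \<Rightarrow> complex \<Rightarrow> ('g \<Rightarrow> complex) \<Rightarrow> ('g \<Rightarrow> 'v::ab_group_add free_alg set) set ring"
  where "spherical_subalgebra scale \<omega> G \<rho> t c =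
    corner_ring (symplectic_reflection_algebra scale \<omega> G \<rho> t c) (symmetrizer scale \<omega> G \<rho> t c)"

end

theory Submission
  imports Defs
begin

text \<open>
  Write \<open>\<sigma>\<close> for the symbol map from the spherical subalgebra \<open>B\<close>, filtered by word length, to the
  polynomial functions on \<open>V\<close> that are invariant under \<open>G\<close> (a vector \<open>x\<close> is the function
  \<open>p \<mapsto> \<omega> x p\<close>). By the Poincare-Birkhoff-Witt theorem \<open>\<sigma>\<close> is well defined and identifies the associated
  graded algebra with the invariants; this rests on functionals on words which kill the relations,
  and they exist because moving along adjacent transpositions from a word to its sorted form
  has no monodromy, by the Jacobi identity.

  The commutator of \<open>B\<close> lowers the degree by at least 2, and its leading term is a sum over \<open>g \<in> G\<close>.
  The term of a reflection \<open>s\<close> is \<open>\<omega>\<^sub>s\<close> evaluated at two vectors \<open>x\<close>, \<open>y\<close> such that the images of both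
  under \<open>1 - s\<close> are orthogonal to \<open>p\<close>, by a telescoping sum. As \<open>1 - s\<close> has rank 2 the two
  images are proportional and the term vanishes. Only the multiple \<open>t\<close> of the standard Poisson bracket
  is left, and that bracket is nonzero.

  For \<open>t = 0\<close> the commutator lowers the degree by some \<open>k \<ge> 3\<close>. The leading terms form a
  biderivation of the invariants. It extends to \<open>V\<close> with poles only along the fixed spaces of
  elements of \<open>G\<close>. These have codimension at least 2, so a generic affine line and its point at infinity
  avoid them; on such a line the extension is a rational function without poles and of negative
  degree, hence zero. Inductively all commutators vanish.
\<close>

section \<open>Linear extension to formal combinations\<close>

text \<open>Elements of \<open>B\<close> are handled through representatives in the free algebra:
  \<open>x\<close> stands for \<open>e x e\<close>, and the representatives of 0 form a set
  \<open>K\<close>. The obstacle is that leading terms give a bracket on invariants only, where no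
  linear functions are at hand to read coefficients from. A linear function \<open>v\<close> is
  however a root of its orbit polynomial, whose coefficients are invariant. Differentiating this
  equation extends the bracket to \<open>v\<close>, with the derivative of the orbit polynomial at
  that root, \<open>\<Delta> p v\<close>, as denominator. At a point \<open>p\<close> with trivial
  stabilizer a generic \<open>v\<close> has a nonzero denominator and every vector is a combination
  of generic ones; this is why poles can lie on the fixed spaces only. The bound 3 comes from
  degrees: on two linear functions a bracket that lowers the degree by \<open>k\<close> has degree
  \<open>2 - k\<close>. For \<open>k = 2\<close> the coefficients are constants and may survive, as
  the Poisson bracket shows; from \<open>k = 3\<close> on the degree is negative. The induction on
  \<open>k\<close> ends because a commutator of words of total length \<open>n\<close> cannot lose
  more than \<open>n\<close> letters.\<close>

definition lin_ext :: "('k \<Rightarrow> 'a) \<Rightarrow> ('k \<Rightarrow>\<^sub>0 'a) \<Rightarrow> 'a::comm_ring_1"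
  where "lin_ext \<phi> x = (\<Sum>k\<in>Poly_Mapping.keys x. Poly_Mapping.lookup x k * \<phi> k)"

definition push :: "('k \<Rightarrow> 'l) \<Rightarrow> ('k \<Rightarrow>\<^sub>0 'a) \<Rightarrow> ('l \<Rightarrow>\<^sub>0 'a::comm_ring_1)"
  where "push f x = (\<Sum>k\<in>Poly_Mapping.keys x. Poly_Mapping.single (f k) (Poly_Mapping.lookup x k))"

lemma lin_ext_0 [simp]: "lin_ext \<phi> 0 = 0"
  by (simp add: lin_ext_def)

lemma lin_ext_single [simp]: "lin_ext \<phi> (Poly_Mapping.single k a) = a * \<phi> k"
  by (simp add: lin_ext_def)

lemma lin_ext_add: "lin_ext \<phi> (x + y) = lin_ext \<phi> x + lin_ext \<phi> y"
  unfolding lin_ext_def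
  by (rule setsum_keys_plus_distrib) (simp_all add: algebra_simps)

lemma lin_ext_uminus: "lin_ext \<phi> (- x) = - lin_ext \<phi> x"
  using lin_ext_add[of \<phi> "x" "- x"] by (simp add: eq_neg_iff_add_eq_0 add.commute)

lemma lin_ext_diff: "lin_ext \<phi> (x - y) = lin_ext \<phi> x - lin_ext \<phi> y"
  using lin_ext_add[of \<phi> "x - y" y] by simp

lemma lin_ext_sum: "lin_ext \<phi> (\<Sum>i\<in>A. f i) = (\<Sum>i\<in>A. lin_ext \<phi> (f i))"
  by (induction A rule: infinite_finite_induct) (simp_all add: lin_ext_add)

lemma push_0 [simp]: "push f 0 = 0"
  by (simp add: push_def)

lemma push_single [simp]: "push f (Poly_Mapping.single k a) = Poly_Mapping.single (f k) a"
  by (simp add: push_def)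

lemma push_add: "push f (x + y) = push f x + push f y"
  unfolding push_def
  by (rule setsum_keys_plus_distrib) (simp_all add: single_add)

lemma push_uminus: "push f (- x) = - push f x"
  using push_add[of f "x" "- x"] by (simp add: eq_neg_iff_add_eq_0 add.commute)

lemma push_diff: "push f (x - y) = push f x - push f y"
  using push_add[of f "x - y" y] by simp

lemma push_sum: "push f (\<Sum>i\<in>A. g i) = (\<Sum>i\<in>A. push f (g i))"
  by (induction A rule: infinite_finite_induct) (simp_all add: push_add)

lemma poly_mapping_sum_singles:
  "x = (\<Sum>k\<in>Poly_Mapping.keys x. Poly_Mapping.single k (Poly_Mapping.lookup x k))"
  by (rule poly_mapping_eqI)
    (auto simp: lookup_sum lookup_single when_def sum.If_cases in_keys_iff)

lemma poly_mapping_additive_induct [case_names zero single add]: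
  assumes "P 0" "\<And>k a. P (Poly_Mapping.single k a)" "\<And>x y. P x \<Longrightarrow> P y \<Longrightarrow> P (x + y)"
  shows "P (x :: 'k \<Rightarrow>\<^sub>0 'a::comm_monoid_add)"
proof -
  have "P (\<Sum>k\<in>A. Poly_Mapping.single k (Poly_Mapping.lookup x k))" if "finite A" for A
    using that by induction (auto intro: assms)
  thus ?thesis
    by (subst poly_mapping_sum_singles) simp
qed

lemma push_id: "(\<And>k. f k = k) \<Longrightarrow> push f x = x"
  by (induction x rule: poly_mapping_additive_induct) (simp_all add: push_add)

lemma lin_ext_push: "lin_ext \<phi> (push f x) = lin_ext (\<lambda>k. \<phi> (f k)) x"
  by (induction x rule: poly_mapping_additive_induct) (simp_all add: push_add lin_ext_add)

lemma lin_ext_mult: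
  fixes x y :: "'k::monoid_add \<Rightarrow>\<^sub>0 'a::comm_ring_1"
  assumes "\<And>k l. \<phi> (k + l) = \<phi> k * \<phi> l"
  shows "lin_ext \<phi> (x * y) = lin_ext \<phi> x * lin_ext \<phi> y"
proof (induction x rule: poly_mapping_additive_induct)
  case (single k a)
  show ?case
    by (induction y rule: poly_mapping_additive_induct)
      (simp_all add: lin_ext_add ring_distribs mult_single assms)
qed (simp_all add: lin_ext_add ring_distribs)

lemma push_mult:
  fixes x y :: "'k::monoid_add \<Rightarrow>\<^sub>0 'a::comm_ring_1" and f :: "'k \<Rightarrow> 'l::monoid_add"
  assumes "\<And>k l. f (k + l) = f k + f l"
  shows "push f (x * y) = push f x * push f y"
proof (induction x rule: poly_mapping_additive_induct)
  case (single k a)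
  show ?case
    by (induction y rule: poly_mapping_additive_induct)
      (simp_all add: push_add ring_distribs mult_single assms)
qed (simp_all add: push_add ring_distribs)

lemma lin_ext_scale:
  fixes x :: "'k::monoid_add \<Rightarrow>\<^sub>0 'a::comm_ring_1"
  shows "lin_ext \<phi> (Poly_Mapping.single 0 a * x) = a * lin_ext \<phi> x"
  by (induction x rule: poly_mapping_additive_induct)
    (simp_all add: lin_ext_add ring_distribs mult_single mult.assoc)

lemma lin_ext_cong:
  "(\<And>k. k \<in> Poly_Mapping.keys x \<Longrightarrow> \<phi> k = \<psi> k) \<Longrightarrow> lin_ext \<phi> x = lin_ext \<psi> x"
  by (simp add: lin_ext_def)

lemma keys_single_mult:
  fixes x :: "'k::monoid_add \<Rightarrow>\<^sub>0 'a::comm_ring_1"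
  shows "Poly_Mapping.keys (Poly_Mapping.single 0 a * x) \<subseteq> Poly_Mapping.keys x"
  using keys_mult[of "Poly_Mapping.single 0 a" x] by (auto split: if_splits)

section \<open>Simple connectedness of the sorting graph\<close>

text \<open>
  A function \<open>E\<close> on words is sought which changes by \<open>D u i j f\<close> when \<open>i\<close> and \<open>j\<close> are swapped between
  \<open>u\<close> and \<open>f\<close>. The total change along insertion sort is one.
\<close>

context
  fixes D :: "'i::linorder list \<Rightarrow> 'i \<Rightarrow> 'i \<Rightarrow> 'i list \<Rightarrow> 'a::ab_group_add"
begin

fun insert_cost :: "'i list \<Rightarrow> 'i \<Rightarrow> 'i list \<Rightarrow> 'a" where
  "insert_cost u i [] = 0"
| "insert_cost u i (j # f) = (if i \<le> j then 0 else D u i j f + insert_cost (u @ [j]) i f)"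

fun sort_cost :: "'i list \<Rightarrow> 'i list \<Rightarrow> 'a" where
  "sort_cost u [] = 0"
| "sort_cost u (i # f) = sort_cost (u @ [i]) f + insert_cost u i (sort f)"

context
  fixes n :: nat
  assumes anti: "\<And>u i j f. length u + length f + 2 = n \<Longrightarrow> D u i j f = - D u j i f"
    and refl: "\<And>u i f. length u + length f + 2 = n \<Longrightarrow> D u i i f = 0"
    and comm: "\<And>u i j f k l h. length u + length f + length h + 4 = n \<Longrightarrow>
      D u i j (f @ [k,l] @ h) - D u i j (f @ [l,k] @ h) =
      D (u @ [i,j] @ f) k l h - D (u @ [j,i] @ f) k l h"
    and hexagon: "\<And>u i j k f. length u + length f + 3 = n \<Longrightarrow>
      D u i j (k # f) + D (u @ [j]) i k f + D u j k (i # f) =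
      D (u @ [i]) j k f + D u i k (j # f) + D (u @ [k]) i j f"
begin

text \<open>Moving \<open>k\<close> past one letter and swapping \<open>i\<close> and
  \<open>j\<close> in the prefix form a square, which \<open>comm\<close> closes. Summed over the
  letters passed, the differences telescope.\<close>

lemma insert_cost_context:
  assumes "length u + length q + length f + 3 = n"
  shows "insert_cost (u @ [i,j] @ q) k f - insert_cost (u @ [j,i] @ q) k f =
    D u i j (q @ k # f) - D u i j (q @ insort k f)"
  using assms
proof (induction f arbitrary: q)
  case (Cons l f)
  from Cons.prems have le: "length u + length q + length f + 4 = n" by simp
  have "insert_cost (u @ [i,j] @ q @ [l]) k f - insert_cost (u @ [j,i] @ q @ [l]) k f =
    D u i j ((q @ [l]) @ k # f) - D u i j ((q @ [l]) @ insort k f)"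
    using Cons.IH[of "q @ [l]"] le by simp
  moreover have "D (u @ [i,j] @ q) k l f - D (u @ [j,i] @ q) k l f =
      D u i j (q @ [k,l] @ f) - D u i j (q @ [l,k] @ f)"
    by (rule comm[symmetric]) (use le in simp)
  ultimately show ?case by (simp add: algebra_simps)
qed simp

lemma sort_cost_context:
  assumes "length u + length q + length f + 2 = n"
  shows "sort_cost (u @ [i,j] @ q) f - sort_cost (u @ [j,i] @ q) f =
    D u i j (q @ f) - D u i j (q @ sort f)"
  using assms
proof (induction f arbitrary: q)
  case (Cons l f)
  from Cons.prems have le: "length u + length q + length f + 3 = n" by simp
  have "sort_cost (u @ [i,j] @ q @ [l]) f - sort_cost (u @ [j,i] @ q @ [l]) f =
    D u i j ((q @ [l]) @ f) - D u i j ((q @ [l]) @ sort f)"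
    using Cons.IH[of "q @ [l]"] le by simp
  moreover have "insert_cost (u @ [i,j] @ q) l (sort f) - insert_cost (u @ [j,i] @ q) l (sort f) =
    D u i j (q @ l # sort f) - D u i j (q @ insort l (sort f))"
    by (rule insert_cost_context) (use le in simp)
  ultimately have "(sort_cost (u @ [i,j] @ q @ [l]) f - sort_cost (u @ [j,i] @ q @ [l]) f)
      + (insert_cost (u @ [i,j] @ q) l (sort f) - insert_cost (u @ [j,i] @ q) l (sort f)) =
      (D u i j ((q @ [l]) @ f) - D u i j ((q @ [l]) @ sort f))
      + (D u i j (q @ l # sort f) - D u i j (q @ insort l (sort f)))"
    by simp
  thus ?case by (simp add: algebra_simps)
qed simp

text \<open>Two orders of inserting \<open>i\<close> and \<open>j\<close> are compared. Once
  \<open>j\<close> stops, \<open>i\<close> merely has to cross it in addition. As long as both cross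
  the same \<open>k\<close>, \<open>hexagon\<close> moves the swap of \<open>i\<close> and
  \<open>j\<close> behind \<open>k\<close>, and \<open>insert_cost_context\<close> corrects the
  prefixes.\<close>

lemma insert_cost_swap_aux:
  assumes "length u + length f + 2 = n" "j < i" "sorted f"
  shows "insert_cost (u @ [i]) j f + insert_cost u i (insort j f)
    - insert_cost (u @ [j]) i f - insert_cost u j (insort i f) = D u i j f"
  using assms
proof (induction f arbitrary: u)
  case (Cons k f)
  from Cons.prems have le: "length u + length f + 3 = n" and s: "sorted f" by auto
  show ?case
  proof (cases "j \<le> k")
    case True
    have "insert_cost u j (insort i (k # f)) = 0"
      using True \<open>j < i\<close> less_imp_le[OF \<open>j < i\<close>] by simp
    thus ?thesis using True \<open>j < i\<close> less_imp_le[OF \<open>j < i\<close>] by auto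
  next
    case False
    hence jk: "\<not> j \<le> k" "\<not> i \<le> k" using \<open>j < i\<close> by auto
    have IH: "insert_cost (u @ [k, i]) j f + insert_cost (u @ [k]) i (insort j f)
      - insert_cost (u @ [k, j]) i f - insert_cost (u @ [k]) j (insort i f) = D (u @ [k]) i j f"
      using Cons.IH[of "u @ [k]"] le s \<open>j < i\<close> by simp
    have c1: "insert_cost (u @ [i,k]) j f - insert_cost (u @ [k,i]) j f =
        D u i k (j # f) - D u i k (insort j f)"
      using insert_cost_context[of u "[]" f i k j] le by simp
    have c2: "insert_cost (u @ [j,k]) i f - insert_cost (u @ [k,j]) i f =
        D u j k (i # f) - D u j k (insort i f)"
      using insert_cost_context[of u "[]" f j k i] le by simp
    have hx: "D u i j (k # f) + D (u @ [j]) i k f + D u j k (i # f) =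
      D (u @ [i]) j k f + D u i k (j # f) + D (u @ [k]) i j f"
      by (rule hexagon) (use le in simp)
    have "insert_cost (u @ [i]) j (k # f) + insert_cost u i (insort j (k # f))
      - insert_cost (u @ [j]) i (k # f) - insert_cost u j (insort i (k # f)) =
      D (u @ [i]) j k f + insert_cost (u @ [i,k]) j f + D u i k (insort j f)
      + insert_cost (u @ [k]) i (insort j f) - D (u @ [j]) i k f - insert_cost (u @ [j,k]) i f
      - D u j k (insort i f) - insert_cost (u @ [k]) j (insort i f)"
      using jk by (simp add: algebra_simps)
    also have "\<dots> = D (u @ [i]) j k f - D (u @ [j]) i k f + D u i k (insort j f) - D u j k (insort i f)
      + (insert_cost (u @ [i,k]) j f - insert_cost (u @ [k,i]) j f)
      - (insert_cost (u @ [j,k]) i f - insert_cost (u @ [k,j]) i f)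
      + (insert_cost (u @ [k, i]) j f + insert_cost (u @ [k]) i (insort j f)
      - insert_cost (u @ [k, j]) i f - insert_cost (u @ [k]) j (insort i f))"
      by (simp add: algebra_simps)
    also have "\<dots> = (D (u @ [i]) j k f + D u i k (j # f) + D (u @ [k]) i j f)
       - D (u @ [j]) i k f - D u j k (i # f)"
      unfolding IH c1 c2 by (simp add: algebra_simps)
    also have "\<dots> = D u i j (k # f)"
      unfolding hx[symmetric] by (simp add: algebra_simps)
    finally show ?thesis .
  qed
qed (auto simp: not_le)

lemma insert_cost_swap:
  assumes "length u + length f + 2 = n" "sorted f"
  shows "insert_cost (u @ [i]) j f + insert_cost u i (insort j f)
    - insert_cost (u @ [j]) i f - insert_cost u j (insort i f) = D u i j f"
proof -
  consider "i = j" | "j < i" | "i < j" by force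
  thus ?thesis
  proof cases
    case 1 thus ?thesis using refl assms by simp
  next
    case 2 thus ?thesis using insert_cost_swap_aux assms by blast
  next
    case 3
    from insert_cost_swap_aux[OF assms(1) 3 assms(2)] anti[OF assms(1), of i j]
    show ?thesis by (simp add: algebra_simps)
  qed
qed

text \<open>Letters before the swapped pair are inserted into the same sorted list on both sides, so
  only the pair itself matters.\<close>

lemma sort_cost_swap:
  assumes "length u + length p + length f + 2 = n"
  shows "sort_cost u (p @ [i,j] @ f) - sort_cost u (p @ [j,i] @ f) = D (u @ p) i j f"
  using assms
proof (induction p arbitrary: u)
  case Nil
  have "sort_cost (u @ [i,j]) f - sort_cost (u @ [j,i]) f = D u i j f - D u i j (sort f)"
    using sort_cost_context[of u "[]" f i j] Nil by simp
  moreover have "insert_cost (u @ [i]) j (sort f) + insert_cost u i (insort j (sort f))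
    - insert_cost (u @ [j]) i (sort f) - insert_cost u j (insort i (sort f)) = D u i j (sort f)"
    by (rule insert_cost_swap) (use Nil in simp_all)
  ultimately show ?case by (simp add: algebra_simps)
next
  case (Cons k p)
  have "sort (p @ [i,j] @ f) = sort (p @ [j,i] @ f)"
    by (simp flip: sorted_list_of_multiset_mset add: add_mset_commute)
  thus ?case using Cons by simp
qed

text \<open>The squares of \<open>comm\<close> and the hexagons of \<open>hexagon\<close> are the
  two-dimensional faces of the permutohedron. Since the total change around each of them is zero, a
  potential exists, and the cost of insertion sort is an explicit one.\<close>

lemma adjacent_swap_cocycle:
  "\<exists>E. \<forall>u i j f. length u + length f + 2 = n \<longrightarrow> E (u @ [i,j] @ f) - E (u @ [j,i] @ f) = D u i j f"
  using sort_cost_swap[of "[]"] by (intro exI[of _ "sort_cost []"]) simp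

end
end

section \<open>Finite groups of symplectic transformations\<close>

locale symplectic_action = finite_dimensional_vector_space scale Basis + group G
  for scale :: "complex \<Rightarrow> 'v::ab_group_add \<Rightarrow> 'v" (infixr \<open>*s\<close> 75)
    and Basis :: "'v set"
    and G :: "('g, 'm) monoid_scheme" (structure) +
  fixes \<omega> :: "'v \<Rightarrow> 'v \<Rightarrow> complex" and \<rho> :: "'g \<Rightarrow> 'v \<Rightarrow> 'v"
  assumes fin: "finite (carrier G)"
    and sympl: "symplectic_form scale \<omega>"
    and faithful: "\<And>g. g \<in> carrier G \<Longrightarrow> (\<And>x. \<rho> g x = x) \<Longrightarrow> g = \<one>"
    and rho_mult: "\<And>g h x. g \<in> carrier G \<Longrightarrow> h \<in> carrier G \<Longrightarrow> \<rho> (g \<otimes> h) x = \<rho> g (\<rho> h x)"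
    and rho_one: "\<rho> \<one> x = x"
    and rho_linear: "\<And>g. g \<in> carrier G \<Longrightarrow> Vector_Spaces.linear scale scale (\<rho> g)"
    and omega_invariant: "invariant_form G \<rho> \<omega>"
begin

abbreviation "N \<equiv> card (carrier G)"

lemma N_pos: "N > 0"
  using fin by (auto simp: card_gt_0_iff)

lemma form_linear:
  shows "\<omega> (x + y) z = \<omega> x z + \<omega> y z" "\<omega> z (x + y) = \<omega> z x + \<omega> z y"
    "\<omega> (a *s x) z = a * \<omega> x z" "\<omega> z (a *s x) = a * \<omega> z x"
    "\<omega> (x - y) z = \<omega> x z - \<omega> y z" "\<omega> z (x - y) = \<omega> z x - \<omega> z y"
    "\<omega> (- x) z = - \<omega> x z" "\<omega> z (- x) = - \<omega> z x" "\<omega> 0 z = 0" "\<omega> z 0 = 0"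
    "\<omega> (sum f A) z = (\<Sum>i\<in>A. \<omega> (f i) z)" "\<omega> z (sum f A) = (\<Sum>i\<in>A. \<omega> z (f i))"
proof -
  interpret l: Vector_Spaces.linear scale "(*)" "\<lambda>x. \<omega> x z"
    using sympl unfolding symplectic_form_def skew_bilinear_form_def by blast
  interpret r: Vector_Spaces.linear scale "(*)" "\<omega> z"
    using sympl unfolding symplectic_form_def skew_bilinear_form_def by blast
  show "\<omega> (x + y) z = \<omega> x z + \<omega> y z" "\<omega> z (x + y) = \<omega> z x + \<omega> z y"
    "\<omega> (a *s x) z = a * \<omega> x z" "\<omega> z (a *s x) = a * \<omega> z x"
    "\<omega> (x - y) z = \<omega> x z - \<omega> y z" "\<omega> z (x - y) = \<omega> z x - \<omega> z y"
    "\<omega> (- x) z = - \<omega> x z" "\<omega> z (- x) = - \<omega> z x" "\<omega> 0 z = 0" "\<omega> z 0 = 0"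
    "\<omega> (sum f A) z = (\<Sum>i\<in>A. \<omega> (f i) z)" "\<omega> z (sum f A) = (\<Sum>i\<in>A. \<omega> z (f i))"
    by (rule l.add r.add l.scale r.scale l.diff r.diff l.neg r.neg l.zero r.zero l.sum r.sum)+
qed

lemma form_skew: "\<omega> x y = - \<omega> y x"
  using sympl unfolding symplectic_form_def skew_bilinear_form_def by blast

lemma form_self [simp]: "\<omega> x x = 0"
  using form_skew[of x x] by simp

lemma form_nondegenerate: "(\<And>y. \<omega> x y = 0) \<Longrightarrow> x = 0"
  using sympl by (simp add: symplectic_form_def)

lemma rho_lin:
  assumes "g \<in> carrier G"
  shows "\<rho> g (x + y) = \<rho> g x + \<rho> g y" "\<rho> g (a *s x) = a *s \<rho> g x" "\<rho> g (x - y) = \<rho> g x - \<rho> g y"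
    "\<rho> g 0 = 0" "\<rho> g (- x) = - \<rho> g x" "\<rho> g (sum f A) = (\<Sum>i\<in>A. \<rho> g (f i))"
proof -
  interpret l: Vector_Spaces.linear scale scale "\<rho> g" by (rule rho_linear[OF assms])
  show "\<rho> g (x + y) = \<rho> g x + \<rho> g y" "\<rho> g (a *s x) = a *s \<rho> g x" "\<rho> g (x - y) = \<rho> g x - \<rho> g y"
    "\<rho> g 0 = 0" "\<rho> g (- x) = - \<rho> g x" "\<rho> g (sum f A) = (\<Sum>i\<in>A. \<rho> g (f i))"
    by (rule l.add l.scale l.diff l.zero l.neg l.sum)+
qed

lemma rho_inv [simp]:
  assumes "g \<in> carrier G"
  shows "\<rho> (inv g) (\<rho> g x) = x" "\<rho> g (\<rho> (inv g) x) = x"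
  using rho_mult[of "inv g" g x] rho_mult[of g "inv g" x] assms by (simp_all add: rho_one)

lemma form_rho [simp]: "g \<in> carrier G \<Longrightarrow> \<omega> (\<rho> g x) (\<rho> g y) = \<omega> x y"
  using omega_invariant by (simp add: invariant_form_def)

lemma form_rho_adjoint: "g \<in> carrier G \<Longrightarrow> \<omega> (\<rho> g x) y = \<omega> x (\<rho> (inv g) y)"
  using form_rho[of g x "\<rho> (inv g) y"] by simp

lemma map_rho_map: "g \<in> carrier G \<Longrightarrow> h \<in> carrier G \<Longrightarrow> map (\<rho> g) (map (\<rho> h) w) = map (\<rho> (g \<otimes> h)) w"
  by (simp add: rho_mult)

lemma map_rho_one [simp]: "map (\<rho> \<one>) w = w"
  by (induction w) (simp_all add: rho_one)

lemma mult_inv_cancel: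
  assumes "h \<in> carrier G" "g \<in> carrier G"
  shows "h \<otimes> (inv h \<otimes> g) = g" "inv h \<otimes> (h \<otimes> g) = g"
  using m_assoc[of h "inv h" g] m_assoc[of "inv h" h g] assms by simp_all

lemma bij_mult_left: "h \<in> carrier G \<Longrightarrow> bij_betw (\<lambda>g. h \<otimes> g) (carrier G) (carrier G)"
  by (rule bij_betw_byWitness[of _ "\<lambda>g. inv h \<otimes> g"]) (auto simp: mult_inv_cancel)

lemma bij_mult_right: "h \<in> carrier G \<Longrightarrow> bij_betw (\<lambda>g. g \<otimes> h) (carrier G) (carrier G)"
  by (rule bij_betw_byWitness[of _ "\<lambda>g. g \<otimes> inv h"]) (auto simp: m_assoc)

lemma bij_inv: "bij_betw (\<lambda>g. inv g) (carrier G) (carrier G)"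
  by (rule bij_betw_byWitness[of _ "\<lambda>g. inv g"]) auto

lemma bij_conj: "h \<in> carrier G \<Longrightarrow> bij_betw (\<lambda>g. h \<otimes> g \<otimes> inv h) (carrier G) (carrier G)"
  by (rule bij_betw_byWitness[of _ "\<lambda>g. inv h \<otimes> g \<otimes> h"])
    (auto simp: m_assoc mult_inv_cancel)

lemmas sum_mult_left = sum.reindex_bij_betw[OF bij_mult_left]
  and sum_mult_right = sum.reindex_bij_betw[OF bij_mult_right]
  and sum_inv = sum.reindex_bij_betw[OF bij_inv]
  and sum_conj = sum.reindex_bij_betw[OF bij_conj]

subsection \<open>The projection along the fixed space\<close>

text \<open>The powers of \<open>s\<close> run up to the order of the group, a multiple of the order
  of \<open>s\<close>, so that one formula serves all elements. The result is the projection to the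
  fixed space of \<open>s\<close> along the image of \<open>1 - s\<close>, and \<open>pr\<close> is
  the complementary projection.\<close>

definition avg :: "'g \<Rightarrow> 'v \<Rightarrow> 'v"
  where "avg s x = (1 / of_nat N) *s (\<Sum>i<N. \<rho> (s [^] i) x)"

definition pr :: "'g \<Rightarrow> 'v \<Rightarrow> 'v"
  where "pr s x = x - avg s x"

lemma rho_pow_Suc: "s \<in> carrier G \<Longrightarrow> \<rho> (s [^] Suc i) x = \<rho> s (\<rho> (s [^] (i::nat)) x)"
  using rho_mult[of s "s [^] i" x] nat_pow_Suc2[of s i] by (simp del: nat_pow_Suc)

lemma avg_lin:
  assumes "s \<in> carrier G"
  shows "avg s (x + y) = avg s x + avg s y" "avg s (a *s x) = a *s avg s x" "avg s (x - y) = avg s x - avg s y"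
  using assms
  by (simp_all add: avg_def rho_lin nat_pow_closed sum.distrib scale_right_distrib sum_subtractf
      scale_right_diff_distrib scale_left_commute flip: scale_sum_right)

lemma pr_lin:
  assumes "s \<in> carrier G"
  shows "pr s (x + y) = pr s x + pr s y" "pr s (a *s x) = a *s pr s x" "pr s (x - y) = pr s x - pr s y"
  using assms by (simp_all add: pr_def avg_lin scale_right_diff_distrib)

lemma avg_rho:
  assumes s: "s \<in> carrier G"
  shows "avg s (\<rho> s x) = avg s x"
proof -
  have "(\<Sum>i<N. \<rho> (s [^] i) (\<rho> s x)) = (\<Sum>i<N. \<rho> (s [^] Suc i) x)"
    using s by (simp add: rho_mult)
  also have "\<dots> = (\<Sum>i<N. \<rho> (s [^] i) x) + \<rho> (s [^] N) x - \<rho> (s [^] (0::nat)) x"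
    using sum.lessThan_Suc_shift[of "\<lambda>i. \<rho> (s [^] i) x" N] by (simp add: algebra_simps)
  also have "\<dots> = (\<Sum>i<N. \<rho> (s [^] i) x)"
    using pow_order_eq_1[OF s] by (simp add: Coset.order_def rho_one)
  finally show ?thesis by (simp add: avg_def)
qed

lemma rho_avg:
  assumes s: "s \<in> carrier G"
  shows "\<rho> s (avg s x) = avg s x"
proof -
  have "\<rho> s (\<rho> (s [^] i) x) = \<rho> (s [^] i) (\<rho> s x)" for i :: nat
    using rho_pow_Suc[OF s, of i x] s by (simp add: rho_mult)
  hence "\<rho> s (avg s x) = avg s (\<rho> s x)"
    using s by (simp add: avg_def rho_lin)
  thus ?thesis by (simp add: avg_rho[OF s])
qed

lemma avg_fixed:
  assumes s: "s \<in> carrier G" and "\<rho> s x = x"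
  shows "avg s x = x"
proof -
  have "\<rho> (s [^] i) x = x" for i :: nat
    by (induction i) (simp_all add: rho_one rho_mult s assms)
  thus ?thesis using N_pos
    by (simp add: avg_def sum_constant_scale)
qed

text \<open>Each \<open>1 - s^i\<close> is divisible by \<open>1 - s\<close>, and
  \<open>pr s\<close> is the mean of these operators.\<close>

lemma pr_in_range:
  assumes s: "s \<in> carrier G"
  shows "pr s x \<in> range (\<lambda>v. v - \<rho> s v)"
proof -
  have "\<exists>v. x - \<rho> (s [^] i) x = v - \<rho> s v" for i :: nat
  proof (induction i)
    case (Suc i)
    then obtain v where v: "x - \<rho> (s [^] i) x = v - \<rho> s v" by blast
    have "\<rho> (s [^] Suc i) x = \<rho> s (\<rho> (s [^] i) x)"
      by (rule rho_pow_Suc[OF s])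
    hence "x - \<rho> (s [^] Suc i) x = (v + \<rho> (s [^] i) x) - \<rho> s (v + \<rho> (s [^] i) x)"
      using v s by (simp add: rho_lin algebra_simps)
    thus ?case by blast
  qed (auto simp: rho_one intro!: exI[of _ 0] rho_lin s)
  then obtain v where v: "\<And>i::nat. x - \<rho> (s [^] i) x = v i - \<rho> s (v i)" by metis
  have "pr s x = (1 / of_nat N) *s (\<Sum>i<N. x - \<rho> (s [^] i) x)"
    using N_pos by (simp add: pr_def avg_def sum_subtractf scale_right_diff_distrib sum_constant_scale)
  also have "\<dots> = (1 / of_nat N) *s (\<Sum>i<N. v i) - \<rho> s ((1 / of_nat N) *s (\<Sum>i<N. v i))"
    by (simp add: v sum_subtractf scale_right_diff_distrib rho_lin s)
  finally show ?thesis by blast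
qed

text \<open>Uniqueness in the definite description holds because \<open>avg s\<close> kills the
  image of \<open>1 - s\<close> and fixes its kernel.\<close>

lemma proj_along_eq:
  assumes s: "s \<in> carrier G"
  shows "proj_along (range (\<lambda>v. v - \<rho> s v)) {v. v - \<rho> s v = 0} x = pr s x"
  unfolding proj_along_def
proof (rule the_equality)
  show "pr s x \<in> range (\<lambda>v. v - \<rho> s v) \<and> x - pr s x \<in> {v. v - \<rho> s v = 0}"
    using pr_in_range[OF s] rho_avg[OF s] by (simp add: pr_def)
next
  fix u assume u: "u \<in> range (\<lambda>v. v - \<rho> s v) \<and> x - u \<in> {v. v - \<rho> s v = 0}"
  then obtain v where v: "u = v - \<rho> s v" by blast
  have "avg s u = 0" by (simp add: v avg_lin avg_rho s)
  moreover have "avg s (x - u) = x - u"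
    by (rule avg_fixed[OF s]) (use u in \<open>simp add: algebra_simps\<close>)
  ultimately show "u = pr s x" by (simp add: pr_def avg_lin s)
qed

abbreviation "refl_form \<equiv> reflection_form \<omega> \<rho>"
abbreviation "refls \<equiv> symplectic_reflections scale G \<rho>"

lemma refl_form_eq: "s \<in> carrier G \<Longrightarrow> refl_form s x y = \<omega> (pr s x) (pr s y)"
  unfolding reflection_form_def Let_def by (simp only: proj_along_eq)

lemma rho_pr:
  assumes g: "g \<in> carrier G" and s: "s \<in> carrier G"
  shows "pr (g \<otimes> s \<otimes> inv g) (\<rho> g x) = \<rho> g (pr s x)"
proof -
  have "\<rho> ((g \<otimes> s \<otimes> inv g) [^] i) (\<rho> g x) = \<rho> g (\<rho> (s [^] i) x)" for i :: nat
  proof (induction i arbitrary: x)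
    case (Suc i)
    have "\<rho> (g \<otimes> s \<otimes> inv g) (\<rho> g x) = \<rho> g (\<rho> s x)" for x
      using g s by (simp add: rho_mult)
    thus ?case using Suc g s by (simp add: rho_mult)
  qed (simp add: rho_one)
  thus ?thesis using g by (simp add: pr_def avg_def rho_lin)
qed

lemma refl_form_conj:
  assumes g: "g \<in> carrier G" and s: "s \<in> carrier G"
  shows "refl_form (g \<otimes> s \<otimes> inv g) (\<rho> g x) (\<rho> g y) = refl_form s x y"
  using assms by (simp add: refl_form_eq rho_pr)

lemma diff_rho_pr: "s \<in> carrier G \<Longrightarrow> \<rho> s (pr s x) - pr s x = \<rho> s x - x"
  by (simp add: pr_def rho_lin rho_avg algebra_simps)

text \<open>Rank 2 enters here: the projection has its values in a plane, spanned by
  \<open>a\<close> and \<open>b\<close>. The coordinates are chosen pointwise.\<close>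

lemma reflection_coordinates:
  assumes "s \<in> refls"
  shows "\<exists>a b \<alpha> \<beta>. \<forall>x. pr s x = \<alpha> x *s a + \<beta> x *s b"
proof -
  have s: "s \<in> carrier G" and d: "dim (range (\<lambda>v. \<rho> s v - v)) = 2"
    using assms by (auto simp: symplectic_reflections_def)
  obtain B where B: "B \<subseteq> range (\<lambda>v. \<rho> s v - v)" "independent B"
      "range (\<lambda>v. \<rho> s v - v) \<subseteq> span B" "card B = 2"
    using basis_exists[of "range (\<lambda>v. \<rho> s v - v)"] d by metis
  then obtain a b where ab: "B = {a, b}" by (auto simp: card_2_iff)
  have "\<exists>\<alpha> \<beta>. pr s x = \<alpha> *s a + \<beta> *s b" for x
  proof -
    obtain v where "pr s x = v - \<rho> s v" using pr_in_range[OF s] by blast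
    hence "pr s x = \<rho> s (- v) - (- v)" by (simp add: rho_lin s)
    hence "pr s x \<in> span {a, b}" using B ab by blast
    then obtain \<alpha> where "pr s x - \<alpha> *s a \<in> span {b}" by (auto simp: span_insert)
    then obtain \<beta> where "pr s x - \<alpha> *s a = \<beta> *s b" by (auto simp: span_singleton)
    thus ?thesis by (metis add.commute diff_eq_eq)
  qed
  hence "\<forall>x. \<exists>q. pr s x = fst q *s a + snd q *s b"
    by (metis fst_conv snd_conv)
  then obtain q where "\<forall>x. pr s x = fst (q x) *s a + snd (q x) *s b"
    using choice[of "\<lambda>x q. pr s x = fst q *s a + snd q *s b"] by auto
  thus ?thesis by (intro exI[of _ a] exI[of _ b] exI[of _ "\<lambda>x. fst (q x)"] exI[of _ "\<lambda>x. snd (q x)"])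
qed

lemma refl_form_coordinates:
  assumes "s \<in> carrier G" "\<And>x. pr s x = \<alpha> x *s a + \<beta> x *s b"
  shows "refl_form s x y = (\<alpha> x * \<beta> y - \<beta> x * \<alpha> y) * \<omega> a b"
  using form_skew[of b a]
  by (simp add: refl_form_eq assms form_linear algebra_simps)

text \<open>Both \<omega>_s and \<open>s - 1\<close> factor through the plane of
  \<open>reflection_coordinates\<close>, and an alternating expression in three vectors of a plane
  vanishes.\<close>

lemma refl_form_jacobi:
  assumes s: "s \<in> refls"
  shows "refl_form s x y *s (\<rho> s z - z) + refl_form s y z *s (\<rho> s x - x)
    + refl_form s z x *s (\<rho> s y - y) = 0"
proof -
  have sG: "s \<in> carrier G" using s by (auto simp: symplectic_reflections_def)
  obtain a b \<alpha> \<beta> where "\<forall>x. pr s x = \<alpha> x *s a + \<beta> x *s b"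
    using reflection_coordinates[OF s] by (elim exE)
  hence c: "\<And>x. pr s x = \<alpha> x *s a + \<beta> x *s b" by (rule spec)
  define w where "w = \<omega> a b"
  have f: "refl_form s x y = (\<alpha> x * \<beta> y - \<beta> x * \<alpha> y) * w" for x y
    unfolding w_def by (rule refl_form_coordinates[OF sG c])
  define a' b' where "a' = \<rho> s a - a" and "b' = \<rho> s b - b"
  have T: "\<rho> s x - x = \<alpha> x *s a' + \<beta> x *s b'" for x
    unfolding diff_rho_pr[OF sG, symmetric, of x] c a'_def b'_def
    by (simp add: rho_lin sG scale_right_diff_distrib)
  have "refl_form s x y *s (\<rho> s z - z) + refl_form s y z *s (\<rho> s x - x) + refl_form s z x *s (\<rho> s y - y)
    = ((\<alpha> x * \<beta> y - \<beta> x * \<alpha> y) * w * \<alpha> z + (\<alpha> y * \<beta> z - \<beta> y * \<alpha> z) * w * \<alpha> x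
      + (\<alpha> z * \<beta> x - \<beta> z * \<alpha> x) * w * \<alpha> y) *s a'
    + ((\<alpha> x * \<beta> y - \<beta> x * \<alpha> y) * w * \<beta> z + (\<alpha> y * \<beta> z - \<beta> y * \<alpha> z) * w * \<beta> x
      + (\<alpha> z * \<beta> x - \<beta> z * \<alpha> x) * w * \<beta> y) *s b'"
    unfolding T f
    by (simp only: scale_right_distrib scale_left_distrib scale_scale add_ac)
  also have "\<dots> = 0"
    by (simp add: algebra_simps)
  finally show ?thesis .
qed

lemma refl_form_eq_0:
  assumes s: "s \<in> refls" and p: "\<rho> s p \<noteq> p"
    and x: "\<omega> (x - \<rho> s x) p = 0" and y: "\<omega> (y - \<rho> s y) p = 0"
  shows "refl_form s x y = 0"
proof -
  have sG: "s \<in> carrier G" using s by (auto simp: symplectic_reflections_def)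
  obtain a b \<alpha> \<beta> where "\<forall>x. pr s x = \<alpha> x *s a + \<beta> x *s b"
    using reflection_coordinates[OF s] by (elim exE)
  hence c: "\<And>x. pr s x = \<alpha> x *s a + \<beta> x *s b" by (rule spec)
  have T: "\<omega> (z - \<rho> s z) p = \<alpha> z * \<omega> (a - \<rho> s a) p + \<beta> z * \<omega> (b - \<rho> s b) p" for z
  proof -
    have "z - \<rho> s z = pr s z - \<rho> s (pr s z)"
      using diff_rho_pr[OF sG, of z] by (metis minus_diff_eq)
    hence "\<omega> (z - \<rho> s z) p = \<omega> (pr s z - \<rho> s (pr s z)) p" by (rule arg_cong)
    thus ?thesis unfolding c by (simp add: rho_lin sG form_linear algebra_simps)
  qed
  define A B where "A = \<omega> (a - \<rho> s a) p" and "B = \<omega> (b - \<rho> s b) p"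
  \<comment> \<open>\<open>A\<close> and \<open>B\<close> are the coefficients of
    \<open>z \<mapsto> \<omega> (z - \<rho> s z) p\<close> in the coordinates of the plane. If both
    were zero, nondegeneracy would give that \<open>s\<close> fixes \<open>p\<close>. So
    \<open>x\<close> and \<open>y\<close> project to one line, the kernel of this functional, and
    their determinant is zero.\<close>
  have "A \<noteq> 0 \<or> B \<noteq> 0"
  proof (rule ccontr)
    assume "\<not> ?thesis"
    hence z: "\<omega> (z - \<rho> s z) p = 0" for z using T[of z] by (simp flip: A_def B_def)
    have "\<omega> (\<rho> s p - p) (\<rho> s z) = 0" for z
      using z[of z] form_skew[of "z - \<rho> s z" p] form_rho[OF sG, of p z]
      by (simp add: form_linear)
    hence "\<omega> (\<rho> s p - p) z = 0" for z
      using rho_inv(2)[OF sG, of z] by metis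
    thus False using form_nondegenerate[of "\<rho> s p - p"] p by simp
  qed
  moreover have e: "\<alpha> x * A + \<beta> x * B = 0" "\<alpha> y * A + \<beta> y * B = 0"
    using x y T[of x] T[of y] by (simp_all flip: A_def B_def)
  have "A * (\<alpha> x * \<beta> y - \<beta> x * \<alpha> y) = \<beta> y * (\<alpha> x * A + \<beta> x * B) - \<beta> x * (\<alpha> y * A + \<beta> y * B)"
    "B * (\<alpha> x * \<beta> y - \<beta> x * \<alpha> y) = \<alpha> x * (\<alpha> y * A + \<beta> y * B) - \<alpha> y * (\<alpha> x * A + \<beta> x * B)"
    by (simp_all add: algebra_simps)
  ultimately have "\<alpha> x * \<beta> y - \<beta> x * \<alpha> y = 0"
    unfolding e by auto
  thus ?thesis by (simp add: refl_form_coordinates[OF sG c])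
qed

end

locale symplectic_reflection_data = symplectic_action scale Basis G \<omega> \<rho>
  for scale :: "complex \<Rightarrow> 'v::ab_group_add \<Rightarrow> 'v" (infixr \<open>*s\<close> 75)
    and Basis and G :: "('g, 'm) monoid_scheme" (structure) and \<omega> \<rho> +
  fixes t :: complex and c :: "'g \<Rightarrow> complex"
  assumes c_conj: "\<And>g s. g \<in> carrier G \<Longrightarrow> s \<in> symplectic_reflections scale G \<rho> \<Longrightarrow> c (g \<otimes> s \<otimes> inv g) = c s"
begin

text \<open>With these coefficients the defining relation reads: the commutator of \<open>x\<close>
  and \<open>y\<close> is the sum of \<open>\<kappa> g x y\<close> times \<open>g\<close> over the
  whole group.\<close>

definition \<kappa> :: "'g \<Rightarrow> 'v \<Rightarrow> 'v \<Rightarrow> complex"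
  where "\<kappa> g x y = (if g = \<one> then t * \<omega> x y else 0)
    + (if g \<in> refls then - 2 * c g * refl_form g x y else 0)"

lemma refls_carrier: "s \<in> refls \<Longrightarrow> s \<in> carrier G"
  by (simp add: symplectic_reflections_def)

lemma refls_conj:
  assumes g: "g \<in> carrier G" and s: "s \<in> refls"
  shows "g \<otimes> s \<otimes> inv g \<in> refls"
proof -
  have sG: "s \<in> carrier G" using s by (rule refls_carrier)
  have lin: "Vector_Spaces.linear scale scale (\<rho> g)" by (rule rho_linear[OF g])
  have "\<rho> (g \<otimes> s \<otimes> inv g) v - v = \<rho> g (\<rho> s (\<rho> (inv g) v) - \<rho> (inv g) v)" for v
    using g sG by (simp add: rho_mult rho_lin)
  hence "range (\<lambda>v. \<rho> (g \<otimes> s \<otimes> inv g) v - v) = \<rho> g ` ((\<lambda>v. \<rho> s v - v) ` range (\<rho> (inv g)))"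
    by (simp add: image_image)
  also have "range (\<rho> (inv g)) = UNIV"
    using rho_inv(1)[OF g] by (metis surjI)
  finally have r: "range (\<lambda>v. \<rho> (g \<otimes> s \<otimes> inv g) v - v) = \<rho> g ` range (\<lambda>v. \<rho> s v - v)" .
  interpret vp: finite_dimensional_vector_space_pair_1 scale Basis scale ..
  have "inj (\<rho> g)" using rho_inv(1)[OF g] by (metis injI)
  hence "dim (\<rho> g ` range (\<lambda>v. \<rho> s v - v)) = dim (range (\<lambda>v. \<rho> s v - v))"
    by (intro vp.dim_image_eq[OF lin]) (auto intro: inj_on_subset)
  thus ?thesis
    using s g sG by (simp add: symplectic_reflections_def r)
qed

lemma refls_conj_iff:
  assumes "g \<in> carrier G" "s \<in> carrier G"
  shows "g \<otimes> s \<otimes> inv g \<in> refls \<longleftrightarrow> s \<in> refls"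
proof
  assume "g \<otimes> s \<otimes> inv g \<in> refls"
  from refls_conj[OF _ this, of "inv g"] show "s \<in> refls"
    using assms by (simp add: m_assoc mult_inv_cancel)
qed (use assms refls_conj in blast)

lemma conj_eq_one_iff:
  assumes "g \<in> carrier G" "s \<in> carrier G"
  shows "g \<otimes> s \<otimes> inv g = \<one> \<longleftrightarrow> s = \<one>"
proof
  assume "g \<otimes> s \<otimes> inv g = \<one>"
  hence "inv g \<otimes> (g \<otimes> s \<otimes> inv g) \<otimes> g = \<one>" using assms by simp
  thus "s = \<one>" using assms by (simp add: m_assoc mult_inv_cancel)
qed (use assms in simp)

lemma kappa_conj:
  assumes "h \<in> carrier G" "g \<in> carrier G"
  shows "\<kappa> (h \<otimes> g \<otimes> inv h) (\<rho> h x) (\<rho> h y) = \<kappa> g x y"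
  using assms by (simp add: \<kappa>_def conj_eq_one_iff refls_conj_iff refl_form_conj c_conj)

lemma kappa_skew: "g \<in> carrier G \<Longrightarrow> \<kappa> g x y = - \<kappa> g y x"
  using form_skew[of x y] form_skew[of "pr g x" "pr g y"]
  by (auto simp: \<kappa>_def refl_form_eq)

lemma kappa_linear:
  assumes "g \<in> carrier G"
  shows "\<kappa> g (a *s x + b *s y) z = a * \<kappa> g x z + b * \<kappa> g y z"
    "\<kappa> g z (a *s x + b *s y) = a * \<kappa> g z x + b * \<kappa> g z y"
  using assms by (auto simp: \<kappa>_def refl_form_eq pr_lin form_linear algebra_simps)

text \<open>This is the coefficient of \<open>g\<close> in the Jacobi identity for \<open>x\<close>,
  \<open>y\<close>, \<open>z\<close>, because \<open>g z - z g = (\<rho> g z - z) g\<close> in the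
  smash product. The part with \<open>t\<close> drops out as the identity moves no vector.\<close>

lemma kappa_jacobi:
  assumes "g \<in> carrier G"
  shows "\<kappa> g x y *s (\<rho> g z - z) + \<kappa> g y z *s (\<rho> g x - x) + \<kappa> g z x *s (\<rho> g y - y) = 0"
proof -
  define q where "q = - 2 * c g"
  have "\<kappa> g x y *s (\<rho> g z - z) = (if g \<in> refls then q *s (refl_form g x y *s (\<rho> g z - z)) else 0)" for x y z
    by (cases "g = \<one>") (simp_all add: \<kappa>_def rho_one q_def)
  hence "\<kappa> g x y *s (\<rho> g z - z) + \<kappa> g y z *s (\<rho> g x - x) + \<kappa> g z x *s (\<rho> g y - y) =
    (if g \<in> refls then q *s (refl_form g x y *s (\<rho> g z - z) + refl_form g y z *s (\<rho> g x - x)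
      + refl_form g z x *s (\<rho> g y - y)) else 0)"
    by (simp add: scale_right_distrib)
  thus ?thesis by (simp add: refl_form_jacobi)
qed

section \<open>The Poincare-Birkhoff-Witt functionals\<close>

definition multilinear :: "('v list \<Rightarrow> complex) \<Rightarrow> bool"
  where "multilinear \<l> \<longleftrightarrow> (\<forall>u f x y a b.
    \<l> (u @ (a *s x + b *s y) # f) = a * \<l> (u @ x # f) + b * \<l> (u @ y # f))"

lemma multilinearD:
  "multilinear \<l> \<Longrightarrow> \<l> (u @ (a *s x + b *s y) # f) = a * \<l> (u @ x # f) + b * \<l> (u @ y # f)"
  by (simp add: multilinear_def)

lemma multilinear_scale: "multilinear \<l> \<Longrightarrow> \<l> (u @ (a *s x) # f) = a * \<l> (u @ x # f)"
  using multilinearD[of \<l> u a x 0 x f] by simp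

lemma multilinear_add: "multilinear \<l> \<Longrightarrow> \<l> (u @ (x + y) # f) = \<l> (u @ x # f) + \<l> (u @ y # f)"
  using multilinearD[of \<l> u 1 x 1 y f] by simp

lemma multilinear_diff: "multilinear \<l> \<Longrightarrow> \<l> (u @ (x - y) # f) = \<l> (u @ x # f) - \<l> (u @ y # f)"
  using multilinearD[of \<l> u 1 x "-1" y f] by simp

lemma multilinear_0: "multilinear \<l> \<Longrightarrow> \<l> (u @ 0 # f) = 0"
  using multilinear_scale[of \<l> u 0 0 f] by simp

definition d :: nat where "d = card Basis"

definition e :: "nat \<Rightarrow> 'v" where "e = (SOME e. bij_betw e {..<d} Basis)"

definition coord :: "nat \<Rightarrow> 'v \<Rightarrow> complex" where "coord i v = representation Basis v (e i)"

lemma bij_e: "bij_betw e {..<d} Basis"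
proof -
  have "\<exists>e. bij_betw e {..<d} Basis"
    using ex_bij_betw_nat_finite[OF finite_Basis] by (simp add: atLeast0LessThan d_def)
  thus ?thesis unfolding e_def by (rule someI_ex)
qed

lemma e_in_Basis: "i < d \<Longrightarrow> e i \<in> Basis"
  using bij_e by (auto simp: bij_betw_def)

lemma coord_expand: "v = (\<Sum>i<d. coord i v *s e i)"
proof -
  have "v = (\<Sum>b\<in>Basis. representation Basis v b *s b)"
    using sum_representation_eq[OF independent_Basis _ finite_Basis order_refl, of v]
    by (simp add: span_Basis)
  also have "\<dots> = (\<Sum>i<d. coord i v *s e i)"
    unfolding coord_def by (rule sum.reindex_bij_betw[OF bij_e, symmetric])
  finally show ?thesis .
qed

lemma coord_linear: "coord i (a *s x + b *s y) = a * coord i x + b * coord i y"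
  by (simp add: coord_def representation_add[OF independent_Basis]
      representation_scale[OF independent_Basis] span_Basis)

lemma coord_e: "i < d \<Longrightarrow> j < d \<Longrightarrow> coord i (e j) = (if i = j then 1 else 0)"
  using bij_e e_in_Basis
  by (auto simp: coord_def representation_basis[OF independent_Basis] bij_betw_def inj_on_def)

fun mexp :: "(nat list \<Rightarrow> complex) \<Rightarrow> 'v list \<Rightarrow> complex" where
  "mexp E [] = E []"
| "mexp E (v # w) = (\<Sum>i<d. coord i v * mexp (\<lambda>\<alpha>. E (i # \<alpha>)) w)"

lemma multilinear_mexp: "multilinear (mexp E)"
proof -
  have "mexp E (u @ (a *s x + b *s y) # f) = a * mexp E (u @ x # f) + b * mexp E (u @ y # f)" for u f x y a b
    by (induction u arbitrary: E)
      (simp_all add: coord_linear algebra_simps sum.distrib sum_distrib_left)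
  thus ?thesis by (simp add: multilinear_def)
qed

lemma mexp_basis: "set \<alpha> \<subseteq> {..<d} \<Longrightarrow> mexp E (map e \<alpha>) = E \<alpha>"
proof (induction \<alpha> arbitrary: E)
  case (Cons j \<alpha>)
  have "(\<Sum>i<d. coord i (e j) * mexp (\<lambda>\<alpha>. E (i # \<alpha>)) (map e \<alpha>)) = (\<Sum>i<d. if i = j then E (j # \<alpha>) else 0)"
    using Cons by (intro sum.cong) (auto simp: coord_e)
  thus ?case using Cons by simp
qed simp

lemma multilinear_eq_0:
  assumes ml: "\<And>u f x y a b. length u + length f + 1 = n \<Longrightarrow>
      F (u @ (a *s x + b *s y) # f) = a * F (u @ x # f) + b * F (u @ y # f)"
    and z: "\<And>\<alpha>. set \<alpha> \<subseteq> {..<d} \<Longrightarrow> length \<alpha> = n \<Longrightarrow> F (map e \<alpha>) = 0"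
    and n: "length w = n"
  shows "F w = (0::complex)"
proof -
  have sc: "F (u @ (a *s x) # f) = a * F (u @ x # f)" if "length u + length f + 1 = n" for u f x a
    using ml[OF that, of a x 0 x] by simp
  have ad: "F (u @ (x + y) # f) = F (u @ x # f) + F (u @ y # f)" if "length u + length f + 1 = n" for u f x y
    using ml[OF that, of 1 x 1 y] by simp
  have ze: "F (u @ 0 # f) = 0" if "length u + length f + 1 = n" for u f
    using sc[OF that, of 0 0] by simp
  have su: "F (u @ (\<Sum>i\<in>A. h i) # f) = (\<Sum>i\<in>A. F (u @ h i # f))" if "length u + length f + 1 = n" for u f h and A :: "nat set"
    by (induction A rule: infinite_finite_induct) (simp_all add: ze[OF that] ad[OF that])
  \<comment> \<open>The letters are expanded in the basis one after the other from the left;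
    \<alpha> collects the indices already reached.\<close>
  have "F (map e \<alpha> @ w) = 0" if "set \<alpha> \<subseteq> {..<d}" "length \<alpha> + length w = n" for \<alpha>
    using that
  proof (induction w arbitrary: \<alpha>)
    case (Cons v w)
    have "F (map e \<alpha> @ v # w) = (\<Sum>i<d. coord i v * F (map e \<alpha> @ e i # w))"
      by (subst coord_expand[of v]) (use Cons.prems in \<open>simp add: su sc\<close>)
    also have "\<dots> = 0"
    proof (intro sum.neutral ballI)
      fix i assume "i \<in> {..<d}"
      thus "coord i v * F (map e \<alpha> @ e i # w) = 0"
        using Cons.IH[of "\<alpha> @ [i]"] Cons.prems by simp
    qed
    finally show ?case .
  qed (use z in simp)
  from this[of "[]"] n show ?thesis by simp
qed

text \<open>Such functionals live on \<open>H e\<close>: a group element produced by a commutator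
  travels to the right, acts on the letters of \<open>f\<close> and is absorbed by \<open>e\<close>.
  The bound \<open>n\<close> allows a construction degree by degree.\<close>

definition pbw_relation :: "nat \<Rightarrow> ('v list \<Rightarrow> complex) \<Rightarrow> bool"
  where "pbw_relation n \<l> \<longleftrightarrow> (\<forall>u x y f. length u + length f + 2 \<le> n \<longrightarrow>
    \<l> (u @ [x,y] @ f) - \<l> (u @ [y,x] @ f) = (\<Sum>g\<in>carrier G. \<kappa> g x y * \<l> (u @ map (\<rho> g) f)))"

text \<open>Two kinds of loops have to be checked. For disjoint swaps the conjugation equivariance
  of \<kappa> is responsible, for three letters its Jacobi identity.\<close>

lemma pbw_commutator_cocycle:
  assumes rel: "pbw_relation n \<l>" and ml: "multilinear \<l>"
    and D: "D = (\<lambda>u i j f. \<Sum>g\<in>carrier G. \<kappa> g (e i) (e j) * \<l> (map e u @ map (\<rho> g) (map e f)))"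
  shows "\<exists>E. \<forall>u i j f. length u + length f + 2 = Suc n \<longrightarrow> E (u @ [i,j] @ f) - E (u @ [j,i] @ f) = D u i j f"
proof (rule adjacent_swap_cocycle)
  fix u f :: "nat list" and i j
  show "D u i j f = - D u j i f"
    unfolding D sum_negf[symmetric]
    by (intro sum.cong refl) (subst kappa_skew, simp_all)
  have "\<kappa> g (e i) (e i) = 0" if "g \<in> carrier G" for g
    using kappa_skew[OF that, of "e i" "e i"] by simp
  thus "D u i i f = 0" unfolding D by simp
next
  fix u f h :: "nat list" and i j k l
  assume le: "length u + length f + length h + 4 = Suc n"
  let ?s = "\<lambda>g h'. \<l> (map e u @ map (\<rho> g) (map e f) @ map (\<rho> (h' \<otimes> g)) (map e h))"
  have "D u i j (f @ [k,l] @ h) - D u i j (f @ [l,k] @ h) =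
    (\<Sum>g\<in>carrier G. \<kappa> g (e i) (e j) * (\<l> ((map e u @ map (\<rho> g) (map e f)) @ [\<rho> g (e k), \<rho> g (e l)] @ map (\<rho> g) (map e h))
      - \<l> ((map e u @ map (\<rho> g) (map e f)) @ [\<rho> g (e l), \<rho> g (e k)] @ map (\<rho> g) (map e h))))"
    by (simp add: D algebra_simps sum_subtractf)
  also have "\<dots> = (\<Sum>g\<in>carrier G. \<kappa> g (e i) (e j) *
      (\<Sum>h'\<in>carrier G. \<kappa> h' (\<rho> g (e k)) (\<rho> g (e l)) * ?s g h'))"
  proof (rule sum.cong[OF refl], rule arg_cong2[where f = "(*)", OF refl])
    fix g assume g: "g \<in> carrier G"
    have "\<l> ((map e u @ map (\<rho> g) (map e f)) @ [\<rho> g (e k), \<rho> g (e l)] @ map (\<rho> g) (map e h))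
      - \<l> ((map e u @ map (\<rho> g) (map e f)) @ [\<rho> g (e l), \<rho> g (e k)] @ map (\<rho> g) (map e h)) =
      (\<Sum>h'\<in>carrier G. \<kappa> h' (\<rho> g (e k)) (\<rho> g (e l)) * \<l> ((map e u @ map (\<rho> g) (map e f)) @ map (\<rho> h') (map (\<rho> g) (map e h))))"
      using rel[unfolded pbw_relation_def, rule_format, of "map e u @ map (\<rho> g) (map e f)" "map (\<rho> g) (map e h)" "\<rho> g (e k)" "\<rho> g (e l)"] le
      by simp
    also have "\<dots> = (\<Sum>h'\<in>carrier G. \<kappa> h' (\<rho> g (e k)) (\<rho> g (e l)) * ?s g h')"
      using g by (intro sum.cong refl) (simp only: map_rho_map append_assoc)
    finally show "\<l> ((map e u @ map (\<rho> g) (map e f)) @ [\<rho> g (e k), \<rho> g (e l)] @ map (\<rho> g) (map e h))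
      - \<l> ((map e u @ map (\<rho> g) (map e f)) @ [\<rho> g (e l), \<rho> g (e k)] @ map (\<rho> g) (map e h)) = \<dots>" .
  qed
  \<comment> \<open>Replacing \<open>h'\<close> by its conjugate under \<open>g\<close> undoes the
    action of \<open>g\<close> on the second pair of letters, by \<open>kappa_conj\<close>.
    Afterwards the suffix is moved by \<open>g \<otimes> h'\<close>, as in the other order of the
    two swaps.\<close>
  also have "\<dots> = (\<Sum>g\<in>carrier G. \<kappa> g (e i) (e j) *
      (\<Sum>h'\<in>carrier G. \<kappa> h' (e k) (e l) * ?s g (g \<otimes> h' \<otimes> inv g)))"
  proof (rule sum.cong[OF refl], rule arg_cong2[where f = "(*)", OF refl])
    fix g assume g: "g \<in> carrier G"
    show "(\<Sum>h'\<in>carrier G. \<kappa> h' (\<rho> g (e k)) (\<rho> g (e l)) * ?s g h') =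
      (\<Sum>h'\<in>carrier G. \<kappa> h' (e k) (e l) * ?s g (g \<otimes> h' \<otimes> inv g))"
      by (subst sum_conj[OF g, symmetric], intro sum.cong refl) (simp add: kappa_conj g)
  qed
  also have "\<dots> = (\<Sum>g\<in>carrier G. \<kappa> g (e i) (e j) *
      (\<Sum>h'\<in>carrier G. \<kappa> h' (e k) (e l) * \<l> (map e u @ map (\<rho> g) (map e f) @ map (\<rho> (g \<otimes> h')) (map e h))))"
    by (intro sum.cong refl) (simp add: m_assoc)
  also have "\<dots> = (\<Sum>h'\<in>carrier G. \<kappa> h' (e k) (e l) *
      (\<Sum>g\<in>carrier G. \<kappa> g (e i) (e j) * \<l> (map e u @ map (\<rho> g) (map e f) @ map (\<rho> (g \<otimes> h')) (map e h))))"
    unfolding sum_distrib_left by (subst sum.swap) (simp add: mult_ac)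
  also have "\<dots> = (\<Sum>h'\<in>carrier G. \<kappa> h' (e k) (e l) *
     (\<l> (map e u @ [e i, e j] @ map e f @ map (\<rho> h') (map e h)) - \<l> (map e u @ [e j, e i] @ map e f @ map (\<rho> h') (map e h))))"
  proof (rule sum.cong[OF refl], rule arg_cong2[where f = "(*)", OF refl])
    fix h' assume h': "h' \<in> carrier G"
    have "(\<Sum>g\<in>carrier G. \<kappa> g (e i) (e j) * \<l> (map e u @ map (\<rho> g) (map e f) @ map (\<rho> (g \<otimes> h')) (map e h))) =
      (\<Sum>g\<in>carrier G. \<kappa> g (e i) (e j) * \<l> (map e u @ map (\<rho> g) (map e f @ map (\<rho> h') (map e h))))"
      using h' by (intro sum.cong refl) (simp only: map_rho_map map_append)
    also have "\<dots> = \<l> (map e u @ [e i, e j] @ (map e f @ map (\<rho> h') (map e h))) - \<l> (map e u @ [e j, e i] @ (map e f @ map (\<rho> h') (map e h)))"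
      using rel[unfolded pbw_relation_def, rule_format, of "map e u" "map e f @ map (\<rho> h') (map e h)" "e i" "e j"] le
      by simp
    finally show "(\<Sum>g\<in>carrier G. \<kappa> g (e i) (e j) * \<l> (map e u @ map (\<rho> g) (map e f) @ map (\<rho> (g \<otimes> h')) (map e h))) =
      \<l> (map e u @ [e i, e j] @ map e f @ map (\<rho> h') (map e h)) - \<l> (map e u @ [e j, e i] @ map e f @ map (\<rho> h') (map e h))"
      by simp
  qed
  also have "\<dots> = D (u @ [i,j] @ f) k l h - D (u @ [j,i] @ f) k l h"
    by (simp add: D algebra_simps sum_subtractf)
  finally show "D u i j (f @ [k,l] @ h) - D u i j (f @ [l,k] @ h) =
    D (u @ [i,j] @ f) k l h - D (u @ [j,i] @ f) k l h" .
next
  fix u f :: "nat list" and i j k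
  let ?w = "\<lambda>g v::'v. \<l> (map e u @ v # map (\<rho> g) (map e f))"
  have diff: "D u i j (k # f) - D (u @ [k]) i j f =
    (\<Sum>g\<in>carrier G. ?w g (\<kappa> g (e i) (e j) *s (\<rho> g (e k) - e k)))" for i j k
    by (simp add: D multilinear_scale[OF ml] multilinear_diff[OF ml] algebra_simps sum_subtractf)
  \<comment> \<open>The cyclic sum gathers the left side of \<open>kappa_jacobi\<close> in the
    single slot between \<open>u\<close> and \<open>f\<close>.\<close>
  have "(D u i j (k # f) - D (u @ [k]) i j f) + (D u j k (i # f) - D (u @ [i]) j k f)
      + (D u k i (j # f) - D (u @ [j]) k i f) =
    (\<Sum>g\<in>carrier G. ?w g (\<kappa> g (e i) (e j) *s (\<rho> g (e k) - e k) + \<kappa> g (e j) (e k) *s (\<rho> g (e i) - e i)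
      + \<kappa> g (e k) (e i) *s (\<rho> g (e j) - e j)))"
    unfolding diff by (simp only: multilinear_add[OF ml] sum.distrib)
  also have "\<dots> = 0"
    by (simp add: kappa_jacobi multilinear_0[OF ml])
  finally have *: "(D u i j (k # f) - D (u @ [k]) i j f) + (D u j k (i # f) - D (u @ [i]) j k f)
      + (D u k i (j # f) - D (u @ [j]) k i f) = 0" .
  have anti: "D u i j f = - D u j i f" for u i j f
    unfolding D sum_negf[symmetric]
    by (intro sum.cong refl) (subst kappa_skew, simp_all)
  show "D u i j (k # f) + D (u @ [j]) i k f + D u j k (i # f) =
      D (u @ [i]) j k f + D u i k (j # f) + D (u @ [k]) i j f"
    using * anti[of u k i "j # f"] anti[of "u @ [j]" k i f] by (simp add: algebra_simps)
qed

text \<open>For words with one letter more, the relations prescribe how the functional changes under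
  swaps. The cocycle lemma yields values on basis words; multilinearity yields the others.\<close>

lemma pbw_extend:
  assumes rel: "pbw_relation n \<l>" and ml: "multilinear \<l>"
  shows "\<exists>\<l>'. pbw_relation (Suc n) \<l>' \<and> multilinear \<l>' \<and> (\<forall>w. length w \<le> n \<longrightarrow> \<l>' w = \<l> w)"
proof -
  define D where "D = (\<lambda>u i j f. \<Sum>g\<in>carrier G. \<kappa> g (e i) (e j) * \<l> (map e u @ map (\<rho> g) (map e f)))"
  obtain E where E: "\<And>u i j f. length u + length f + 2 = Suc n \<Longrightarrow> E (u @ [i,j] @ f) - E (u @ [j,i] @ f) = D u i j f"
    using pbw_commutator_cocycle[OF rel ml D_def] by blast
  \<comment> \<open>Length \<open>Suc n\<close> is the only new one tested by
    \<open>pbw_relation (Suc n)\<close>. On longer words the value is a placeholder that a further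
    extension may replace.\<close>
  define \<l>' where "\<l>' w = (if length w \<le> n then \<l> w else mexp E w)" for w
  have ml': "multilinear \<l>'"
    using ml multilinear_mexp[of E] by (auto simp: multilinear_def \<l>'_def)
  let ?H = "\<lambda>u x y f. \<l>' (u @ [x,y] @ f) - \<l>' (u @ [y,x] @ f) - (\<Sum>g\<in>carrier G. \<kappa> g x y * \<l> (u @ map (\<rho> g) f))"
  have H1: "?H (u @ (a *s p + b *s q) # u') x y f = a * ?H (u @ p # u') x y f + b * ?H (u @ q # u') x y f"
    for u u' p q x y f a b
    using multilinearD[OF ml', of u a p b q "u' @ [x,y] @ f"] multilinearD[OF ml', of u a p b q "u' @ [y,x] @ f"]
      multilinearD[OF ml, of u a p b q]
    by (simp add: algebra_simps sum.distrib sum_distrib_left)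
  have H4: "?H u x y (f @ (a *s p + b *s q) # f') = a * ?H u x y (f @ p # f') + b * ?H u x y (f @ q # f')"
    for u p q x y f f' a b
    using multilinearD[OF ml', of "u @ [x,y] @ f" a p b q f'] multilinearD[OF ml', of "u @ [y,x] @ f" a p b q f']
      multilinearD[OF ml, of "u @ map (\<rho> g) f" a "\<rho> g p" b "\<rho> g q" "map (\<rho> g) f'" for g]
    by (simp add: algebra_simps sum.distrib sum_distrib_left rho_lin)
  have H2: "?H u (a *s p + b *s q) y f = a * ?H u p y f + b * ?H u q y f" for u p q y f a b
    using multilinearD[OF ml', of u a p b q "[y] @ f"] multilinearD[OF ml', of "u @ [y]" a p b q f]
    by (simp add: algebra_simps sum.distrib sum_distrib_left kappa_linear)
  have H3: "?H u x (a *s p + b *s q) f = a * ?H u x p f + b * ?H u x q f" for u p q x f a b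
    using multilinearD[OF ml', of u a p b q "[x] @ f"] multilinearD[OF ml', of "u @ [x]" a p b q f]
    by (simp add: algebra_simps sum.distrib sum_distrib_left kappa_linear)
  have Hb: "?H (map e \<alpha>) (e i) (e j) (map e \<beta>) = 0"
    if "set \<alpha> \<subseteq> {..<d}" "set \<beta> \<subseteq> {..<d}" "i < d" "j < d" "length \<alpha> + length \<beta> + 2 = Suc n" for \<alpha> \<beta> i j
  proof -
    have "\<l>' (map e \<alpha> @ [e i, e j] @ map e \<beta>) = E (\<alpha> @ [i,j] @ \<beta>)" if "i < d" "j < d" for i j
      using mexp_basis[of "\<alpha> @ [i,j] @ \<beta>" E] that \<open>set \<alpha> \<subseteq> _\<close> \<open>set \<beta> \<subseteq> _\<close> \<open>_ + 2 = _\<close>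
      by (simp add: \<l>'_def)
    thus ?thesis using E[of \<alpha> \<beta> i j] that by (simp add: D_def)
  qed
  have Hx: "?H (map e \<alpha>) x y (map e \<beta>) = 0"
    if "set \<alpha> \<subseteq> {..<d}" "set \<beta> \<subseteq> {..<d}" "length \<alpha> + length \<beta> + 2 = Suc n" for \<alpha> \<beta> x y
  proof -
    let ?F = "\<lambda>w. ?H (map e \<alpha>) (w ! 0) (w ! 1) (map e \<beta>)"
    have "?F [x,y] = 0"
    proof (rule multilinear_eq_0[where F = ?F and n = 2])
      fix u f :: "'v list" and p q a b assume le: "length u + length f + 1 = 2"
      then consider z where "u = []" "f = [z]" | z where "u = [z]" "f = []"
        by (cases u; cases f) (auto simp: length_Suc_conv)
      thus "?F (u @ (a *s p + b *s q) # f) = a * ?F (u @ p # f) + b * ?F (u @ q # f)"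
      proof cases
        case 1 thus ?thesis using H2[of "map e \<alpha>" a p b q z "map e \<beta>"] by simp
      next
        case 2 thus ?thesis using H3[of "map e \<alpha>" z a p b q "map e \<beta>"] by simp
      qed
    next
      fix \<gamma> :: "nat list" assume "set \<gamma> \<subseteq> {..<d}" "length \<gamma> = 2"
      then obtain i j where "\<gamma> = [i,j]" "i < d" "j < d" by (auto simp: numeral_2_eq_2 length_Suc_conv)
      thus "?F (map e \<gamma>) = 0" using Hb[of \<alpha> \<beta> i j] that by simp
    qed simp
    thus ?thesis by simp
  qed
  have Hf: "?H (map e \<alpha>) x y f = 0"
    if "set \<alpha> \<subseteq> {..<d}" "length \<alpha> + length f + 2 = Suc n" for \<alpha> x y f
    by (rule multilinear_eq_0[where F = "?H (map e \<alpha>) x y" and n = "length f"])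
      (use H4 Hx that in auto)
  have H: "?H u x y f = 0" if "length u + length f + 2 = Suc n" for u x y f
    by (rule multilinear_eq_0[where F = "\<lambda>u. ?H u x y f" and n = "length u"])
      (use H1 Hf that in auto)
  have "pbw_relation (Suc n) \<l>'"
    unfolding pbw_relation_def
  proof (intro allI impI)
    fix u f :: "'v list" and x y assume le: "length u + length f + 2 \<le> Suc n"
    have *: "(\<Sum>g\<in>carrier G. \<kappa> g x y * \<l>' (u @ map (\<rho> g) f)) = (\<Sum>g\<in>carrier G. \<kappa> g x y * \<l> (u @ map (\<rho> g) f))"
      using le by (simp add: \<l>'_def)
    show "\<l>' (u @ [x,y] @ f) - \<l>' (u @ [y,x] @ f) = (\<Sum>g\<in>carrier G. \<kappa> g x y * \<l>' (u @ map (\<rho> g) f))"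
    proof (cases "length u + length f + 2 = Suc n")
      case True
      thus ?thesis using H[of u f x y] by (simp add: *)
    next
      case False
      thus ?thesis using rel le unfolding * by (simp add: pbw_relation_def \<l>'_def)
    qed
  qed
  moreover have "\<forall>w. length w \<le> n \<longrightarrow> \<l>' w = \<l> w" by (simp add: \<l>'_def)
  ultimately show ?thesis using ml' by blast
qed

text \<open>The start is a symmetric product in length \<open>M\<close> and 0 elsewhere. It obeys
  the relations up to length \<open>M\<close> because their right sides involve words two letters
  shorter. On words of length at most \<open>M\<close> the result therefore reads off the leading
  symbol at \<open>p\<close>.\<close>

lemma pbw_functional:
  obtains \<l> where "multilinear \<l>" "\<And>n. pbw_relation n \<l>"
    "\<And>w. length w < M \<Longrightarrow> \<l> w = 0" "\<And>w. length w = M \<Longrightarrow> \<l> w = (\<Prod>x\<leftarrow>w. \<omega> x p)"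
proof -
  define \<l>0 where "\<l>0 w = (if length w = M then \<Prod>x\<leftarrow>w. \<omega> x p else 0)" for w
  have 0: "multilinear \<l>0" "pbw_relation M \<l>0"
    by (auto simp: multilinear_def pbw_relation_def \<l>0_def form_linear algebra_simps)
  have "\<exists>F. \<forall>n. (pbw_relation (M + n) (F n) \<and> multilinear (F n) \<and> (n = 0 \<longrightarrow> F n = \<l>0)) \<and>
    (\<forall>w. length w \<le> M + n \<longrightarrow> F (Suc n) w = F n w)"
  proof (rule dependent_nat_choice)
    show "\<exists>x. pbw_relation (M + 0) x \<and> multilinear x \<and> (0 = (0::nat) \<longrightarrow> x = \<l>0)" using 0 by auto
  qed (use pbw_extend in auto)
  then obtain F where F: "\<And>n. pbw_relation (M + n) (F n)" "\<And>n. multilinear (F n)" "F 0 = \<l>0"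
    "\<And>n w. length w \<le> M + n \<Longrightarrow> F (Suc n) w = F n w" by blast
  have mono: "F (n + k) w = F n w" if "length w \<le> M + n" for n k w
    using that by (induction k) (simp_all add: F(4))
  \<comment> \<open>Later stages agree with earlier ones on short words, so each word may use the
    stage numbered by its own length.\<close>
  define \<l> where "\<l> w = F (length w) w" for w
  have \<l>: "\<l> w = F n w" if "length w \<le> M + n" for n w
  proof -
    have "F (length w) w = F (length w + n) w" by (rule mono[symmetric]) simp
    also have "\<dots> = F n w" using mono[OF that, of "length w"] by (simp add: add.commute)
    finally show ?thesis by (simp add: \<l>_def)
  qed
  show ?thesis
  proof (rule that)
    show "multilinear \<l>"
      unfolding multilinear_def
    proof (intro allI)
      fix u f :: "'v list" and x y a b
      show "\<l> (u @ (a *s x + b *s y) # f) = a * \<l> (u @ x # f) + b * \<l> (u @ y # f)"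
        using multilinearD[OF F(2)[of "length u + length f + 1"], of u a x b y f]
        by (simp add: \<l>_def)
    qed
    show "pbw_relation n \<l>" for n
      unfolding pbw_relation_def
    proof (intro allI impI)
      fix u f :: "'v list" and x y
      let ?n = "length u + length f + 2"
      have "\<l> w = F ?n w" if "length w \<le> ?n" for w by (rule \<l>) (use that in simp)
      moreover have "length u + length f + 2 \<le> M + ?n" by simp
      ultimately show "\<l> (u @ [x,y] @ f) - \<l> (u @ [y,x] @ f) = (\<Sum>g\<in>carrier G. \<kappa> g x y * \<l> (u @ map (\<rho> g) f))"
        using F(1)[of ?n] unfolding pbw_relation_def by simp
    qed
    show "\<l> w = 0" if "length w < M" for w
      using \<l>[of w 0] that by (simp add: F(3) \<l>0_def)
    show "\<l> w = (\<Prod>x\<leftarrow>w. \<omega> x p)" if "length w = M" for w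
      using \<l>[of w 0] that by (simp add: F(3) \<l>0_def)
  qed
qed

end

section \<open>Biderivations of negative degree\<close>

text \<open>A regular function on the projective line that vanishes at infinity is zero; here it is
  \<open>n / m\<close>, with local denominators from \<open>loc\<close> and one for infinity from
  \<open>inf\<close>. By \<open>loc\<close> each root of \<open>m\<close> is also a root of
  \<open>n\<close> and can be cancelled, until \<open>m\<close> is constant and the degrees
  contradict \<open>inf\<close>.\<close>

lemma poly_ratio_eq_0:
  fixes n m :: "complex poly"
  assumes m: "m \<noteq> 0"
    and loc: "\<And>z. \<exists>n' m'. poly m' z \<noteq> 0 \<and> n * m' = m * n'"
    and inf: "m' \<noteq> 0" "n' = 0 \<or> Polynomial.degree n' < Polynomial.degree m'" "n * m' = m * n'"
  shows "n = 0"
  using m loc inf(3)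
proof (induction "Polynomial.degree m" arbitrary: n m)
  case 0
  show ?case
  proof (rule ccontr)
    assume n: "n \<noteq> 0"
    hence n': "n' \<noteq> 0" using 0(4) 0(2) inf(1) by auto
    have "Polynomial.degree n + Polynomial.degree m' = Polynomial.degree (n * m')"
      using n inf(1) by (simp add: degree_mult_eq)
    also have "\<dots> = Polynomial.degree n'"
      using 0(1,2,4) n' by (simp add: degree_mult_eq)
    finally show False using inf(2) n' by simp
  qed
next
  case (Suc k)
  have "\<not> constant (poly m)"
    using Suc(2) by (simp add: constant_degree)
  then obtain z where z: "poly m z = 0"
    using fundamental_theorem_of_algebra by blast
  obtain n1 m1 where nm: "poly m1 z \<noteq> 0" "n * m1 = m * n1" using Suc(4) by blast
  have "poly n z = 0"
    using arg_cong[OF nm(2), of "\<lambda>p. poly p z"] nm(1) z by simp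
  hence "[:-z, 1:] dvd n" "[:-z, 1:] dvd m"
    using z by (simp_all only: poly_eq_0_iff_dvd)
  then obtain a b where ab: "n = [:-z, 1:] * a" "m = [:-z, 1:] * b"
    by (elim dvdE)
  have x: "[:-z, 1:] \<noteq> 0" by simp
  have can: "a * p = b * q" if "n * p = m * q" for p q
  proof -
    have "[:-z, 1:] * (a * p) = [:-z, 1:] * (b * q)" using that by (simp only: ab mult.assoc)
    thus ?thesis using mult_left_cancel[OF x] by blast
  qed
  have b: "b \<noteq> 0" using ab Suc(3) by auto
  have "Polynomial.degree m = Suc (Polynomial.degree b)"
    unfolding ab by (subst degree_mult_eq) (use b in auto)
  hence "k = Polynomial.degree b" using Suc(2) by simp
  hence "a = 0"
    by (rule Suc(1)[OF _ b]) (use Suc(4,5) can in blast)+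
  thus ?case by (simp add: ab)
qed

lemma exists_avoiding:
  assumes "finite I" "\<And>i. i \<in> I \<Longrightarrow> a i \<noteq> 0 \<or> b i \<noteq> (0::complex)"
  shows "\<exists>\<mu>. \<forall>i\<in>I. a i + \<mu> * b i \<noteq> 0"
proof -
  \<comment> \<open>Where \<open>b i\<close> is 0 the quotient is 0 by convention, which excludes
    one more value and does no harm.\<close>
  have "finite ((\<lambda>i. - a i / b i) ` I)" using assms(1) by simp
  then obtain \<mu> where \<mu>: "\<mu> \<notin> (\<lambda>i. - a i / b i) ` I"
    using infinite_UNIV_char_0[where 'a = complex] by (metis UNIV_eq_I)
  have "a i + \<mu> * b i \<noteq> 0" if i: "i \<in> I" for i
  proof (cases "b i = 0")
    case False
    have "\<mu> \<noteq> - a i / b i" using \<mu> i by blast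
    thus ?thesis using False by (simp add: field_simps add_eq_0_iff)
  qed (use assms(2)[OF i] in simp)
  thus ?thesis by blast
qed

text \<open>Polynomials are formed with the vectors as formal variables, so \<open>var\<close> is
  not additive. Linearity in the variables is supplied by the functionals applied to them:
  evaluation at a point and derivations.\<close>

definition var :: "'v \<Rightarrow> 'v multiset \<Rightarrow>\<^sub>0 complex" where "var v = Poly_Mapping.single {#v#} 1"
definition cst :: "complex \<Rightarrow> 'v multiset \<Rightarrow>\<^sub>0 complex" where "cst a = Poly_Mapping.single 0 a"

lemma cst_add: "cst (a + b) = cst a + cst b" and cst_mult: "cst (a * b) = cst a * cst b"
  and cst_1 [simp]: "cst 1 = 1" and cst_0 [simp]: "cst 0 = 0" and cst_uminus: "cst (- a) = - cst a"
  by (simp_all add: cst_def single_add mult_single single_uminus)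

lemma cst_power: "cst (a ^ n) = cst a ^ n"
  by (induction n) (simp_all add: cst_mult)

lemma cst_sum: "cst (\<Sum>i\<in>A. f i) = (\<Sum>i\<in>A. cst (f i))"
  by (induction A rule: infinite_finite_induct) (simp_all add: cst_add)

lemma cst_prod: "cst (\<Prod>i\<in>A. f i) = (\<Prod>i\<in>A. cst (f i))"
  by (induction A rule: infinite_finite_induct) (simp_all add: cst_mult)

lemma lin_ext_cst: "lin_ext \<phi> (cst a * x) = a * lin_ext \<phi> x"
  unfolding cst_def by (rule lin_ext_scale)

lemma prod_var: "(\<Prod>h\<in>A. var (f h)) = Poly_Mapping.single (image_mset f (mset_set A)) 1"
  by (induction A rule: infinite_finite_induct) (simp_all add: var_def mult_single flip: single_one)

context symplectic_action
begin

section \<open>Vectors and points in general position\<close>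

lemma nonvanishing_vector:
  assumes "finite I" "\<And>i. i \<in> I \<Longrightarrow> z i \<noteq> 0"
  shows "\<exists>v. \<forall>i\<in>I. \<omega> v (z i) \<noteq> 0"
  using assms
proof (induction I)
  case (insert j I)
  then obtain v where v: "\<forall>i\<in>I. \<omega> v (z i) \<noteq> 0" by auto
  obtain w where w: "\<omega> w (z j) \<noteq> 0"
    using form_nondegenerate[of "z j"] insert(4)[of j] form_skew[of "z j"]
    by (metis insertI1 neg_equal_0_iff_equal)
  have "\<exists>\<mu>. \<forall>i\<in>insert j I. \<omega> v (z i) + \<mu> * \<omega> w (z i) \<noteq> 0"
    by (rule exists_avoiding) (use v w insert(1) in auto)
  then obtain \<mu> where "\<forall>i\<in>insert j I. \<omega> (v + \<mu> *s w) (z i) \<noteq> 0"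
    by (auto simp: form_linear)
  thus ?case by blast
qed simp

definition regular :: "'v \<Rightarrow> bool"
  where "regular p \<longleftrightarrow> (\<forall>h\<in>carrier G - {\<one>}. \<rho> h p \<noteq> p)"

text \<open>This is the derivative, at the root \<open>\<omega> v p\<close>, of the polynomial whose
  roots are the values at \<open>p\<close> of the orbit of \<open>v\<close>.\<close>

definition \<Delta> :: "'v \<Rightarrow> 'v \<Rightarrow> complex"
  where "\<Delta> p v = (\<Prod>h\<in>carrier G - {\<one>}. \<omega> v p - \<omega> (\<rho> h v) p)"

lemma Delta_nonzero_iff: "\<Delta> p v \<noteq> 0 \<longleftrightarrow> (\<forall>h\<in>carrier G - {\<one>}. \<omega> v p \<noteq> \<omega> (\<rho> h v) p)"
  using fin by (auto simp: \<Delta>_def)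

lemma exists_generic:
  assumes "regular p"
  shows "\<exists>u. \<Delta> p u \<noteq> 0"
proof -
  have "p - \<rho> (inv h) p \<noteq> 0" if h: "h \<in> carrier G - {\<one>}" for h
  proof
    assume "p - \<rho> (inv h) p = 0"
    hence "\<rho> h p = p" using rho_inv(2)[of h p] h by simp
    thus False using assms h by (auto simp: regular_def)
  qed
  then obtain u where u: "\<forall>h\<in>carrier G - {\<one>}. \<omega> u (p - \<rho> (inv h) p) \<noteq> 0"
    using nonvanishing_vector[of "carrier G - {\<one>}" "\<lambda>h. p - \<rho> (inv h) p"] fin by auto
  have "\<omega> u p \<noteq> \<omega> (\<rho> h u) p" if h: "h \<in> carrier G - {\<one>}" for h
  proof -
    have "\<omega> u (p - \<rho> (inv h) p) = \<omega> u p - \<omega> (\<rho> h u) p"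
      using h by (simp add: form_linear form_rho_adjoint)
    thus ?thesis using u h by auto
  qed
  thus ?thesis by (auto simp: Delta_nonzero_iff)
qed

text \<open>It serves to write any vector as a combination of the two generic vectors
  \<open>v + \<mu> *s u\<close> and \<open>u\<close>.\<close>

lemma exists_generic_shift:
  assumes "\<Delta> p u \<noteq> 0"
  shows "\<exists>\<mu>. \<Delta> p (v + \<mu> *s u) \<noteq> 0"
proof -
  have "\<exists>\<mu>. \<forall>h\<in>carrier G - {\<one>}. (\<omega> v p - \<omega> (\<rho> h v) p) + \<mu> * (\<omega> u p - \<omega> (\<rho> h u) p) \<noteq> 0"
    by (rule exists_avoiding) (use assms fin in \<open>auto simp: Delta_nonzero_iff\<close>)
  then obtain \<mu> where "\<forall>h\<in>carrier G - {\<one>}. (\<omega> v p - \<omega> (\<rho> h v) p) + \<mu> * (\<omega> u p - \<omega> (\<rho> h u) p) \<noteq> 0"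
    by blast
  hence "\<Delta> p (v + \<mu> *s u) \<noteq> 0"
    unfolding Delta_nonzero_iff by (auto simp: form_linear rho_lin algebra_simps)
  thus ?thesis by blast
qed

text \<open>
  That the fixed space of \<open>h\<close> has codimension at least 2 enters through the functional
  \<open>q \<mapsto> \<omega> (q - h q) (p - h p)\<close>: it is nonzero, and it vanishes at \<open>p\<close> because \<open>\<omega>\<close> is alternating.
\<close>

lemma exists_regular_plane:
  assumes p: "regular p"
  shows "\<exists>q. regular q \<and> (\<forall>\<tau>. regular (p + \<tau> *s q))"
proof -
  define a where "a h = p - \<rho> h p" for h
  \<comment> \<open>A fixed vector in the image of \<open>1 - h\<close> is zero, since
    \<open>avg h\<close> both fixes and kills it.\<close>
  have a: "\<rho> h (a h) \<noteq> a h" if h: "h \<in> carrier G - {\<one>}" for h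
  proof
    assume "\<rho> h (a h) = a h"
    hence "avg h (a h) = a h" using h by (intro avg_fixed) auto
    moreover have "avg h (a h) = 0" using h by (simp add: a_def avg_lin avg_rho)
    ultimately have "\<rho> h p = p" by (simp add: a_def)
    thus False using p h by (auto simp: regular_def)
  qed
  have "a h - \<rho> (inv h) (a h) \<noteq> 0" if h: "h \<in> carrier G - {\<one>}" for h
  proof
    assume "a h - \<rho> (inv h) (a h) = 0"
    hence "\<rho> h (a h) = a h" using rho_inv(2)[of h "a h"] h by simp
    thus False using a h by blast
  qed
  then obtain q where q: "\<forall>h\<in>carrier G - {\<one>}. \<omega> q (a h - \<rho> (inv h) (a h)) \<noteq> 0"
    using nonvanishing_vector[of "carrier G - {\<one>}" "\<lambda>h. a h - \<rho> (inv h) (a h)"] fin by auto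
  have *: "\<omega> (q - \<rho> h q) (a h) \<noteq> 0" if h: "h \<in> carrier G - {\<one>}" for h
  proof -
    have "\<omega> q (a h - \<rho> (inv h) (a h)) = \<omega> (q - \<rho> h q) (a h)"
      using h by (simp add: form_linear form_rho_adjoint)
    thus ?thesis using q h by auto
  qed
  have "\<rho> h q \<noteq> q" if "h \<in> carrier G - {\<one>}" for h
    using *[OF that] by (auto simp: form_linear)
  moreover have "\<rho> h (p + \<tau> *s q) \<noteq> p + \<tau> *s q" if h: "h \<in> carrier G - {\<one>}" for h \<tau>
  proof
    assume "\<rho> h (p + \<tau> *s q) = p + \<tau> *s q"
    hence e: "a h + \<tau> *s (q - \<rho> h q) = 0"
      using h by (simp add: a_def rho_lin scale_right_diff_distrib algebra_simps)
    hence "\<omega> (a h + \<tau> *s (q - \<rho> h q)) (a h) = 0" by (simp add: form_linear)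
    hence "\<tau> = 0" using *[OF h] by (simp add: form_linear(1,3))
    hence "\<rho> h p = p" using e by (simp add: a_def)
    thus False using p h by (auto simp: regular_def)
  qed
  ultimately show ?thesis by (auto simp: regular_def)
qed

section \<open>Evaluation of polynomials and the action of the group on them\<close>

definition monom_val :: "'v \<Rightarrow> 'v multiset \<Rightarrow> complex"
  where "monom_val p M = prod_mset (image_mset (\<lambda>v. \<omega> v p) M)"

definition ev :: "'v \<Rightarrow> ('v multiset \<Rightarrow>\<^sub>0 complex) \<Rightarrow> complex"
  where "ev p = lin_ext (monom_val p)"

definition act_poly :: "'g \<Rightarrow> ('v multiset \<Rightarrow>\<^sub>0 complex) \<Rightarrow> ('v multiset \<Rightarrow>\<^sub>0 complex)"
  where "act_poly g = push (image_mset (\<rho> g))"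

lemma ev_mult: "ev p (x * y) = ev p x * ev p y"
  unfolding ev_def by (rule lin_ext_mult) (simp add: monom_val_def)

lemma ev_add: "ev p (x + y) = ev p x + ev p y" and ev_diff: "ev p (x - y) = ev p x - ev p y"
  and ev_sum: "ev p (sum f A) = (\<Sum>i\<in>A. ev p (f i))" and ev_var: "ev p (var v) = \<omega> v p"
  and ev_cst: "ev p (cst a) = a" and ev_0: "ev p 0 = 0"
  by (simp_all add: ev_def lin_ext_add lin_ext_diff lin_ext_sum var_def cst_def monom_val_def)

lemma ev_1: "ev p 1 = 1"
  using ev_cst[of p 1] by simp

lemma ev_prod: "ev p (prod f A) = (\<Prod>i\<in>A. ev p (f i))"
  by (induction A rule: infinite_finite_induct) (simp_all add: ev_1 ev_mult)

lemma ev_power: "ev p (x ^ n) = ev p x ^ n"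
  by (induction n) (simp_all add: ev_1 ev_mult)

lemma act_poly_mult: "act_poly g (x * y) = act_poly g x * act_poly g y"
  unfolding act_poly_def by (rule push_mult) simp

lemma act_poly_add: "act_poly g (x + y) = act_poly g x + act_poly g y"
  and act_poly_diff: "act_poly g (x - y) = act_poly g x - act_poly g y"
  and act_poly_sum: "act_poly g (sum f A) = (\<Sum>i\<in>A. act_poly g (f i))"
  and act_poly_var: "act_poly g (var v) = var (\<rho> g v)" and act_poly_cst: "act_poly g (cst a) = cst a"
  by (simp_all add: act_poly_def push_add push_diff push_sum var_def cst_def)

lemma act_poly_1: "act_poly g 1 = 1"
  using act_poly_cst[of g 1] by simp

lemma act_poly_prod: "act_poly g (prod f A) = (\<Prod>i\<in>A. act_poly g (f i))"
  by (induction A rule: infinite_finite_induct) (simp_all add: act_poly_1 act_poly_mult)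

lemma act_poly_power: "act_poly g (x ^ n) = act_poly g x ^ n"
  by (induction n) (simp_all add: act_poly_1 act_poly_mult)

lemma image_mset_rho_one: "image_mset (\<rho> \<one>) M = M"
  by (induction M) (simp_all add: rho_one)

lemma image_mset_rho_mult:
  "g \<in> carrier G \<Longrightarrow> h \<in> carrier G \<Longrightarrow>
    image_mset (\<rho> g) (image_mset (\<rho> h) M) = image_mset (\<rho> (g \<otimes> h)) M"
  by (induction M) (simp_all add: rho_mult)

lemma act_poly_one: "act_poly \<one> x = x"
  unfolding act_poly_def by (rule push_id) (rule image_mset_rho_one)

text \<open>It separates \<open>p\<close> from the rest of its orbit: its value at \<open>p\<close>
  is \<open>\<Delta> p v\<close>, while it vanishes at all translates of \<open>p\<close> by
  nontrivial elements.\<close>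

definition \<chi> :: "'v \<Rightarrow> 'v \<Rightarrow> 'v multiset \<Rightarrow>\<^sub>0 complex"
  where "\<chi> p v = (\<Prod>h\<in>carrier G - {\<one>}. var v - cst (\<omega> (\<rho> h v) p))"

lemma ev_chi: "ev p (\<chi> p v) = \<Delta> p v"
  by (simp add: \<chi>_def \<Delta>_def ev_prod ev_diff ev_var ev_cst)

lemma ev_act_chi: "h \<in> carrier G - {\<one>} \<Longrightarrow> ev p (act_poly h (\<chi> p v)) = 0"
  using fin
  by (auto simp: \<chi>_def act_poly_prod ev_prod act_poly_diff act_poly_var act_poly_cst ev_diff ev_var ev_cst
      intro!: prod_zero bexI[of _ h])

definition orb :: "'g set \<Rightarrow> 'v \<Rightarrow> 'v multiset"
  where "orb A v = image_mset (\<lambda>h. \<rho> h v) (mset_set A)"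

lemma single_orb: "Poly_Mapping.single (orb A v) 1 = (\<Prod>h\<in>A. var (\<rho> h v))"
  by (simp add: orb_def prod_var)

lemma size_orb: "size (orb A v) = card A"
  by (simp add: orb_def)

end

text \<open>\<open>L M\<close> models the value at \<open>p\<close> of a derivation of the
  invariants, applied to the trace of the monomial \<open>M\<close> over the group. Then
  \<open>L_der\<close> is the Leibniz rule, because the product of the traces of \<open>M1\<close>
  and \<open>M2\<close> is the sum over \<open>g\<close> of the traces of \<open>M1\<close> times
  the translate of \<open>M2\<close> by \<open>g\<close>.\<close>

locale point_derivation = symplectic_action scale Basis G \<omega> \<rho>
  for scale :: "complex \<Rightarrow> 'v::ab_group_add \<Rightarrow> 'v" (infixr \<open>*s\<close> 75)
    and Basis and G :: "('g, 'm) monoid_scheme" (structure) and \<omega> \<rho> +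
  fixes p :: 'v and L :: "'v multiset \<Rightarrow> complex"
  assumes L_lin: "L (add_mset (a *s x + b *s y) M) = a * L (add_mset x M) + b * L (add_mset y M)"
    and L_inv: "g \<in> carrier G \<Longrightarrow> L (image_mset (\<rho> g) M) = L M"
    and L_der: "(\<Sum>g\<in>carrier G. L (M1 + image_mset (\<rho> g) M2)) =
      (\<Sum>h\<in>carrier G. monom_val p (image_mset (\<rho> h) M1)) * L M2 +
      (\<Sum>h\<in>carrier G. monom_val p (image_mset (\<rho> h) M2)) * L M1"
begin

abbreviation LL where "LL \<equiv> lin_ext L"

lemma LL_act: "g \<in> carrier G \<Longrightarrow> LL (act_poly g x) = LL x"
  unfolding act_poly_def lin_ext_push by (rule lin_ext_cong) (simp add: L_inv)

lemma LL_der: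
  "(\<Sum>g\<in>carrier G. LL (x * act_poly g y)) =
    (\<Sum>h\<in>carrier G. ev p (act_poly h x)) * LL y + (\<Sum>h\<in>carrier G. ev p (act_poly h y)) * LL x"
proof (induction x rule: poly_mapping_additive_induct)
  case (single M1 a)
  show ?case
  proof (induction y rule: poly_mapping_additive_induct)
    case (single M2 b)
    have "(\<Sum>g\<in>carrier G. LL (Poly_Mapping.single M1 a * act_poly g (Poly_Mapping.single M2 b))) =
      a * b * (\<Sum>g\<in>carrier G. L (M1 + image_mset (\<rho> g) M2))"
      by (simp add: act_poly_def mult_single sum_distrib_left)
    also have "\<dots> = (\<Sum>h\<in>carrier G. ev p (act_poly h (Poly_Mapping.single M1 a))) * LL (Poly_Mapping.single M2 b)
       + (\<Sum>h\<in>carrier G. ev p (act_poly h (Poly_Mapping.single M2 b))) * LL (Poly_Mapping.single M1 a)"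
      unfolding L_der by (simp add: act_poly_def ev_def algebra_simps flip: sum_distrib_left)
    finally show ?case .
  qed (simp_all add: act_poly_def push_add ev_add ev_0 lin_ext_add ring_distribs sum.distrib)
qed (simp_all add: act_poly_def push_add ev_add ev_0 lin_ext_add ring_distribs sum.distrib)

lemma LL_der_invariant:
  assumes "\<And>g. g \<in> carrier G \<Longrightarrow> act_poly g x = x"
  shows "of_nat N * LL (x * y) = of_nat N * ev p x * LL y + (\<Sum>h\<in>carrier G. ev p (act_poly h y)) * LL x"
proof -
  have "of_nat N * LL (x * y) = (\<Sum>g\<in>carrier G. LL (act_poly g (x * y)))"
    by (simp add: LL_act)
  also have "\<dots> = (\<Sum>g\<in>carrier G. LL (x * act_poly g y))"
    by (intro sum.cong refl) (simp add: act_poly_mult assms)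
  also have "\<dots> = of_nat N * ev p x * LL y + (\<Sum>h\<in>carrier G. ev p (act_poly h y)) * LL x"
    unfolding LL_der by (simp add: assms)
  finally show ?thesis .
qed

text \<open>Factors of this kind localise at \<open>p\<close>: the trace of \<open>f\<close> has the
  value of \<open>f\<close> itself there, see \<open>sum_ev_off_orbit\<close>.\<close>

definition off_orbit :: "('v multiset \<Rightarrow>\<^sub>0 complex) \<Rightarrow> bool"
  where "off_orbit f \<longleftrightarrow> (\<forall>h\<in>carrier G - {\<one>}. ev p (act_poly h f) = 0)"

lemma off_orbit_mult: "off_orbit f \<Longrightarrow> off_orbit (f * g)" "off_orbit g \<Longrightarrow> off_orbit (f * g)"
  by (simp_all add: off_orbit_def act_poly_mult ev_mult)

lemma off_orbit_chi: "off_orbit (\<chi> p v)"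
  by (simp add: off_orbit_def ev_act_chi)

lemma sum_ev_off_orbit: "off_orbit f \<Longrightarrow> (\<Sum>h\<in>carrier G. ev p (act_poly h f)) = ev p f"
  using fin by (subst sum.remove[of _ \<one>]) (auto simp: off_orbit_def act_poly_one)

text \<open>
  The orbit polynomial \<open>\<Prod>h. T - h v\<close> vanishes at \<open>T = v\<close>. Applying the derivation to this identity
  gives \<open>- \<delta> v / \<Delta> p v\<close> for the value at \<open>v\<close> of its extension to all polynomials.
\<close>

definition \<delta> :: "'v \<Rightarrow> complex"
  where "\<delta> v = (\<Sum>A\<in>Pow (carrier G). (-1) ^ card A * \<omega> v p ^ card (carrier G - A) * L (orb A v))"

text \<open>The orbit polynomial of \<open>v\<close> vanishes at \<open>v\<close>, and its
  coefficients \<open>C i\<close> are invariant, so the Leibniz rule splits every term. The parts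
  with coefficients evaluated at \<open>p\<close> recombine to
  \<open>(var v - cst (\<omega> v p)) * \<chi> p v\<close>; the parts with differentiated
  coefficients add up to \<open>\<delta> v\<close>.\<close>

lemma LL_chi:
  assumes f: "off_orbit f"
  shows "of_nat N * LL ((var v - cst (\<omega> v p)) * \<chi> p v * f) = - \<delta> v * ev p f"
proof -
  let ?cA = "\<lambda>A. (-1) ^ card A * (\<Prod>h\<in>A. var (\<rho> h v))"
  \<comment> \<open>Signed elementary symmetric functions of the orbit of \<open>v\<close>;
    collecting the subsets by size is what makes them invariant.\<close>
  define C where "C i = (\<Sum>A | A \<in> Pow (carrier G) \<and> card A = i. ?cA A)" for i
  have inv: "act_poly g (C i) = C i" if g: "g \<in> carrier G" for g i
  proof -
    have "act_poly g (C i) = (\<Sum>A | A \<in> Pow (carrier G) \<and> card A = i. (-1) ^ i * (\<Prod>h\<in>A. var (\<rho> (g \<otimes> h) v)))"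
      unfolding C_def act_poly_sum
    proof (intro sum.cong refl, clarify)
      fix A assume "A \<subseteq> carrier G"
      hence "(\<Prod>i\<in>A. var (\<rho> g (\<rho> i v))) = (\<Prod>i\<in>A. var (\<rho> (g \<otimes> i) v))"
        using g by (intro prod.cong refl) (auto simp: rho_mult)
      moreover have "act_poly g (-1) = -1"
        using act_poly_cst[of g "-1"] by (simp add: cst_uminus)
      ultimately show "act_poly g (?cA A) = (-1) ^ card A * (\<Prod>h\<in>A. var (\<rho> (g \<otimes> h) v))"
        by (simp add: act_poly_mult act_poly_power act_poly_prod act_poly_var)
    qed
    also have "\<dots> = (\<Sum>A | A \<in> Pow (carrier G) \<and> card A = i. (-1) ^ i * (\<Prod>h\<in>(\<lambda>h. g \<otimes> h) ` A. var (\<rho> h v)))"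
    proof (intro sum.cong refl, clarify)
      fix A assume A: "A \<subseteq> carrier G"
      have "inj_on (\<lambda>h. g \<otimes> h) A"
        using bij_mult_left[OF g] A by (auto simp: bij_betw_def intro: inj_on_subset)
      thus "(-1) ^ card A * (\<Prod>h\<in>A. var (\<rho> (g \<otimes> h) v)) = (-1) ^ card A * (\<Prod>h\<in>(\<lambda>h. g \<otimes> h) ` A. var (\<rho> h v))"
        by (simp add: prod.reindex)
    qed
    also have "\<dots> = (\<Sum>A | A \<in> Pow (carrier G) \<and> card A = i. (-1) ^ i * (\<Prod>h\<in>A. var (\<rho> h v)))"
    proof (rule sum.reindex_bij_betw)
      have b: "bij_betw (\<lambda>A. (\<lambda>h. g \<otimes> h) ` A) (Pow (carrier G)) (Pow (carrier G))"
        by (rule bij_betw_Pow[OF bij_mult_left[OF g]])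
      have cd: "card ((\<lambda>h. g \<otimes> h) ` A) = card A" if "A \<in> Pow (carrier G)" for A
        using bij_mult_left[OF g] that by (intro card_image) (auto simp: bij_betw_def intro: inj_on_subset)
      show "bij_betw (\<lambda>A. (\<lambda>h. g \<otimes> h) ` A) {A. A \<in> Pow (carrier G) \<and> card A = i} {A. A \<in> Pow (carrier G) \<and> card A = i}"
      proof (rule bij_betw_subset[OF b])
        show "(\<lambda>A. (\<lambda>h. g \<otimes> h) ` A) ` {A. A \<in> Pow (carrier G) \<and> card A = i} = {A. A \<in> Pow (carrier G) \<and> card A = i}"
        proof safe
          fix A assume A: "A \<subseteq> carrier G" "i = card A"
          have "A \<in> (\<lambda>A. (\<lambda>h. g \<otimes> h) ` A) ` Pow (carrier G)"
            unfolding bij_betw_imp_surj_on[OF b] using A by simp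
          then obtain B where B: "A = (\<lambda>h. g \<otimes> h) ` B" "B \<in> Pow (carrier G)" by (rule imageE)
          thus "A \<in> (\<lambda>A. (\<lambda>h. g \<otimes> h) ` A) ` {B. B \<in> Pow (carrier G) \<and> card B = card A}"
            using cd[OF B(2)] by (intro image_eqI[of _ _ B]) auto
        qed (use cd g in auto)
      qed auto
    qed
    also have "\<dots> = C i" unfolding C_def by (intro sum.cong) auto
    finally show ?thesis .
  qed
  have cardC: "card (carrier G - A) = N - card A" if "A \<subseteq> carrier G" for A
    using that fin by (simp add: card_Diff_subset finite_subset)
  have grp: "(\<Sum>A\<in>Pow (carrier G). \<phi> (?cA A) (card A)) = (\<Sum>i\<le>N. \<Sum>A | A \<in> Pow (carrier G) \<and> card A = i. \<phi> (?cA A) i)"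
    for \<phi> :: "_ \<Rightarrow> nat \<Rightarrow> 'z::comm_monoid_add"
  proof -
    have "(\<Sum>A\<in>Pow (carrier G). \<phi> (?cA A) (card A)) =
      (\<Sum>i\<le>N. \<Sum>A | A \<in> Pow (carrier G) \<and> card A = i. \<phi> (?cA A) (card A))"
      by (rule sum.group[symmetric]) (use fin in \<open>auto intro: card_mono\<close>)
    also have "\<dots> = (\<Sum>i\<le>N. \<Sum>A | A \<in> Pow (carrier G) \<and> card A = i. \<phi> (?cA A) i)"
      by (intro sum.cong refl) auto
    finally show ?thesis .
  qed
  have "(\<Prod>h\<in>carrier G. var v - var (\<rho> h v)) = 0"
    using fin by (intro prod_zero) (auto simp: rho_one intro!: bexI[of _ \<one>])
  also have "(\<Prod>h\<in>carrier G. var v - var (\<rho> h v)) = (\<Sum>A\<in>Pow (carrier G). ?cA A * var v ^ (N - card A))"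
    unfolding prod_diff_conv_sum[OF fin] by (intro sum.cong refl) (simp add: cardC)
  also have "\<dots> = (\<Sum>i\<le>N. C i * var v ^ (N - i))"
    unfolding grp[of "\<lambda>a i. a * var v ^ (N - i)"] C_def sum_distrib_right ..
  finally have zero: "(\<Sum>i\<le>N. C i * (var v ^ (N - i) * f)) = 0"
    by (simp add: sum_distrib_right[symmetric] mult.assoc[symmetric])
  have ev1: "(var v - cst (\<omega> v p)) * \<chi> p v = (\<Prod>h\<in>carrier G. var v - cst (\<omega> (\<rho> h v) p))"
    unfolding \<chi>_def using fin by (subst prod.remove[of "carrier G" \<one>]) (simp_all add: rho_one)
  also have "\<dots> = (\<Sum>A\<in>Pow (carrier G). cst (ev p (?cA A)) * var v ^ (N - card A))"
    unfolding prod_diff_conv_sum[OF fin]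
  proof (intro sum.cong refl)
    fix A assume "A \<in> Pow (carrier G)"
    moreover have "ev p (-1) = -1" using ev_cst[of p "-1"] by (simp add: cst_uminus)
    ultimately show "(-1) ^ card A * (\<Prod>x\<in>A. cst (\<omega> (\<rho> x v) p)) * (\<Prod>x\<in>carrier G - A. var v) =
      cst (ev p (?cA A)) * var v ^ (N - card A)"
      by (simp add: cardC ev_mult ev_power ev_prod ev_var cst_mult cst_power cst_prod cst_uminus)
  qed
  also have "\<dots> = (\<Sum>i\<le>N. cst (ev p (C i)) * var v ^ (N - i))"
    unfolding grp[of "\<lambda>a i. cst (ev p a) * var v ^ (N - i)"] C_def ev_sum cst_sum sum_distrib_right ..
  finally have ev1: "(var v - cst (\<omega> v p)) * \<chi> p v * f = (\<Sum>i\<le>N. cst (ev p (C i)) * (var v ^ (N - i) * f))"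
    by (simp add: sum_distrib_right mult.assoc)
  have "\<delta> v = (\<Sum>A\<in>Pow (carrier G). \<omega> v p ^ (N - card A) * LL (?cA A))"
    unfolding \<delta>_def
  proof (intro sum.cong refl)
    fix A assume "A \<in> Pow (carrier G)"
    have "?cA A = cst ((-1) ^ card A) * Poly_Mapping.single (orb A v) 1"
      by (simp add: cst_power cst_uminus single_orb)
    hence "LL (?cA A) = (-1) ^ card A * L (orb A v)"
      by (simp only: lin_ext_cst lin_ext_single) simp
    thus "(-1) ^ card A * \<omega> v p ^ card (carrier G - A) * L (orb A v) = \<omega> v p ^ (N - card A) * LL (?cA A)"
      using \<open>A \<in> _\<close> by (simp add: cardC)
  qed
  also have "\<dots> = (\<Sum>i\<le>N. \<omega> v p ^ (N - i) * LL (C i))"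
    unfolding grp[of "\<lambda>a i. \<omega> v p ^ (N - i) * LL a"] C_def lin_ext_sum sum_distrib_left ..
  finally have del: "\<delta> v = (\<Sum>i\<le>N. \<omega> v p ^ (N - i) * LL (C i))" .
  have "0 = of_nat N * LL (\<Sum>i\<le>N. C i * (var v ^ (N - i) * f))"
    by (simp add: zero)
  also have "\<dots> = (\<Sum>i\<le>N. of_nat N * LL (C i * (var v ^ (N - i) * f)))"
    by (simp add: lin_ext_sum sum_distrib_left)
  also have "\<dots> = (\<Sum>i\<le>N. of_nat N * ev p (C i) * LL (var v ^ (N - i) * f) + \<omega> v p ^ (N - i) * ev p f * LL (C i))"
  proof (intro sum.cong refl)
    fix i
    have "(\<Sum>h\<in>carrier G. ev p (act_poly h (var v ^ (N - i) * f))) = \<omega> v p ^ (N - i) * ev p f"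
      by (subst sum_ev_off_orbit) (simp_all add: off_orbit_mult f ev_mult ev_power ev_var)
    thus "of_nat N * LL (C i * (var v ^ (N - i) * f)) =
      of_nat N * ev p (C i) * LL (var v ^ (N - i) * f) + \<omega> v p ^ (N - i) * ev p f * LL (C i)"
      by (subst LL_der_invariant) (simp_all add: inv)
  qed
  also have "\<dots> = of_nat N * LL ((var v - cst (\<omega> v p)) * \<chi> p v * f) + \<delta> v * ev p f"
  proof -
    have "(\<Sum>i\<le>N. of_nat N * ev p (C i) * LL (var v ^ (N - i) * f)) =
        of_nat N * LL ((var v - cst (\<omega> v p)) * \<chi> p v * f)"
      unfolding ev1 by (simp only: lin_ext_sum lin_ext_cst sum_distrib_left mult.assoc)
    moreover have "(\<Sum>i\<le>N. \<omega> v p ^ (N - i) * ev p f * LL (C i)) = \<delta> v * ev p f"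
      unfolding del sum_distrib_right by (intro sum.cong refl) simp
    ultimately show ?thesis by (simp only: sum.distrib)
  qed
  finally show ?thesis by (simp add: eq_neg_iff_add_eq_0)
qed

lemma LL_var_linear:
  "LL (var (a *s x + b *s y) * f) = a * LL (var x * f) + b * LL (var y * f)"
  by (induction f rule: poly_mapping_additive_induct)
    (simp_all add: var_def mult_single lin_ext_add ring_distribs L_lin)

text \<open>Up to a constant factor the quotient is the value of the extended derivation at a
  vector. For a comparison of the three vectors, \<open>LL_chi\<close> is applied to one test
  polynomial that contains all three factors \<open>\<chi>\<close>.\<close>

lemma delta_linear:
  assumes "\<Delta> p x \<noteq> 0" "\<Delta> p y \<noteq> 0" "\<Delta> p (a *s x + b *s y) \<noteq> 0"
  shows "\<delta> (a *s x + b *s y) / \<Delta> p (a *s x + b *s y) = a * (\<delta> x / \<Delta> p x) + b * (\<delta> y / \<Delta> p y)"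
proof -
  let ?z = "a *s x + b *s y"
  let ?g = "\<chi> p x * \<chi> p y * \<chi> p ?z"
  have e: "ev p ?g \<noteq> 0" using assms by (simp add: ev_mult ev_chi)
  have *: "of_nat N * LL ((var v - cst (\<omega> v p)) * ?g) = - (\<delta> v / \<Delta> p v) * ev p ?g"
    if v: "v \<in> {x, y, ?z}" for v
  proof -
    have "?g = \<chi> p x * (\<chi> p y * \<chi> p ?z)" "?g = \<chi> p y * (\<chi> p x * \<chi> p ?z)" "?g = \<chi> p ?z * (\<chi> p x * \<chi> p y)"
      by (simp_all add: mult_ac)
    moreover have "off_orbit (\<chi> p a * \<chi> p b)" for a b by (simp add: off_orbit_mult off_orbit_chi)
    ultimately have "\<exists>f. ?g = \<chi> p v * f \<and> off_orbit f" using v by (metis empty_iff insert_iff)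
    then obtain f where f: "?g = \<chi> p v * f" "off_orbit f" by blast
    have "of_nat N * LL ((var v - cst (\<omega> v p)) * ?g) = - \<delta> v * ev p f"
      unfolding f(1) using LL_chi[OF f(2), of v] by (simp add: mult.assoc)
    also have "\<dots> = - (\<delta> v / \<Delta> p v) * ev p ?g"
      unfolding f(1) using assms v by (auto simp: ev_mult ev_chi)
    finally show ?thesis .
  qed
  have "LL ((var ?z - cst (\<omega> ?z p)) * ?g) =
      a * LL ((var x - cst (\<omega> x p)) * ?g) + b * LL ((var y - cst (\<omega> y p)) * ?g)"
    by (simp only: left_diff_distrib lin_ext_diff LL_var_linear lin_ext_cst form_linear) (simp add: algebra_simps)
  hence "of_nat N * LL ((var ?z - cst (\<omega> ?z p)) * ?g) =
      a * (of_nat N * LL ((var x - cst (\<omega> x p)) * ?g)) + b * (of_nat N * LL ((var y - cst (\<omega> y p)) * ?g))"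
    by (simp add: algebra_simps)
  hence "(\<delta> ?z / \<Delta> p ?z) * ev p ?g = (a * (\<delta> x / \<Delta> p x) + b * (\<delta> y / \<Delta> p y)) * ev p ?g"
    by (simp only: * insert_iff simp_thms) (simp add: algebra_simps)
  thus ?thesis using mult_right_cancel[OF e] by blast
qed

text \<open>A separator \<open>g\<close> is found such that, in the presence of \<open>g\<close>,
  the functional \<open>LL\<close> cannot distinguish the monomials in the orbit of \<open>M\<close>
  from their values at \<open>p\<close>. For the trace \<open>F\<close> of \<open>M\<close> this
  gives \<open>LL (F * g) = ev p F * LL g\<close>, whereas the Leibniz rule has the further term
  \<open>ev p g * LL F\<close>. So \<open>LL F\<close>, a multiple of \<open>L M\<close>, is
  zero.\<close>

lemma derivation_eq_0:
  assumes reg: "regular p" and z: "\<And>v. \<Delta> p v \<noteq> 0 \<Longrightarrow> \<delta> v = 0"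
  shows "L M = 0"
proof -
  have Nn: "(of_nat N :: complex) \<noteq> 0" using N_pos by simp
  define good where "good g v \<longleftrightarrow> (\<forall>f. LL ((var v - cst (\<omega> v p)) * (g * f)) = 0)" for g v
  have good_mult: "good (g * f) v" if "good g v" for g f v
    using that by (simp add: good_def mult.assoc)
  have "\<exists>g. good g v \<and> off_orbit g \<and> ev p g \<noteq> 0" for v
  proof -
    obtain u where u: "\<Delta> p u \<noteq> 0" using exists_generic[OF reg] by blast
    obtain \<mu> where \<mu>: "\<Delta> p (v + \<mu> *s u) \<noteq> 0" using exists_generic_shift[OF u] by blast
    let ?w = "v + \<mu> *s u"
    let ?g = "\<chi> p ?w * \<chi> p ?w * (\<chi> p u * \<chi> p u)"
    have "LL ((var v - cst (\<omega> v p)) * (?g * f)) = 0" for f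
    proof -
      have "LL ((var ?w - cst (\<omega> ?w p)) * \<chi> p ?w * (\<chi> p ?w * (\<chi> p u * \<chi> p u) * f)) = 0"
        using LL_chi[of "\<chi> p ?w * (\<chi> p u * \<chi> p u) * f" ?w] z[OF \<mu>] Nn
        by (simp add: off_orbit_mult off_orbit_chi)
      moreover have "LL ((var u - cst (\<omega> u p)) * \<chi> p u * (\<chi> p u * (\<chi> p ?w * \<chi> p ?w) * f)) = 0"
        using LL_chi[of "\<chi> p u * (\<chi> p ?w * \<chi> p ?w) * f" u] z[OF u] Nn
        by (simp add: off_orbit_mult off_orbit_chi)
      moreover have v: "v = 1 *s ?w + (- \<mu>) *s u" by simp
      have "LL ((var (1 *s ?w + (- \<mu>) *s u) - cst (\<omega> (1 *s ?w + (- \<mu>) *s u) p)) * (?g * f)) =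
        1 * LL ((var ?w - cst (\<omega> ?w p)) * (?g * f)) + (- \<mu>) * LL ((var u - cst (\<omega> u p)) * (?g * f))"
        by (simp only: left_diff_distrib lin_ext_diff LL_var_linear lin_ext_cst form_linear) (simp add: algebra_simps)
      ultimately show ?thesis unfolding v[symmetric] by (simp add: mult_ac)
    qed
    hence "good ?g v" by (simp add: good_def)
    moreover have "off_orbit ?g" by (simp add: off_orbit_mult off_orbit_chi)
    moreover have "ev p ?g \<noteq> 0" using u \<mu> by (simp add: ev_mult ev_chi)
    ultimately show ?thesis by blast
  qed
  then obtain \<gamma> where \<gamma>: "\<And>v. good (\<gamma> v) v" "\<And>v. off_orbit (\<gamma> v)" "\<And>v. ev p (\<gamma> v) \<noteq> 0" by metis
  define S where "S = set_mset (\<Sum>h\<in>carrier G. image_mset (\<rho> h) M)"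
  \<comment> \<open>The factor \<open>\<gamma> 0\<close>, belonging to the zero vector, keeps
    \<open>g\<close> off the orbit even if \<open>S\<close> is empty.\<close>
  define g where "g = \<gamma> 0 * (\<Prod>v\<in>S. \<gamma> v)"
  have S: "finite S" by (simp add: S_def)
  have g1: "off_orbit g" by (simp add: g_def off_orbit_mult \<gamma>)
  have g2: "ev p g \<noteq> 0" using S by (simp add: g_def ev_mult ev_prod \<gamma>)
  have g3: "good g v" if "v \<in> S" for v
  proof -
    have "g = \<gamma> v * (\<gamma> 0 * (\<Prod>v\<in>S-{v}. \<gamma> v))"
      using S that by (simp add: g_def prod.remove[of S v] mult_ac)
    thus ?thesis by (simp add: good_mult \<gamma>)
  qed
  have mon: "LL ((Poly_Mapping.single M' 1 - cst (monom_val p M')) * (g * f)) = 0" if "set_mset M' \<subseteq> S" for M' f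
    using that
  proof (induction M' arbitrary: f)
    case (add v M')
    have s: "Poly_Mapping.single (add_mset v M') 1 = var v * (Poly_Mapping.single M' 1 :: _ \<Rightarrow>\<^sub>0 complex)"
      by (simp add: var_def mult_single)
    have "(Poly_Mapping.single (add_mset v M') 1 - cst (monom_val p (add_mset v M'))) * (g * f) =
      (var v - cst (\<omega> v p)) * (g * (Poly_Mapping.single M' 1 * f)) +
      (Poly_Mapping.single M' 1 - cst (monom_val p M')) * (g * (cst (\<omega> v p) * f))"
      by (simp add: s monom_val_def cst_mult algebra_simps)
    thus ?case using add g3[of v] by (simp add: lin_ext_add good_def)
  qed (simp add: monom_val_def flip: single_one)
  define F where "F = (\<Sum>h\<in>carrier G. Poly_Mapping.single (image_mset (\<rho> h) M) (1::complex))"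
  have F: "act_poly k F = F" if k: "k \<in> carrier G" for k
  proof -
    have "act_poly k F = (\<Sum>h\<in>carrier G. Poly_Mapping.single (image_mset (\<rho> (k \<otimes> h)) M) 1)"
      unfolding F_def act_poly_sum
      using k by (intro sum.cong refl) (simp only: act_poly_def push_single image_mset_rho_mult)
    thus ?thesis
      unfolding F_def using sum_mult_left[OF k, of "\<lambda>h. Poly_Mapping.single (image_mset (\<rho> h) M) 1"] by simp
  qed
  have Fev: "ev p F = (\<Sum>h\<in>carrier G. monom_val p (image_mset (\<rho> h) M))"
    by (simp add: F_def ev_sum) (simp add: ev_def)
  have Fdiff: "F - cst (ev p F) =
    (\<Sum>h\<in>carrier G. Poly_Mapping.single (image_mset (\<rho> h) M) 1 - cst (monom_val p (image_mset (\<rho> h) M)))"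
    unfolding Fev cst_sum by (simp add: F_def sum_subtractf)
  have "LL ((F - cst (ev p F)) * g) =
    (\<Sum>h\<in>carrier G. LL ((Poly_Mapping.single (image_mset (\<rho> h) M) 1 - cst (monom_val p (image_mset (\<rho> h) M))) * g))"
    unfolding Fdiff sum_distrib_right lin_ext_sum ..
  also have "\<dots> = 0"
  proof (intro sum.neutral ballI)
    fix h assume h: "h \<in> carrier G"
    have "set_mset (image_mset (\<rho> h) M) \<subseteq> S"
      unfolding S_def using h fin by (auto simp: set_mset_sum intro!: bexI[of _ h])
    thus "LL ((Poly_Mapping.single (image_mset (\<rho> h) M) 1 - cst (monom_val p (image_mset (\<rho> h) M))) * g) = 0"
      using mon[of _ 1] by simp
  qed
  finally have "of_nat N * LL (F * g) = of_nat N * ev p F * LL g"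
    by (simp add: left_diff_distrib lin_ext_diff lin_ext_cst)
  moreover have "of_nat N * LL (F * g) = of_nat N * ev p F * LL g + ev p g * LL F"
    using LL_der_invariant[OF F, of g] by (simp add: sum_ev_off_orbit[OF g1])
  ultimately have "LL F = 0" using g2 by simp
  moreover have "LL F = of_nat N * L M"
    by (simp add: F_def lin_ext_sum L_inv)
  ultimately show ?thesis using Nn by simp
qed

end

text \<open>\<open>\<beta> p M M'\<close> models the value at \<open>p\<close> of a bracket of the
  traces of two monomials. That the bracket lowers degrees by \<open>k\<close> is expressed on
  affine lines, with \<open>k\<close> added to the degree instead of subtracted; hence a total size
  below \<open>k\<close> forces \<open>P = 0\<close>.\<close>

locale graded_biderivation = symplectic_action scale Basis G \<omega> \<rho>
  for scale :: "complex \<Rightarrow> 'v::ab_group_add \<Rightarrow> 'v" (infixr \<open>*s\<close> 75)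
    and Basis and G :: "('g, 'm) monoid_scheme" (structure) and \<omega> \<rho> +
  fixes k :: nat and \<beta> :: "'v \<Rightarrow> 'v multiset \<Rightarrow> 'v multiset \<Rightarrow> complex"
  assumes k_ge_3: "k \<ge> 3"
    and beta_lin: "\<beta> p (add_mset (a *s x + b *s y) M) M' = a * \<beta> p (add_mset x M) M' + b * \<beta> p (add_mset y M) M'"
    and beta_inv: "g \<in> carrier G \<Longrightarrow> \<beta> p (image_mset (\<rho> g) M) M' = \<beta> p M M'"
    and beta_der: "(\<Sum>g\<in>carrier G. \<beta> p (M1 + image_mset (\<rho> g) M2) M') =
      (\<Sum>h\<in>carrier G. monom_val p (image_mset (\<rho> h) M1)) * \<beta> p M2 M' +
      (\<Sum>h\<in>carrier G. monom_val p (image_mset (\<rho> h) M2)) * \<beta> p M1 M'"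
    and beta_skew: "\<beta> p M M' = - \<beta> p M' M"
    and beta_poly: "\<exists>P. (P = 0 \<or> Polynomial.degree P + k \<le> size M + size M') \<and>
      (\<forall>\<tau>. \<beta> (p + \<tau> *s q) M M' = poly P \<tau>)"
begin

lemma point_derivation_sum:
  "point_derivation scale Basis G \<omega> \<rho> p (\<lambda>M. \<Sum>i\<in>I. a i * \<beta> p M (M' i))"
proof unfold_locales
  show "(\<Sum>i\<in>I. a i * \<beta> p (add_mset (r *s x + s *s y) M) (M' i)) =
    r * (\<Sum>i\<in>I. a i * \<beta> p (add_mset x M) (M' i)) + s * (\<Sum>i\<in>I. a i * \<beta> p (add_mset y M) (M' i))"
    for r x s y M
    by (simp add: beta_lin sum_distrib_left algebra_simps sum.distrib)
  show "g \<in> carrier G \<Longrightarrow> (\<Sum>i\<in>I. a i * \<beta> p (image_mset (\<rho> g) M) (M' i)) = (\<Sum>i\<in>I. a i * \<beta> p M (M' i))" for g M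
    by (simp add: beta_inv)
  fix M1 M2
  have "(\<Sum>g\<in>carrier G. \<Sum>i\<in>I. a i * \<beta> p (M1 + image_mset (\<rho> g) M2) (M' i)) =
    (\<Sum>i\<in>I. a i * (\<Sum>g\<in>carrier G. \<beta> p (M1 + image_mset (\<rho> g) M2) (M' i)))"
    by (subst sum.swap) (simp add: sum_distrib_left)
  also have "\<dots> = (\<Sum>h\<in>carrier G. monom_val p (image_mset (\<rho> h) M1)) * (\<Sum>i\<in>I. a i * \<beta> p M2 (M' i)) +
      (\<Sum>h\<in>carrier G. monom_val p (image_mset (\<rho> h) M2)) * (\<Sum>i\<in>I. a i * \<beta> p M1 (M' i))"
  proof -
    define m1 m2 where "m1 = (\<Sum>h\<in>carrier G. monom_val p (image_mset (\<rho> h) M1))"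
      and "m2 = (\<Sum>h\<in>carrier G. monom_val p (image_mset (\<rho> h) M2))"
    show ?thesis
      unfolding beta_der m1_def[symmetric] m2_def[symmetric]
      by (simp add: ring_distribs sum.distrib sum_distrib_left mult_ac)
  qed
  finally show "(\<Sum>g\<in>carrier G. \<Sum>i\<in>I. a i * \<beta> p (M1 + image_mset (\<rho> g) M2) (M' i)) =
    (\<Sum>h\<in>carrier G. monom_val p (image_mset (\<rho> h) M1)) * (\<Sum>i\<in>I. a i * \<beta> p M2 (M' i)) +
      (\<Sum>h\<in>carrier G. monom_val p (image_mset (\<rho> h) M2)) * (\<Sum>i\<in>I. a i * \<beta> p M1 (M' i))" .
qed

definition contr :: "'v \<Rightarrow> 'v \<Rightarrow> 'v multiset \<Rightarrow> complex"
  where "contr p w M = (\<Sum>B\<in>Pow (carrier G). ((-1) ^ card B * \<omega> w p ^ card (carrier G - B)) * \<beta> p M (orb B w))"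

text \<open>The sum that defines \<open>\<delta>\<close> is formed in both arguments,
  \<open>contr\<close> being the second one. The minus signs of the two extensions cancel, so
  \<open>R\<close> below is, up to a constant factor, the extended bracket of the linear functions
  \<open>v\<close> and \<open>w\<close>.\<close>

definition dd :: "'v \<Rightarrow> 'v \<Rightarrow> 'v \<Rightarrow> complex"
  where "dd p v w = (\<Sum>A\<in>Pow (carrier G). (-1) ^ card A * \<omega> v p ^ card (carrier G - A) * contr p w (orb A v))"

lemma contr_derivation: "point_derivation scale Basis G \<omega> \<rho> p (contr p w)"
  using point_derivation_sum[where M' = "\<lambda>B. orb B w"] by (simp add: contr_def[abs_def])

lemma dd_eq_delta: "dd p v w = point_derivation.\<delta> G \<omega> \<rho> p (contr p w) v"
proof -
  interpret point_derivation scale Basis G \<omega> \<rho> p "contr p w" by (rule contr_derivation)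
  show ?thesis by (simp add: dd_def \<delta>_def)
qed

lemma dd_skew: "dd p v w = - dd p w v"
proof -
  have "dd p v w = (\<Sum>A\<in>Pow (carrier G). \<Sum>B\<in>Pow (carrier G). ((-1) ^ card A * \<omega> v p ^ card (carrier G - A)) *
    ((-1) ^ card B * \<omega> w p ^ card (carrier G - B)) * \<beta> p (orb A v) (orb B w))"
    by (simp add: dd_def contr_def sum_distrib_left mult_ac)
  also have "\<dots> = (\<Sum>B\<in>Pow (carrier G). \<Sum>A\<in>Pow (carrier G). ((-1) ^ card A * \<omega> v p ^ card (carrier G - A)) *
    ((-1) ^ card B * \<omega> w p ^ card (carrier G - B)) * \<beta> p (orb A v) (orb B w))"
    by (rule sum.swap)
  also have "\<dots> = (\<Sum>B\<in>Pow (carrier G). \<Sum>A\<in>Pow (carrier G). - (((-1) ^ card B * \<omega> w p ^ card (carrier G - B)) *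
    ((-1) ^ card A * \<omega> v p ^ card (carrier G - A)) * \<beta> p (orb B w) (orb A v)))"
    by (intro sum.cong refl) (subst beta_skew, simp)
  also have "\<dots> = - dd p w v"
    by (simp add: dd_def contr_def sum_distrib_left mult_ac sum_negf)
  finally show ?thesis .
qed

definition R :: "'v \<Rightarrow> 'v \<Rightarrow> 'v \<Rightarrow> complex" where "R p v w = dd p v w / (\<Delta> p v * \<Delta> p w)"

lemma R_linear:
  assumes "\<Delta> p x \<noteq> 0" "\<Delta> p y \<noteq> 0" "\<Delta> p (a *s x + b *s y) \<noteq> 0"
  shows "R p (a *s x + b *s y) w = a * R p x w + b * R p y w"
    "R p w (a *s x + b *s y) = a * R p w x + b * R p w y"
proof -
  have *: "R p (a *s x + b *s y) w = a * R p x w + b * R p y w" for w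
  proof -
    interpret point_derivation scale Basis G \<omega> \<rho> p "contr p w" by (rule contr_derivation)
    have "dd p (a *s x + b *s y) w / \<Delta> p (a *s x + b *s y) = a * (dd p x w / \<Delta> p x) + b * (dd p y w / \<Delta> p y)"
      using delta_linear[OF assms] by (simp add: dd_eq_delta)
    hence "dd p (a *s x + b *s y) w / \<Delta> p (a *s x + b *s y) / \<Delta> p w =
      (a * (dd p x w / \<Delta> p x) + b * (dd p y w / \<Delta> p y)) / \<Delta> p w"
      by (rule arg_cong)
    thus ?thesis by (simp add: R_def add_divide_distrib)
  qed
  have sk: "R p v w = - R p w v" for v w
    using dd_skew[of p v w] by (simp add: R_def mult.commute)
  show "R p (a *s x + b *s y) w = a * R p x w + b * R p y w" by (rule *)
  show "R p w (a *s x + b *s y) = a * R p w x + b * R p w y"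
    by (subst (1 2 3) sk) (simp add: *)
qed

text \<open>Replacing \<open>v\<close> and \<open>w\<close> by combinations of shifted vectors
  trades their denominators for others. This gives a function with apparent poles a representation
  without them at a prescribed point.\<close>

lemma R_shift:
  assumes "\<Delta> p v \<noteq> 0" "\<Delta> p w \<noteq> 0" "\<Delta> p u \<noteq> 0" "\<Delta> p (v + r *s u) \<noteq> 0" "\<Delta> p (w + s *s u) \<noteq> 0"
  shows "R p v w = R p (v + r *s u) (w + s *s u) - s * R p (v + r *s u) u
    - r * R p u (w + s *s u) + r * s * R p u u"
proof -
  have 1: "R p (1 *s v + r *s u) z = 1 * R p v z + r * R p u z" for z
    by (rule R_linear) (use assms in simp_all)
  have 2: "R p z (1 *s w + s *s u) = 1 * R p z w + s * R p z u" for z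
    by (rule R_linear) (use assms in simp_all)
  show ?thesis using 1 2 by (simp add: algebra_simps)
qed

definition low :: "nat \<Rightarrow> complex poly \<Rightarrow> bool"
  where "low n P \<longleftrightarrow> P = 0 \<or> Polynomial.degree P + k \<le> n"

lemma low_add: "low n P \<Longrightarrow> low n Q \<Longrightarrow> low n (P + Q)"
proof (cases "P = 0 \<or> Q = 0")
  case False
  assume *: "low n P" "low n Q"
  have "Polynomial.degree (P + Q) \<le> n - k"
    by (rule degree_add_le) (use * False in \<open>auto simp: low_def\<close>)
  thus ?thesis using * False by (auto simp: low_def)
qed auto

lemma low_0: "low n 0"
  by (simp add: low_def)

lemma low_sum: "(\<And>i. i \<in> I \<Longrightarrow> low n (f i)) \<Longrightarrow> low n (\<Sum>i\<in>I. f i)"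
  by (induction I rule: infinite_finite_induct) (simp_all add: low_add low_0)

lemma low_mult:
  assumes "Polynomial.degree P \<le> m" "low n Q"
  shows "low (m + n) (P * Q)"
  using assms degree_mult_le[of P Q] by (auto simp: low_def)

lemma low_mono: "low m P \<Longrightarrow> m \<le> n \<Longrightarrow> low n P"
  by (auto simp: low_def)

text \<open>The powers contribute the sizes of the complements of two subsets of the group, the
  monomials contribute the sizes of the subsets, and the bracket takes \<open>k\<close> away. This
  leaves degree at most \<open>2 * N - k\<close>.\<close>

lemma dd_poly: "\<exists>P. low (2 * N) P \<and> (\<forall>\<tau>. dd (p + \<tau> *s q) v w = poly P \<tau>)"
proof -
  obtain B where B: "\<And>M M'. low (size M + size M') (B M M')"
    "\<And>M M' \<tau>. \<beta> (p + \<tau> *s q) M M' = poly (B M M') \<tau>"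
    using beta_poly[of _ _ p q] unfolding low_def by metis
  define l where "l v = [:\<omega> v p, \<omega> v q:]" for v
  have l: "poly (l v) \<tau> = \<omega> v (p + \<tau> *s q)" for v \<tau> by (simp add: l_def form_linear)
  define P where "P = (\<Sum>A\<in>Pow (carrier G). \<Sum>C\<in>Pow (carrier G).
    ((-1) ^ card A * l v ^ card (carrier G - A)) * (((-1) ^ card C * l w ^ card (carrier G - C)) * B (orb A v) (orb C w)))"
  have dl: "Polynomial.degree ((-1) ^ n * l v ^ m) \<le> m" for n m v
  proof -
    have "Polynomial.degree (l v ^ m) \<le> Polynomial.degree (l v) * m" by (rule degree_power_le)
    also have "\<dots> \<le> m" by (simp add: l_def)
    finally have "Polynomial.degree (l v ^ m) \<le> m" .
    thus ?thesis by (cases "even n") simp_all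
  qed
  have "low (2 * N) (((-1) ^ card A * l v ^ card (carrier G - A)) *
      (((-1) ^ card C * l w ^ card (carrier G - C)) * B (orb A v) (orb C w)))"
    if "A \<subseteq> carrier G" "C \<subseteq> carrier G" for A C
  proof -
    have AC: "card A \<le> N" "card C \<le> N" "card (carrier G - A) = N - card A" "card (carrier G - C) = N - card C"
      using that fin by (auto simp: card_mono card_Diff_subset finite_subset)
    have "low ((N - card A) + ((N - card C) + (card A + card C))) (((-1) ^ card A * l v ^ card (carrier G - A)) *
      (((-1) ^ card C * l w ^ card (carrier G - C)) * B (orb A v) (orb C w)))"
      unfolding AC using B(1)[of "orb A v" "orb C w"] by (intro low_mult dl) (simp add: size_orb)
    thus ?thesis using AC by (simp add: low_mono)
  qed
  hence "low (2 * N) P"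
    unfolding P_def by (intro low_sum) simp
  moreover have "dd (p + \<tau> *s q) v w = poly P \<tau>" for \<tau>
  proof -
    have "poly ((-1) ^ n) \<tau> = (-1) ^ n" for n :: nat by (simp add: poly_power)
    thus ?thesis
      by (simp add: P_def dd_def contr_def poly_sum poly_power l B(2) sum_distrib_left mult.assoc)
  qed
  ultimately show ?thesis by blast
qed

text \<open>Each of the \<open>N - 1\<close> factors is linear along the line, and the coefficient
  of the top power is \<open>\<Delta> q v\<close>. A direction generic in this sense therefore gives
  the full degree.\<close>

lemma Delta_poly:
  obtains P where "\<And>\<tau>. poly P \<tau> = \<Delta> (p + \<tau> *s q) v" "Polynomial.degree P \<le> N - 1"
    "\<Delta> q v \<noteq> 0 \<Longrightarrow> P \<noteq> 0 \<and> Polynomial.degree P = N - 1"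
proof
  let ?l = "\<lambda>h. [:\<omega> v p - \<omega> (\<rho> h v) p, \<omega> v q - \<omega> (\<rho> h v) q:]"
  let ?P = "\<Prod>h\<in>carrier G - {\<one>}. ?l h"
  have c: "card (carrier G - {\<one>}) = N - 1" using fin by (simp add: card_Diff_singleton)
  show "poly ?P \<tau> = \<Delta> (p + \<tau> *s q) v" for \<tau>
    unfolding poly_prod \<Delta>_def by (intro prod.cong refl) (simp add: form_linear algebra_simps)
  have "Polynomial.degree ?P \<le> (\<Sum>h\<in>carrier G - {\<one>}. Polynomial.degree (?l h))"
    using degree_prod_sum_le[of "carrier G - {\<one>}" ?l] fin by (simp add: o_def)
  also have "\<dots> \<le> (\<Sum>h\<in>carrier G - {\<one>}. 1)" by (intro sum_mono) simp
  finally show "Polynomial.degree ?P \<le> N - 1" by (simp add: c)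
  assume "\<Delta> q v \<noteq> 0"
  hence nz: "\<omega> v q - \<omega> (\<rho> h v) q \<noteq> 0" if "h \<in> carrier G - {\<one>}" for h
    using that by (simp add: Delta_nonzero_iff)
  have "Polynomial.degree ?P = (\<Sum>h\<in>carrier G - {\<one>}. Polynomial.degree (?l h))"
    by (rule degree_prod_sum_eq) (use nz in auto)
  also have "\<dots> = (\<Sum>h\<in>carrier G - {\<one>}. 1)"
    by (intro sum.cong refl) (use nz in auto)
  finally have "Polynomial.degree ?P = N - 1" by (simp add: c)
  moreover have "?P \<noteq> 0" using fin nz by auto
  ultimately show "?P \<noteq> 0 \<and> Polynomial.degree ?P = N - 1" by blast
qed

text \<open>Along the line the extended bracket is the ratio of \<open>P v w\<close> and
  \<open>E v * E w\<close>. For each parameter a vector \<open>u\<close> generic at that point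
  yields, through \<open>R_shift\<close>, an equal ratio whose denominator does not vanish there; a
  vector generic for the direction \<open>q\<close> does the same at infinity.\<close>

lemma dd_eq_0:
  assumes reg: "regular p" and v: "\<Delta> p v \<noteq> 0" and w: "\<Delta> p w \<noteq> 0"
  shows "dd p v w = 0"
proof -
  obtain q where q: "regular q" "\<And>\<tau>. regular (p + \<tau> *s q)"
    using exists_regular_plane[OF reg] by blast
  obtain P where P: "\<And>v w. low (2 * N) (P v w)" "\<And>v w \<tau>. dd (p + \<tau> *s q) v w = poly (P v w) \<tau>"
    using dd_poly[of p q] by metis
  have "\<forall>v. \<exists>P. (\<forall>\<tau>. poly P \<tau> = \<Delta> (p + \<tau> *s q) v) \<and> Polynomial.degree P \<le> N - 1 \<and>
    (\<Delta> q v \<noteq> 0 \<longrightarrow> P \<noteq> 0 \<and> Polynomial.degree P = N - 1)"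
    using Delta_poly[of p q] by metis
  then obtain E where E: "\<And>v \<tau>. poly (E v) \<tau> = \<Delta> (p + \<tau> *s q) v" "\<And>v. Polynomial.degree (E v) \<le> N - 1"
    "\<And>v. \<Delta> q v \<noteq> 0 \<Longrightarrow> E v \<noteq> 0 \<and> Polynomial.degree (E v) = N - 1"
    by metis
  have Enz: "E x \<noteq> 0" if "\<Delta> (p + \<tau> *s q) x \<noteq> 0" for x \<tau>
    using E(1)[of x \<tau>] that by auto
  define n m where "n = P v w" and "m = E v * E w"
  have m: "E v \<noteq> 0" "E w \<noteq> 0" using Enz[of 0] v w by auto
  have key: "n * (E (v + r *s u) * E u * (E (w + s *s u) * E u)) = m *
     (P (v + r *s u) (w + s *s u) * (E u * E u) - Polynomial.smult s (P (v + r *s u) u * (E (w + s *s u) * E u))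
      - Polynomial.smult r (P u (w + s *s u) * (E (v + r *s u) * E u))
      + Polynomial.smult (r * s) (P u u * (E (v + r *s u) * E (w + s *s u))))"
    (is "n * ?m' = m * ?n'")
    if nz: "E u \<noteq> 0" "E (v + r *s u) \<noteq> 0" "E (w + s *s u) \<noteq> 0" for u r s
  proof -
    \<comment> \<open>The factor \<open>m * ?m'\<close> makes the identity trivial where a
      denominator vanishes. As a nonzero polynomial it is cancelled afterwards.\<close>
    have "poly ((n * ?m' - m * ?n') * (m * ?m')) \<tau> = 0" for \<tau>
    proof (cases "poly (m * ?m') \<tau> = 0")
      case False
      define z where "z = p + \<tau> *s q"
      have g: "\<Delta> z v \<noteq> 0" "\<Delta> z w \<noteq> 0" "\<Delta> z u \<noteq> 0" "\<Delta> z (v + r *s u) \<noteq> 0" "\<Delta> z (w + s *s u) \<noteq> 0"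
        using False by (auto simp: m_def E(1) z_def)
      define A B C D F where "A = \<Delta> z v" and "B = \<Delta> z w" and "C = \<Delta> z u" and "D = \<Delta> z (v + r *s u)"
        and "F = \<Delta> z (w + s *s u)"
      have nz': "A \<noteq> 0" "B \<noteq> 0" "C \<noteq> 0" "D \<noteq> 0" "F \<noteq> 0" using g by (simp_all add: A_def B_def C_def D_def F_def)
      have "dd z v w / (A * B) = dd z (v + r *s u) (w + s *s u) / (D * F) - s * (dd z (v + r *s u) u / (D * C))
        - r * (dd z u (w + s *s u) / (C * F)) + r * s * (dd z u u / (C * C))"
        using R_shift[OF g] by (simp add: R_def A_def B_def C_def D_def F_def)
      hence "dd z v w / (A * B) * (A * B * (D * C * (F * C))) = (dd z (v + r *s u) (w + s *s u) / (D * F) - s * (dd z (v + r *s u) u / (D * C))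
        - r * (dd z u (w + s *s u) / (C * F)) + r * s * (dd z u u / (C * C))) * (A * B * (D * C * (F * C)))"
        by (rule arg_cong)
      hence "dd z v w * (D * C * (F * C)) = (A * B) * (dd z (v + r *s u) (w + s *s u) * (C * C) - s * (dd z (v + r *s u) u * (F * C))
        - r * (dd z u (w + s *s u) * (D * C)) + r * s * (dd z u u * (D * F)))"
        using nz' by (simp add: field_simps)
      hence "poly (n * ?m' - m * ?n') \<tau> = 0"
        by (simp add: n_def m_def E(1) A_def B_def C_def D_def F_def z_def flip: P(2))
      thus ?thesis by simp
    qed simp
    hence "(n * ?m' - m * ?n') * (m * ?m') = 0"
      using poly_all_0_iff_0 by blast
    moreover have "m * ?m' \<noteq> 0" using m nz by (simp add: m_def)
    ultimately show ?thesis by (simp only: mult_eq_0_iff) simp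
  qed
  have "n = 0"
  proof -
    obtain u where u: "\<Delta> q u \<noteq> 0" using exists_generic[OF q(1)] by blast
    obtain r where r: "\<Delta> q (v + r *s u) \<noteq> 0" using exists_generic_shift[OF u] by blast
    obtain s where s: "\<Delta> q (w + s *s u) \<noteq> 0" using exists_generic_shift[OF u] by blast
    let ?m' = "E (v + r *s u) * E u * (E (w + s *s u) * E u)"
    let ?n' = "P (v + r *s u) (w + s *s u) * (E u * E u) - Polynomial.smult s (P (v + r *s u) u * (E (w + s *s u) * E u))
      - Polynomial.smult r (P u (w + s *s u) * (E (v + r *s u) * E u))
      + Polynomial.smult (r * s) (P u u * (E (v + r *s u) * E (w + s *s u)))"
    have dm: "Polynomial.degree ?m' = 4 * (N - 1)"
      using E(3)[OF u] E(3)[OF r] E(3)[OF s] by (simp add: degree_mult_eq)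
    have lo: "low (2 * (N - 1) + 2 * N) (P x y * (E a * E b))" for x y a b
    proof -
      have "Polynomial.degree (E a * E b) \<le> 2 * (N - 1)"
        using degree_mult_le[of "E a" "E b"] E(2)[of a] E(2)[of b] by simp
      thus ?thesis using low_mult[of "E a * E b" "2 * (N - 1)" "2 * N" "P x y"] P(1) by (simp only: mult.commute)
    qed
    have sm: "low n Q \<Longrightarrow> low n (Polynomial.smult a Q)" for n Q a
      using degree_smult_le[of a Q] by (auto simp: low_def)
    have mi: "low n Q \<Longrightarrow> low n (- Q)" for n Q by (auto simp: low_def)
    have "low (2 * (N - 1) + 2 * N) ?n'"
      unfolding diff_conv_add_uminus by (intro low_add mi sm lo)
    \<comment> \<open>The numerator has degree at most \<open>4 * N - 2 - k\<close>, the denominator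
      \<open>4 * N - 4\<close>. The difference \<open>2 - k\<close> is the place where
      \<open>k = 2\<close> would fail.\<close>
    moreover have "2 * (N - 1) + 2 * N < 4 * (N - 1) + k"
      using N_pos k_ge_3 by simp
    ultimately have "?n' = 0 \<or> Polynomial.degree ?n' < Polynomial.degree ?m'"
      unfolding dm low_def by linarith
    moreover have nz: "E u \<noteq> 0" "E (v + r *s u) \<noteq> 0" "E (w + s *s u) \<noteq> 0"
      using E(3)[OF u] E(3)[OF r] E(3)[OF s] by blast+
    hence "?m' \<noteq> 0" by simp
    moreover have "n * ?m' = m * ?n'" by (rule key[OF nz])
    moreover have "\<exists>n' m'. poly m' z \<noteq> 0 \<and> n * m' = m * n'" for z
    proof -
      obtain u where u: "\<Delta> (p + z *s q) u \<noteq> 0" using exists_generic[OF q(2)] by blast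
      obtain r where r: "\<Delta> (p + z *s q) (v + r *s u) \<noteq> 0" using exists_generic_shift[OF u] by blast
      obtain s where s: "\<Delta> (p + z *s q) (w + s *s u) \<noteq> 0" using exists_generic_shift[OF u] by blast
      have "poly (E (v + r *s u) * E u * (E (w + s *s u) * E u)) z \<noteq> 0"
        using u r s by (simp add: E(1))
      thus ?thesis using key[OF Enz[OF u] Enz[OF r] Enz[OF s]] by blast
    qed
    moreover have "m \<noteq> 0" using m by (simp add: m_def)
    ultimately show ?thesis using poly_ratio_eq_0[of m n ?m' ?n'] by blast
  qed
  thus ?thesis using P(2)[of 0 v w] by (simp add: n_def)
qed

text \<open>Contraction with a generic \<open>w\<close> in the second argument is a derivation in
  the first, and \<open>dd_eq_0\<close> kills it. By skew symmetry this says that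
  \<open>\<delta>\<close> vanishes for the derivation with \<open>M'\<close> fixed, so
  \<open>derivation_eq_0\<close> applies a second time.\<close>

theorem biderivation_eq_0:
  assumes reg: "regular p"
  shows "\<beta> p M M' = 0"
proof -
  have c: "contr p w M = 0" if w: "\<Delta> p w \<noteq> 0" for w M
  proof -
    interpret point_derivation scale Basis G \<omega> \<rho> p "contr p w" by (rule contr_derivation)
    show ?thesis
      by (rule derivation_eq_0[OF reg]) (use dd_eq_0[OF reg _ w] in \<open>simp add: dd_eq_delta\<close>)
  qed
  have "point_derivation scale Basis G \<omega> \<rho> p (\<lambda>M. \<Sum>i\<in>{()}. 1 * \<beta> p M M')"
    by (rule point_derivation_sum)
  then interpret point_derivation scale Basis G \<omega> \<rho> p "\<lambda>M. \<beta> p M M'" by simp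
  show ?thesis
  proof (rule derivation_eq_0[OF reg])
    fix w assume w: "\<Delta> p w \<noteq> 0"
    have "\<delta> w = - contr p w M'"
      unfolding \<delta>_def contr_def sum_negf[symmetric]
      by (intro sum.cong refl) (subst beta_skew, simp)
    thus "\<delta> w = 0" by (simp add: c[OF w])
  qed
qed

end

section \<open>The filtration of the spherical subalgebra\<close>

lemma poly_mapping_keys_induct:
  assumes "P 0" "\<And>k a. k \<in> Poly_Mapping.keys x \<Longrightarrow> P (Poly_Mapping.single k a)"
    "\<And>x y. P x \<Longrightarrow> P y \<Longrightarrow> P (x + y)"
  shows "P (x :: 'k \<Rightarrow>\<^sub>0 'a::comm_monoid_add)"
proof -
  have "P (\<Sum>k\<in>A. Poly_Mapping.single k (Poly_Mapping.lookup x k))"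
    if "finite A" "A \<subseteq> Poly_Mapping.keys x" for A
    using that by induction (auto intro: assms)
  thus ?thesis
    by (subst poly_mapping_sum_singles) simp
qed

text \<open>A Vandermonde argument by interpolation: vanishing power sums give vanishing sums
  against every polynomial, and a polynomial with roots at all other values leaves only
  \<open>s\<close>. The other values may coincide among themselves.\<close>

lemma power_sums_eq_0:
  fixes f :: "'i \<Rightarrow> complex"
  assumes S: "finite S" and z: "\<And>r::nat. (\<Sum>s\<in>S. b s * f s ^ r) = 0"
    and s: "s \<in> S" and isolated: "\<And>s'. s' \<in> S \<Longrightarrow> s' \<noteq> s \<Longrightarrow> f s' \<noteq> f s"
  shows "b s = 0"
proof -
  have P: "(\<Sum>s\<in>S. b s * poly P (f s)) = 0" for P
  proof -
    have "(\<Sum>s\<in>S. b s * poly P (f s)) = (\<Sum>i\<le>Polynomial.degree P. Polynomial.coeff P i * (\<Sum>s\<in>S. b s * f s ^ i))"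
      unfolding poly_altdef sum_distrib_left by (subst sum.swap) (simp add: mult_ac)
    thus ?thesis by (simp add: z)
  qed
  let ?P = "\<Prod>s'\<in>S - {s}. [:- f s', 1:]"
  have "(\<Sum>s'\<in>S. b s' * poly ?P (f s')) = b s * poly ?P (f s) + (\<Sum>s'\<in>S - {s}. b s' * poly ?P (f s'))"
    by (rule sum.remove[OF S s])
  also have "(\<Sum>s'\<in>S - {s}. b s' * poly ?P (f s')) = 0"
    using S by (intro sum.neutral ballI) (auto simp: poly_prod)
  finally have "b s * poly ?P (f s) = 0" using P[of ?P] by simp
  moreover have "poly ?P (f s) \<noteq> 0"
    using S isolated by (fastforce simp: poly_prod)
  ultimately show ?thesis by simp
qed

text \<open>The variables receive distinct primes, all raised to a common power \<open>r\<close>. By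
  unique factorisation the monomials have distinct values for \<open>r = 1\<close>, so
  \<open>power_sums_eq_0\<close> separates them.\<close>

lemma monomials_independent:
  fixes b :: "nat multiset \<Rightarrow>\<^sub>0 complex"
  assumes z: "\<And>z. lin_ext (\<lambda>m. prod_mset (image_mset z m)) b = 0"
  shows "b = 0"
proof -
  obtain f :: "nat \<Rightarrow> nat" where f1: "inj f" "range f \<subseteq> {p. normalization_semidom_class.prime p}"
    using infinite_countable_subset[OF primes_infinite] by blast
  hence f: "inj f" "\<And>i. normalization_semidom_class.prime (f i)" by auto
  define val where "val m = (of_nat (prod_mset (image_mset f m)) :: complex)" for m
  have "inj val"
  proof (rule injI)
    fix m m' assume "val m = val m'"
    hence "prod_mset (image_mset f m) = prod_mset (image_mset f m')"
      by (simp only: val_def of_nat_eq_iff)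
    hence "prime_factorization (prod_mset (image_mset f m)) = prime_factorization (prod_mset (image_mset f m'))"
      by (rule arg_cong)
    hence "image_mset f m = image_mset f m'"
      using f(2) by (subst (asm) (1 2) prime_factorization_prod_mset_primes) auto
    thus "m = m'" using multiset.inj_map[OF f(1)] by (simp add: inj_def)
  qed
  moreover have "(\<Sum>m\<in>Poly_Mapping.keys b. Poly_Mapping.lookup b m * val m ^ r) = 0" for r
  proof -
    have "prod_mset (image_mset (\<lambda>i. of_nat (f i) ^ r) m) = val m ^ r" for m
      by (induction m) (simp_all add: val_def power_mult_distrib)
    thus ?thesis using z[of "\<lambda>i. of_nat (f i) ^ r"] by (simp add: lin_ext_def)
  qed
  ultimately have "Poly_Mapping.lookup b m = 0" if "m \<in> Poly_Mapping.keys b" for m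
    using power_sums_eq_0[of "Poly_Mapping.keys b" "Poly_Mapping.lookup b" val m] that
    by (auto simp: inj_def)
  thus ?thesis by (metis in_keys_iff poly_mapping_eqI lookup_zero)
qed

section \<open>Words and degrees in the free algebra\<close>

lemma plus_Word [simp]: "Word u + Word w = Word (u @ w)"
  by (simp add: plus_word_def)

lemma map_word_plus: "map_word f (u + w) = map_word f u + map_word f w"
  by (cases u; cases w) simp

lemma free_map_push: "free_map f = push (map_word f)"
  by (simp add: fun_eq_iff free_map_def push_def)

abbreviation W :: "'v list \<Rightarrow> 'v free_alg" where "W w \<equiv> Poly_Mapping.single (Word w) 1"

lemma free_scalar_W [simp]: "free_scalar a * W w = Poly_Mapping.single (Word w) a"
  by (simp add: free_scalar_def mult_single)

lemma free_scalar_1 [simp]: "free_scalar 1 = 1" and free_scalar_0 [simp]: "free_scalar 0 = 0"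
  by (simp_all add: free_scalar_def)

lemma free_scalar_mult: "free_scalar a * free_scalar b = free_scalar (a * b)"
  by (simp add: free_scalar_def mult_single)

lemma free_scalar_commute: "x * free_scalar a = free_scalar a * x"
  by (induction x rule: poly_mapping_additive_induct)
    (simp_all add: free_scalar_def mult_single ring_distribs mult.commute)

lemma free_map_hom:
  "free_map f (x * y) = free_map f x * free_map f y" "free_map f (x + y) = free_map f x + free_map f y"
  "free_map f (x - y) = free_map f x - free_map f y" "free_map f 0 = 0" "free_map f (- x) = - free_map f x"
  "free_map f (sum h A) = (\<Sum>i\<in>A. free_map f (h i))" "free_map f (free_scalar a) = free_scalar a"
  "free_map f (Poly_Mapping.single (Word w) a) = Poly_Mapping.single (Word (map f w)) a"
  by (simp_all add: free_map_push push_mult map_word_plus push_add push_diff push_uminus push_sum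
      free_scalar_def zero_word_def)

text \<open>\<open>k\<close> counts letters lost against the expected length \<open>n\<close>. It is
  added on the left rather than subtracted on the right, so that \<open>k > n\<close> leaves only
  the element 0.\<close>

definition deg_le :: "nat \<Rightarrow> nat \<Rightarrow> 'v free_alg \<Rightarrow> bool"
  where "deg_le k n x \<longleftrightarrow> (\<forall>w\<in>Poly_Mapping.keys x. length (letters w) + k \<le> n)"

lemma deg_le_0 [simp]: "deg_le k n 0"
  by (simp add: deg_le_def)

lemma deg_le_add: "deg_le k n x \<Longrightarrow> deg_le k n y \<Longrightarrow> deg_le k n (x + y)"
  using keys_add[of x y] by (auto simp: deg_le_def)

lemma keys_uminus_poly_mapping: "Poly_Mapping.keys (- x) = Poly_Mapping.keys (x :: 'k \<Rightarrow>\<^sub>0 complex)"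
  by (auto simp: in_keys_iff)

lemma deg_le_uminus: "deg_le k n x \<Longrightarrow> deg_le k n (- x)"
  by (simp add: deg_le_def keys_uminus_poly_mapping)

lemma deg_le_diff: "deg_le k n x \<Longrightarrow> deg_le k n y \<Longrightarrow> deg_le k n (x - y)"
  using deg_le_add[of k n x "- y"] by (simp add: deg_le_uminus)

lemma deg_le_sum: "(\<And>i. i \<in> A \<Longrightarrow> deg_le k n (f i)) \<Longrightarrow> deg_le k n (\<Sum>i\<in>A. f i)"
  by (induction A rule: infinite_finite_induct) (simp_all add: deg_le_add)

lemma deg_le_single: "length w + k \<le> n \<Longrightarrow> deg_le k n (Poly_Mapping.single (Word w) a)"
  by (simp add: deg_le_def)

lemma deg_le_scale: "deg_le k n x \<Longrightarrow> deg_le k n (free_scalar a * x)"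
  using keys_single_mult[of a x] by (auto simp: deg_le_def free_scalar_def)

lemma deg_le_induct [consumes 1, case_names zero single add]:
  assumes "deg_le k n x" "P 0" "\<And>w a. length w + k \<le> n \<Longrightarrow> P (Poly_Mapping.single (Word w) a)"
    "\<And>x y. P x \<Longrightarrow> P y \<Longrightarrow> P (x + y)"
  shows "P x"
proof (rule poly_mapping_keys_induct)
  fix w a assume "w \<in> Poly_Mapping.keys x"
  thus "P (Poly_Mapping.single w a)"
    using assms(1) assms(3)[of "letters w" a] by (auto simp: deg_le_def)
qed (use assms in auto)

context symplectic_action
begin

abbreviation act :: "'g \<Rightarrow> 'v free_alg \<Rightarrow> 'v free_alg" where "act g \<equiv> free_map (\<rho> g)"

lemma act_mult: "g \<in> carrier G \<Longrightarrow> h \<in> carrier G \<Longrightarrow> act g (act h x) = act (g \<otimes> h) x"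
  by (induction x rule: poly_mapping_additive_induct)
    (simp_all add: free_map_hom, metis free_map_hom(8) map_rho_map word.exhaust)

lemma act_one: "act \<one> x = x"
proof (induction x rule: poly_mapping_additive_induct)
  case (single w a)
  thus ?case by (cases w) (simp add: free_map_hom)
qed (simp_all add: free_map_hom)

text \<open>As \<open>(e x e) (e y e)\<close> is the mean of \<open>e x g(y) e\<close> over \<open>g\<close>, this is \<open>N\<close> times the product of the spherical subalgebra.\<close>

definition star :: "'v free_alg \<Rightarrow> 'v free_alg \<Rightarrow> 'v free_alg"
  where "star x y = (\<Sum>g\<in>carrier G. x * act g y)"

lemma star_add: "star (x + y) z = star x z + star y z" "star z (x + y) = star z x + star z y"
  and star_diff: "star (x - y) z = star x z - star y z" "star z (x - y) = star z x - star z y"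
  and star_zero: "star 0 z = 0" "star z 0 = 0"
  by (simp_all add: star_def free_map_hom ring_distribs sum.distrib sum_subtractf left_diff_distrib right_diff_distrib)

lemma star_scale: "star (free_scalar a * x) y = free_scalar a * star x y"
  "star x (free_scalar a * y) = free_scalar a * star x y"
  unfolding star_def sum_distrib_left
  by (simp_all add: free_map_hom mult.assoc) (metis (no_types, opaque_lifting) free_scalar_commute mult.assoc)

lemma star_assoc: "star (star x y) z = star x (star y z)"
proof -
  have "star x (star y z) = (\<Sum>g\<in>carrier G. \<Sum>h\<in>carrier G. x * act g y * act (g \<otimes> h) z)"
    unfolding star_def
    by (intro sum.cong refl) (simp add: free_map_hom sum_distrib_left act_mult mult.assoc)
  also have "\<dots> = (\<Sum>g\<in>carrier G. \<Sum>h\<in>carrier G. x * act g y * act h z)"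
    by (rule sum.cong[OF refl], rule sum_mult_left[where g = "\<lambda>h. x * act _ y * act h z"])
  also have "\<dots> = star (star x y) z"
    unfolding star_def sum_distrib_right by (rule sum.swap)
  finally show ?thesis by simp
qed

definition cm :: "'v free_alg \<Rightarrow> 'v free_alg \<Rightarrow> 'v free_alg"
  where "cm x y = star x y - star y x"

lemma cm_add: "cm (x + y) z = cm x z + cm y z" "cm z (x + y) = cm z x + cm z y"
  and cm_diff: "cm (x - y) z = cm x z - cm y z" "cm z (x - y) = cm z x - cm z y"
  and cm_zero: "cm 0 z = 0" "cm z 0 = 0"
  and cm_scale: "cm (free_scalar a * x) y = free_scalar a * cm x y" "cm x (free_scalar a * y) = free_scalar a * cm x y"
  and cm_skew: "cm x y = - cm y x"
  by (simp_all add: cm_def star_add star_diff star_zero star_scale right_diff_distrib)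

lemma cm_star: "cm (star x y) z = star x (cm y z) + star (cm x z) y"
  by (simp add: cm_def star_diff star_assoc)

section \<open>Symbols of words and their dependence on the point\<close>

definition word_val :: "'v \<Rightarrow> 'v list \<Rightarrow> complex"
  where "word_val p w = (\<Prod>x\<leftarrow>w. \<omega> x p)"

definition \<sigma> :: "'v \<Rightarrow> 'v list \<Rightarrow> complex"
  where "\<sigma> p w = (\<Sum>h\<in>carrier G. word_val p (map (\<rho> h) w))"

text \<open>For an element with \<open>deg_le k n\<close> this is the value at \<open>p\<close> of
  the symbol \<sigma> in degree \<open>n - k\<close>; words of any other length are dropped.\<close>

definition top :: "nat \<Rightarrow> nat \<Rightarrow> 'v \<Rightarrow> 'v free_alg \<Rightarrow> complex"
  where "top k n p = lin_ext (\<lambda>w. if length (letters w) + k = n then \<sigma> p (letters w) else 0)"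

lemma top_single [simp]: "top k n p (Poly_Mapping.single (Word w) a) = (if length w + k = n then a * \<sigma> p w else 0)"
  by (simp add: top_def)

lemma top_add: "top k n p (x + y) = top k n p x + top k n p y"
  and top_diff: "top k n p (x - y) = top k n p x - top k n p y"
  and top_uminus: "top k n p (- x) = - top k n p x"
  and top_0 [simp]: "top k n p 0 = 0"
  and top_sum: "top k n p (sum f A) = (\<Sum>i\<in>A. top k n p (f i))"
  and top_scale: "top k n p (free_scalar a * x) = a * top k n p x"
  by (simp_all add: top_def lin_ext_add lin_ext_diff lin_ext_uminus lin_ext_sum free_scalar_def lin_ext_scale)

lemma top_lower: "deg_le (Suc k) n x \<Longrightarrow> top k n p x = 0"
  unfolding top_def lin_ext_def by (intro sum.neutral ballI) (auto simp: deg_le_def)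

lemma star_single:
  "star (Poly_Mapping.single (Word u) a) (Poly_Mapping.single (Word w) b) =
    (\<Sum>g\<in>carrier G. Poly_Mapping.single (Word (u @ map (\<rho> g) w)) (a * b))"
  by (simp add: star_def free_map_hom mult_single)

lemma word_val_append: "word_val p (u @ w) = word_val p u * word_val p w"
  by (simp add: word_val_def)

lemma sum_sigma_append: "(\<Sum>g\<in>carrier G. \<sigma> p (u @ map (\<rho> g) w)) = \<sigma> p u * \<sigma> p w"
proof -
  have "(\<Sum>g\<in>carrier G. \<sigma> p (u @ map (\<rho> g) w)) =
    (\<Sum>h\<in>carrier G. \<Sum>g\<in>carrier G. word_val p (map (\<rho> h) u) * word_val p (map (\<rho> (h \<otimes> g)) w))"
    unfolding \<sigma>_def by (subst sum.swap, intro sum.cong refl)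
      (simp only: map_append word_val_append map_rho_map)
  also have "\<dots> = (\<Sum>h\<in>carrier G. \<Sum>g\<in>carrier G. word_val p (map (\<rho> h) u) * word_val p (map (\<rho> g) w))"
    by (rule sum.cong[OF refl], rule sum_mult_left[where g = "\<lambda>g. _ * word_val p (map (\<rho> g) w)"])
  also have "\<dots> = \<sigma> p u * \<sigma> p w"
    unfolding \<sigma>_def sum_product ..
  finally show ?thesis .
qed

text \<open>Symbols multiply, and both orders of the factors give the same value: the associated
  graded algebra is commutative.\<close>

lemma top_star:
  assumes "deg_le 0 m x" "deg_le k n z"
  shows "top k (m + n) p (star x z) = top 0 m p x * top k n p z"
    and "top k (m + n) p (star z x) = top 0 m p x * top k n p z"
proof -
  have "top k (m + n) p (star x z) = top 0 m p x * top k n p z \<and> top k (m + n) p (star z x) = top 0 m p x * top k n p z"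
    using assms(1)
  proof (induction rule: deg_le_induct)
    case (single u a)
    show ?case using assms(2)
    proof (induction rule: deg_le_induct)
      case (single w b)
      show ?case using \<open>length u + 0 \<le> m\<close> \<open>length w + k \<le> n\<close>
        by (auto simp: star_single top_sum sum_sigma_append simp flip: sum_distrib_left)
    qed (simp_all add: star_zero star_add top_add ring_distribs)
  qed (simp_all add: star_zero star_add top_add ring_distribs)
  thus "top k (m + n) p (star x z) = top 0 m p x * top k n p z"
    "top k (m + n) p (star z x) = top 0 m p x * top k n p z" by auto
qed

lemma word_val_poly:
  "\<exists>P. Polynomial.degree P \<le> length w \<and> (\<forall>\<tau>. word_val (p + \<tau> *s q) w = poly P \<tau>)"
proof (induction w)
  case Nil
  show ?case by (intro exI[of _ 1]) (simp add: word_val_def)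
next
  case (Cons x w)
  then obtain P where P: "Polynomial.degree P \<le> length w" "\<forall>\<tau>. word_val (p + \<tau> *s q) w = poly P \<tau>" by blast
  have "Polynomial.degree ([:\<omega> x p, \<omega> x q:] * P) \<le> length (x # w)"
    using degree_mult_le[of "[:\<omega> x p, \<omega> x q:]" P] P(1) degree_pCons_le[of "\<omega> x p" "[:\<omega> x q:]"] by simp
  moreover have "word_val (p + \<tau> *s q) (x # w) = poly ([:\<omega> x p, \<omega> x q:] * P) \<tau>" for \<tau>
    using P(2) by (simp add: word_val_def form_linear algebra_simps)
  ultimately show ?case by blast
qed

lemma sigma_poly:
  "\<exists>P. Polynomial.degree P \<le> length w \<and> (\<forall>\<tau>. \<sigma> (p + \<tau> *s q) w = poly P \<tau>)"
proof -
  have "\<forall>h. \<exists>P. Polynomial.degree P \<le> length w \<and> (\<forall>\<tau>. word_val (p + \<tau> *s q) (map (\<rho> h) w) = poly P \<tau>)"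
    using word_val_poly[of "map (\<rho> _) w"] by simp
  then obtain P where P: "\<And>h. Polynomial.degree (P h) \<le> length w"
    "\<And>h \<tau>. word_val (p + \<tau> *s q) (map (\<rho> h) w) = poly (P h) \<tau>" by metis
  show ?thesis
    by (rule exI[of _ "\<Sum>h\<in>carrier G. P h"])
      (auto simp: \<sigma>_def poly_sum P(2) intro!: degree_sum_le P(1) fin)
qed

lemma top_poly:
  assumes "deg_le k n x"
  shows "\<exists>P. (P = 0 \<or> Polynomial.degree P + k \<le> n) \<and> (\<forall>\<tau>. top k n (p + \<tau> *s q) x = poly P \<tau>)"
  using assms
proof (induction rule: deg_le_induct)
  case (single w a)
  obtain P where P: "Polynomial.degree P \<le> length w" "\<forall>\<tau>. \<sigma> (p + \<tau> *s q) w = poly P \<tau>"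
    using sigma_poly by blast
  show ?case
  proof (cases "length w + k = n")
    case True
    thus ?thesis using P degree_smult_le[of a P]
      by (intro exI[of _ "Polynomial.smult a P"]) auto
  qed (auto intro!: exI[of _ 0])
next
  case (add x y)
  then obtain P Q where P: "P = 0 \<or> Polynomial.degree P + k \<le> n" "\<And>\<tau>. top k n (p + \<tau> *s q) x = poly P \<tau>"
    and Q: "Q = 0 \<or> Polynomial.degree Q + k \<le> n" "\<And>\<tau>. top k n (p + \<tau> *s q) y = poly Q \<tau>" by blast
  have "P + Q = 0 \<or> Polynomial.degree (P + Q) + k \<le> n"
  proof (cases "P = 0 \<or> Q = 0")
    case False
    have "Polynomial.degree (P + Q) \<le> n - k"
      by (rule degree_add_le) (use P(1) Q(1) False in auto)
    thus ?thesis using P(1) False by auto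
  qed (use P(1) Q(1) in auto)
  thus ?case using P(2) Q(2) by (intro exI[of _ "P + Q"]) (simp add: top_add)
qed (auto intro!: exI[of _ 0])

text \<open>Faithfulness provides for each \<open>h \<noteq> \<one>\<close> a nonzero vector
  \<open>y h - \<rho> (inv h) (y h)\<close>; a point not orthogonal to it is moved by
  \<open>h\<close>.\<close>

lemma exists_regular: "\<exists>q. regular q"
proof -
  have "\<exists>y. y - \<rho> (inv h) y \<noteq> 0" if h: "h \<in> carrier G - {\<one>}" for h
  proof (rule ccontr)
    assume "\<not> ?thesis"
    hence "\<rho> (inv h) y = y" for y by (metis eq_iff_diff_eq_0)
    hence "inv h = \<one>" by (intro faithful) (use h in auto)
    thus False using h by (metis DiffE inv_inv inv_one singletonI)
  qed
  then obtain y where y: "\<And>h. h \<in> carrier G - {\<one>} \<Longrightarrow> y h - \<rho> (inv h) (y h) \<noteq> 0" by metis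
  obtain q where q: "\<forall>h\<in>carrier G - {\<one>}. \<omega> q (y h - \<rho> (inv h) (y h)) \<noteq> 0"
    using nonvanishing_vector[of "carrier G - {\<one>}" "\<lambda>h. y h - \<rho> (inv h) (y h)"] y fin by auto
  have "\<rho> h q \<noteq> q" if h: "h \<in> carrier G - {\<one>}" for h
  proof
    assume "\<rho> h q = q"
    moreover have "\<omega> q (y h - \<rho> (inv h) (y h)) = \<omega> q (y h) - \<omega> (\<rho> h q) (y h)"
      using h by (simp add: form_linear form_rho_adjoint)
    ultimately show False using q h by auto
  qed
  thus ?thesis by (auto simp: regular_def)
qed

text \<open>On a line through \<open>p\<close> in a regular direction each nontrivial
  \<open>h\<close> fixes at most one point. So the polynomial has infinitely many zeros.\<close>

lemma vanish_of_regular: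
  assumes reg: "\<And>p. regular p \<Longrightarrow> F p = 0"
    and poly: "\<And>p q. \<exists>P. \<forall>\<tau>. F (p + \<tau> *s q) = poly P \<tau>"
  shows "F p = 0"
proof -
  obtain q where q: "regular q" using exists_regular by blast
  obtain P where P: "\<And>\<tau>. F (p + \<tau> *s q) = poly P \<tau>" using poly by blast
  have one: "\<tau> = \<tau>'" if h: "h \<in> carrier G - {\<one>}" and
    "\<rho> h (p + \<tau> *s q) = p + \<tau> *s q" "\<rho> h (p + \<tau>' *s q) = p + \<tau>' *s q" for h \<tau> \<tau>'
  proof (rule ccontr)
    assume ne: "\<tau> \<noteq> \<tau>'"
    have "\<rho> h ((\<tau> - \<tau>') *s q) = (p + \<tau> *s q) - (p + \<tau>' *s q)"
      using that by (simp add: rho_lin scale_left_diff_distrib) (metis add_diff_cancel_left add_diff_eq)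
    hence "(\<tau> - \<tau>') *s (\<rho> h q - q) = 0"
      using h by (simp add: rho_lin scale_left_diff_distrib scale_right_diff_distrib)
    hence "\<rho> h q = q" using ne by simp
    thus False using q h by (auto simp: regular_def)
  qed
  have "finite {\<tau>. \<rho> h (p + \<tau> *s q) = p + \<tau> *s q}" if "h \<in> carrier G - {\<one>}" for h
  proof (cases "\<exists>\<tau>. \<rho> h (p + \<tau> *s q) = p + \<tau> *s q")
    case True
    then obtain \<tau> where "\<rho> h (p + \<tau> *s q) = p + \<tau> *s q" by blast
    hence "{\<tau>. \<rho> h (p + \<tau> *s q) = p + \<tau> *s q} \<subseteq> {\<tau>}" using one[OF that] by blast
    thus ?thesis by (rule finite_subset) simp
  qed simp
  hence "finite (\<Union>h\<in>carrier G - {\<one>}. {\<tau>. \<rho> h (p + \<tau> *s q) = p + \<tau> *s q})" using fin by blast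
  hence "infinite (UNIV - (\<Union>h\<in>carrier G - {\<one>}. {\<tau>. \<rho> h (p + \<tau> *s q) = p + \<tau> *s q}))"
    by (intro Diff_infinite_finite infinite_UNIV_char_0)
  moreover have "UNIV - (\<Union>h\<in>carrier G - {\<one>}. {\<tau>. \<rho> h (p + \<tau> *s q) = p + \<tau> *s q}) \<subseteq> {\<tau>. poly P \<tau> = 0}"
  proof
    fix \<tau> assume "\<tau> \<in> UNIV - (\<Union>h\<in>carrier G - {\<one>}. {\<tau>. \<rho> h (p + \<tau> *s q) = p + \<tau> *s q})"
    hence "regular (p + \<tau> *s q)" by (simp add: regular_def)
    thus "\<tau> \<in> {\<tau>. poly P \<tau> = 0}" using reg[of "p + \<tau> *s q"] P[of \<tau>] by simp
  qed
  ultimately have "infinite {\<tau>. poly P \<tau> = 0}" using infinite_super by blast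
  hence "P = 0" using poly_roots_finite by blast
  thus ?thesis using P[of 0] by simp
qed

text \<open>
  Summed over \<open>h\<close>, these are the two arguments of \<open>\<kappa>\<close> in the term of \<open>g\<close> of the symbol of a commutator.
\<close>

definition slide :: "'v \<Rightarrow> 'g \<Rightarrow> 'g \<Rightarrow> 'v list \<Rightarrow> 'v"
  where "slide p g h w = (\<Sum>i<length w. (word_val p (map (\<rho> h) (take i w)) *
    word_val p (map (\<rho> (g \<otimes> h)) (drop (Suc i) w))) *s \<rho> h (w ! i))"

text \<open>The words whose first \<open>i\<close> letters are moved by \<open>h\<close> and the
  others by \<open>g \<otimes> h\<close> interpolate between the two ends, and consecutive ones
  differ in one letter.\<close>

lemma slide_telescope:
  assumes g: "g \<in> carrier G" and h: "h \<in> carrier G"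
  shows "\<omega> (slide p g h w - \<rho> g (slide p g h w)) p = word_val p (map (\<rho> h) w) - word_val p (map (\<rho> (g \<otimes> h)) w)"
proof -
  define F where "F i = word_val p (map (\<rho> h) (take i w)) * word_val p (map (\<rho> (g \<otimes> h)) (drop i w))" for i
  have "\<omega> (slide p g h w - \<rho> g (slide p g h w)) p = (\<Sum>i<length w. (word_val p (map (\<rho> h) (take i w)) *
    word_val p (map (\<rho> (g \<otimes> h)) (drop (Suc i) w))) * (\<omega> (\<rho> h (w ! i)) p - \<omega> (\<rho> (g \<otimes> h) (w ! i)) p))"
    using g h by (simp add: slide_def rho_lin rho_mult form_linear algebra_simps sum_subtractf)
  also have "\<dots> = (\<Sum>i<length w. F (Suc i) - F i)"
  proof (intro sum.cong refl)
    fix i assume "i \<in> {..<length w}"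
    hence i: "take (Suc i) w = take i w @ [w ! i]" "drop i w = w ! i # drop (Suc i) w"
      by (simp_all add: take_Suc_conv_app_nth Cons_nth_drop_Suc)
    show "(word_val p (map (\<rho> h) (take i w)) * word_val p (map (\<rho> (g \<otimes> h)) (drop (Suc i) w))) *
      (\<omega> (\<rho> h (w ! i)) p - \<omega> (\<rho> (g \<otimes> h) (w ! i)) p) = F (Suc i) - F i"
      unfolding F_def i by (simp add: word_val_def algebra_simps)
  qed
  also have "\<dots> = F (length w) - F 0" by (rule sum_lessThan_telescope)
  also have "\<dots> = word_val p (map (\<rho> h) w) - word_val p (map (\<rho> (g \<otimes> h)) w)"
    by (simp add: F_def word_val_def)
  finally show ?thesis .
qed

text \<open>For \<open>g = \<one>\<close> this is the differential at \<open>p\<close> of the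
  invariant function \<open>\<sigma>\<close> of the word, with a linear function on \<open>V\<close>
  written as a vector by means of \<omega>.\<close>

definition slides :: "'v \<Rightarrow> 'g \<Rightarrow> 'v list \<Rightarrow> 'v"
  where "slides p g w = (\<Sum>h\<in>carrier G. slide p g h w)"

text \<open>After summation over \<open>h\<close> the two ends of the telescoping sum differ by a
  reindexing only.\<close>

lemma slides_orthogonal:
  assumes g: "g \<in> carrier G"
  shows "\<omega> (slides p g w - \<rho> g (slides p g w)) p = 0"
proof -
  have "\<omega> (slides p g w - \<rho> g (slides p g w)) p = (\<Sum>h\<in>carrier G. \<omega> (slide p g h w - \<rho> g (slide p g h w)) p)"
    using g by (simp add: slides_def rho_lin form_linear sum_subtractf)
  also have "\<dots> = (\<Sum>h\<in>carrier G. word_val p (map (\<rho> h) w)) - (\<Sum>h\<in>carrier G. word_val p (map (\<rho> (g \<otimes> h)) w))"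
    using g by (simp add: slide_telescope sum_subtractf)
  also have "\<dots> = 0"
    using sum_mult_left[OF g, of "\<lambda>h. word_val p (map (\<rho> h) w)"] by simp
  finally show ?thesis .
qed

end

section \<open>Commutators in the spherical subalgebra\<close>

text \<open>\<open>K\<close> plays the role of the elements \<open>x\<close> with
  \<open>e x e = 0\<close>. The locale shields the filtration argument from the quotient
  constructions; \<open>K_functional\<close> is the one assumption that keeps elements out of
  \<open>K\<close>.\<close>

locale spherical_kernel = symplectic_reflection_data scale Basis G \<omega> \<rho> t c
  for scale :: "complex \<Rightarrow> 'v::ab_group_add \<Rightarrow> 'v" (infixr \<open>*s\<close> 75)
    and Basis and G :: "('g, 'm) monoid_scheme" (structure) and \<omega> \<rho> t c +
  fixes K :: "'v free_alg set"
  assumes K_0: "0 \<in> K" and K_add: "x \<in> K \<Longrightarrow> y \<in> K \<Longrightarrow> x + y \<in> K"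
    and K_scale: "x \<in> K \<Longrightarrow> free_scalar r * x \<in> K"
    and K_linear: "W (u @ (a *s x' + b *s y') # f) - (free_scalar a * W (u @ x' # f) + free_scalar b * W (u @ y' # f)) \<in> K"
    and K_relation: "W (u @ [x',y'] @ f) - W (u @ [y',x'] @ f)
      - (\<Sum>g\<in>carrier G. free_scalar (\<kappa> g x' y') * W (u @ map (\<rho> g) f)) \<in> K"
    and K_act: "g \<in> carrier G \<Longrightarrow> x - act g x \<in> K"
    and K_star: "x \<in> K \<Longrightarrow> star x y \<in> K" "x \<in> K \<Longrightarrow> star y x \<in> K"
    and K_functional: "x \<in> K \<Longrightarrow> multilinear \<l> \<Longrightarrow> (\<And>n. pbw_relation n \<l>) \<Longrightarrow>
      lin_ext (\<lambda>w. \<Sum>g\<in>carrier G. \<l> (map (\<rho> g) (letters w))) x = 0"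
begin

lemma K_uminus: "x \<in> K \<Longrightarrow> - x \<in> K"
  using K_scale[of x "-1"] by (simp add: free_scalar_def single_uminus)

lemma K_diff: "x \<in> K \<Longrightarrow> y \<in> K \<Longrightarrow> x - y \<in> K"
  using K_add[of x "- y"] K_uminus[of y] by simp

lemma K_sum: "(\<And>i. i \<in> A \<Longrightarrow> f i \<in> K) \<Longrightarrow> (\<Sum>i\<in>A. f i) \<in> K"
  by (induction A rule: infinite_finite_induct) (simp_all add: K_0 K_add)

lemma K_cm: "x \<in> K \<Longrightarrow> cm x y \<in> K" "x \<in> K \<Longrightarrow> cm y x \<in> K"
  by (simp_all add: cm_def K_diff K_star)

text \<open>That the symbol is well defined modulo \<open>K\<close> is the Poincare-Birkhoff-Witt theorem.\<close>

lemma top_K: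
  assumes x: "x \<in> K" "deg_le k n x"
  shows "top k n p x = 0"
proof (cases "k \<le> n")
  case True
  obtain \<l> where \<l>: "multilinear \<l>" "\<And>n. pbw_relation n \<l>"
    "\<And>w. length w < n - k \<Longrightarrow> \<l> w = 0" "\<And>w. length w = n - k \<Longrightarrow> \<l> w = (\<Prod>x\<leftarrow>w. \<omega> x p)"
    using pbw_functional[of "n - k" p] by metis
  have "top k n p x = lin_ext (\<lambda>w. \<Sum>g\<in>carrier G. \<l> (map (\<rho> g) (letters w))) x"
    unfolding top_def
  proof (rule lin_ext_cong)
    fix w assume "w \<in> Poly_Mapping.keys x"
    hence "length (letters w) + k \<le> n" using x by (simp add: deg_le_def)
    thus "(if length (letters w) + k = n then \<sigma> p (letters w) else 0) = (\<Sum>g\<in>carrier G. \<l> (map (\<rho> g) (letters w)))"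
      using \<l>(3)[of "map (\<rho> _) (letters w)"] \<l>(4)[of "map (\<rho> _) (letters w)"]
      by (auto simp: \<sigma>_def word_val_def)
  qed
  thus ?thesis using K_functional[OF x(1) \<l>(1,2)] by simp
next
  case False
  hence "Poly_Mapping.keys x = {}" using x(2) by (auto simp: deg_le_def)
  thus ?thesis by (simp add: top_def lin_ext_def)
qed

definition Low :: "nat \<Rightarrow> nat \<Rightarrow> 'v free_alg set"
  where "Low k n = {x. \<exists>y. deg_le (Suc k) n y \<and> x - y \<in> K}"

lemma Low_K: "x \<in> K \<Longrightarrow> x \<in> Low k n"
  unfolding Low_def by (auto intro!: exI[of _ 0])

lemma Low_deg: "deg_le (Suc k) n x \<Longrightarrow> x \<in> Low k n"
  unfolding Low_def by (auto intro!: exI[of _ x] K_0)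

lemma Low_add: "x \<in> Low k n \<Longrightarrow> y \<in> Low k n \<Longrightarrow> x + y \<in> Low k n"
  unfolding Low_def by safe (metis K_add add_diff_add deg_le_add)

lemma Low_scale: "x \<in> Low k n \<Longrightarrow> free_scalar a * x \<in> Low k n"
  unfolding Low_def by safe (metis K_scale deg_le_scale right_diff_distrib)

lemma Low_uminus: "x \<in> Low k n \<Longrightarrow> - x \<in> Low k n"
  using Low_scale[of x k n "-1"] by (simp add: free_scalar_def single_uminus)

lemma Low_0: "0 \<in> Low k n"
  by (simp add: Low_K K_0)

lemma Low_sum: "(\<And>i. i \<in> A \<Longrightarrow> f i \<in> Low k n) \<Longrightarrow> (\<Sum>i\<in>A. f i) \<in> Low k n"
  by (induction A rule: infinite_finite_induct) (simp_all add: Low_0 Low_add)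

lemma Low_trans: "x - y \<in> Low k n \<Longrightarrow> y - z \<in> Low k n \<Longrightarrow> x - z \<in> Low k n"
  using Low_add[of "x - y" k n "y - z"] by simp

text \<open>The relation replaces the difference by words two letters shorter. Hence letters commute
  in the associated graded algebra.\<close>

lemma Low_swap:
  assumes "length u + length f + 2 + k = n"
  shows "W (u @ [x,y] @ f) - W (u @ [y,x] @ f) \<in> Low k n"
proof -
  let ?s = "\<Sum>g\<in>carrier G. free_scalar (\<kappa> g x y) * W (u @ map (\<rho> g) f)"
  have "?s \<in> Low k n"
    by (intro Low_deg deg_le_sum deg_le_scale deg_le_single) (use assms in simp)
  from Low_add[OF Low_K[OF K_relation[of u x y f]] this] show ?thesis by simp
qed

lemma Low_move:
  assumes "length u + length w + length f + 1 + k = n"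
  shows "W (u @ w @ x # f) - W (u @ x # w @ f) \<in> Low k n"
  using assms
proof (induction w arbitrary: u)
  case (Cons y w)
  have "W ((u @ [y]) @ w @ x # f) - W ((u @ [y]) @ x # w @ f) \<in> Low k n"
    by (rule Cons.IH) (use Cons.prems in simp)
  moreover have "W (u @ [y,x] @ (w @ f)) - W (u @ [x,y] @ (w @ f)) \<in> Low k n"
    by (rule Low_swap) (use Cons.prems in simp)
  ultimately show ?case using Low_trans[of "W (u @ (y # w) @ x # f)" "W (u @ y # x # w @ f)" k n "W (u @ x # (y # w) @ f)"] by simp
qed (simp add: Low_0)

lemma Low_permute:
  assumes "mset w = mset w'" "length u + length w + k = n"
  shows "W (u @ w) - W (u @ w') \<in> Low k n"
  using assms
proof (induction w arbitrary: u w')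
  case (Cons x w)
  have "x \<in> set w'" using Cons.prems(1) by (metis list.set_intros(1) set_mset_mset)
  then obtain p q where pq: "w' = p @ x # q" by (auto simp: in_set_conv_decomp)
  hence m: "mset w = mset (p @ q)" using Cons.prems(1) by simp
  hence l: "length w = length p + length q" using mset_eq_length[OF m] by simp
  have "W ((u @ [x]) @ w) - W ((u @ [x]) @ (p @ q)) \<in> Low k n"
    by (rule Cons.IH[OF m]) (use Cons.prems in simp)
  moreover have "W (u @ p @ x # q) - W (u @ x # p @ q) \<in> Low k n"
    by (rule Low_move) (use Cons.prems l in simp)
  hence "- (W (u @ p @ x # q) - W (u @ x # p @ q)) \<in> Low k n" by (rule Low_uminus)
  hence "W (u @ x # p @ q) - W (u @ p @ x # q) \<in> Low k n" by simp
  ultimately show ?case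
    using Low_trans[of "W (u @ x # w)" "W (u @ x # p @ q)" k n "W (u @ p @ x # q)"] by (simp add: pq)
qed (simp add: Low_0)

definition plain :: "nat \<Rightarrow> nat \<Rightarrow> 'v \<Rightarrow> 'v free_alg \<Rightarrow> complex"
  where "plain k n p = lin_ext (\<lambda>w. if length (letters w) + k = n then word_val p (letters w) else 0)"

lemma plain_single [simp]:
  "plain k n p (Poly_Mapping.single (Word w) a) = (if length w + k = n then a * word_val p w else 0)"
  by (simp add: plain_def)

lemma plain_linear: "plain k n p (x + y) = plain k n p x + plain k n p y" "plain k n p 0 = 0"
  "plain k n p (x - y) = plain k n p x - plain k n p y"
  "plain k n p (free_scalar a * x) = a * plain k n p x"
  "plain k n p (sum f A) = (\<Sum>i\<in>A. plain k n p (f i))"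
  by (simp_all add: plain_def lin_ext_add lin_ext_diff lin_ext_sum free_scalar_def lin_ext_scale)

lemma plain_act: "(\<Sum>g\<in>carrier G. plain k n p (act g x)) = top k n p x"
proof (induction x rule: poly_mapping_additive_induct)
  case (single w a)
  thus ?case by (cases w) (simp add: free_map_hom \<sigma>_def sum_distrib_left)
qed (simp_all add: free_map_hom plain_linear top_add sum.distrib)

definition canon :: "nat multiset \<Rightarrow> 'v word"
  where "canon m = Word (map e (sorted_list_of_multiset m))"

text \<open>The spanning half of the Poincare-Birkhoff-Witt theorem: modulo lower terms only sorted
  basis words remain. The last clause preserves the symbol, from which the coefficients
  \<open>b\<close> will be recovered.\<close>

definition reducible :: "nat \<Rightarrow> nat \<Rightarrow> 'v free_alg \<Rightarrow> bool"
  where "reducible k n x \<longleftrightarrow> (\<exists>b :: nat multiset \<Rightarrow>\<^sub>0 complex.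
    (\<forall>m\<in>Poly_Mapping.keys b. set_mset m \<subseteq> {..<d} \<and> size m + k = n) \<and> x - push canon b \<in> Low k n \<and>
    (\<forall>p. plain k n p x = plain k n p (push canon b)))"

lemma reducible_add:
  assumes "reducible k n x" "reducible k n y"
  shows "reducible k n (x + y)"
proof -
  from assms obtain b b' where
    b: "\<forall>m\<in>Poly_Mapping.keys b. set_mset m \<subseteq> {..<d} \<and> size m + k = n" "x - push canon b \<in> Low k n"
      "\<And>p. plain k n p x = plain k n p (push canon b)" and
    b': "\<forall>m\<in>Poly_Mapping.keys b'. set_mset m \<subseteq> {..<d} \<and> size m + k = n" "y - push canon b' \<in> Low k n"
      "\<And>p. plain k n p y = plain k n p (push canon b')"
    unfolding reducible_def by blast
  have "\<forall>m\<in>Poly_Mapping.keys (b + b'). set_mset m \<subseteq> {..<d} \<and> size m + k = n"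
    using b(1) b'(1) keys_add[of b b'] by blast
  moreover have "x + y - push canon (b + b') \<in> Low k n"
    using Low_add[OF b(2) b'(2)] by (simp add: push_add algebra_simps)
  ultimately show ?thesis
    unfolding reducible_def by (intro exI[of _ "b + b'"]) (auto simp: push_add plain_linear b(3) b'(3))
qed

lemma reducible_0: "reducible k n 0"
  unfolding reducible_def by (intro exI[of _ 0]) (simp add: Low_0)

lemma reducible_sum: "(\<And>i. i \<in> A \<Longrightarrow> reducible k n (f i)) \<Longrightarrow> reducible k n (\<Sum>i\<in>A. f i)"
  by (induction A rule: infinite_finite_induct) (simp_all add: reducible_0 reducible_add)

lemma reducible_scale:
  assumes "reducible k n x"
  shows "reducible k n (free_scalar a * x)"
proof -
  from assms obtain b where
    b: "\<forall>m\<in>Poly_Mapping.keys b. set_mset m \<subseteq> {..<d} \<and> size m + k = n" "x - push canon b \<in> Low k n"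
      "\<And>p. plain k n p x = plain k n p (push canon b)"
    unfolding reducible_def by blast
  let ?b = "Poly_Mapping.single 0 a * b"
  have p: "push canon ?b = free_scalar a * push canon b"
  proof (induction b rule: poly_mapping_additive_induct)
    case (single m r)
    thus ?case by (cases "canon m") (simp add: mult_single free_scalar_def)
  qed (simp_all add: ring_distribs push_add)
  show ?thesis
    unfolding reducible_def p
  proof (intro exI[of _ ?b] conjI allI)
    show "\<forall>m\<in>Poly_Mapping.keys ?b. set_mset m \<subseteq> {..<d} \<and> size m + k = n"
      using b(1) keys_single_mult[of a b] by blast
    show "free_scalar a * x - push canon ?b \<in> Low k n"
      using Low_scale[OF b(2), of a] by (simp add: p right_diff_distrib)
    show "plain k n p (free_scalar a * x) = plain k n p (push canon ?b)" for p
      by (simp add: p plain_linear b(3))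
  qed
qed

lemma reducible_cong:
  assumes "reducible k n y" "x - y \<in> Low k n" "\<And>p. plain k n p x = plain k n p y"
  shows "reducible k n x"
  using assms unfolding reducible_def by (metis Low_trans)

lemma word_val_mset: "word_val p (map e \<alpha>) = prod_mset (image_mset (\<lambda>i. \<omega> (e i) p) (mset \<alpha>))"
  by (induction \<alpha>) (simp_all add: word_val_def)

lemma form_expand: "\<omega> v p = (\<Sum>i<d. coord i v * \<omega> (e i) p)"
  by (subst coord_expand[of v]) (simp only: form_linear)

lemma reducible_word:
  assumes "set \<alpha> \<subseteq> {..<d}" "length \<alpha> + length w + k = n"
  shows "reducible k n (W (map e \<alpha> @ w))"
  using assms
proof (induction w arbitrary: \<alpha>)
  case Nil
  let ?b = "Poly_Mapping.single (mset \<alpha>) (1::complex)"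
  have "W ([] @ map e \<alpha>) - W ([] @ map e (sorted_list_of_multiset (mset \<alpha>))) \<in> Low k n"
    by (rule Low_permute) (use Nil in simp_all)
  moreover have "plain k n p (W (map e \<alpha>)) = plain k n p (push canon ?b)" for p
    using Nil by (simp add: canon_def word_val_mset)
  ultimately show ?case
    unfolding reducible_def using Nil by (intro exI[of _ ?b]) (simp add: canon_def)
next
  case (Cons v w)
  let ?y = "\<Sum>i<d. free_scalar (coord i v) * W (map e \<alpha> @ e i # w)"
  have "reducible k n (W (map e (\<alpha> @ [i]) @ w))" if "i < d" for i
    by (rule Cons.IH) (use Cons.prems that in simp_all)
  hence "reducible k n ?y"
    by (intro reducible_sum reducible_scale) simp
  moreover have "W (map e \<alpha> @ v # w) - ?y \<in> Low k n"
  proof -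
    have "W (map e \<alpha> @ (\<Sum>i\<in>A. coord i v *s e i) # w) - (\<Sum>i\<in>A. free_scalar (coord i v) * W (map e \<alpha> @ e i # w)) \<in> K"
      if "finite A" for A
      using that
    proof induction
      case empty
      show ?case using K_linear[of "map e \<alpha>" 0 0 0 0 w] by simp
    next
      case (insert j A)
      have "W (map e \<alpha> @ (coord j v *s e j + 1 *s (\<Sum>i\<in>A. coord i v *s e i)) # w) -
        (free_scalar (coord j v) * W (map e \<alpha> @ e j # w) + free_scalar 1 * W (map e \<alpha> @ (\<Sum>i\<in>A. coord i v *s e i) # w)) \<in> K"
        by (rule K_linear)
      from K_add[OF this insert.IH] show ?case
        using insert.hyps by (simp add: algebra_simps)
    qed
    from this[of "{..<d}"] show ?thesis
      by (intro Low_K) (simp flip: coord_expand)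
  qed
  moreover have "plain k n p (W (map e \<alpha> @ v # w)) = plain k n p ?y" for p
  proof -
    have "\<omega> v p = (\<Sum>i<d. coord i v * \<omega> (e i) p)"
      by (rule form_expand)
    hence "word_val p (map e \<alpha> @ v # w) = (\<Sum>i<d. coord i v * word_val p (map e \<alpha> @ e i # w))"
      by (simp add: word_val_def sum_distrib_left sum_distrib_right mult_ac)
    thus ?thesis using Cons.prems by (simp add: plain_linear(5))
  qed
  ultimately show ?case by (rule reducible_cong)
qed

lemma reducible_all:
  assumes "deg_le k n x"
  shows "reducible k n x"
  using assms
proof (induction rule: deg_le_induct)
  case (single w a)
  show ?case
  proof (cases "length w + k = n")
    case True
    thus ?thesis using reducible_scale[OF reducible_word[of "[]" w k n], of a] by simp
  next
    case False
    hence "deg_le (Suc k) n (Poly_Mapping.single (Word w) a)"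
      using single by (intro deg_le_single) simp
    thus ?thesis
      by (intro reducible_cong[OF reducible_0]) (use False in \<open>simp_all add: Low_deg plain_linear\<close>)
  qed
qed (simp_all add: reducible_0 reducible_add)

text \<open>The map from \<open>p\<close> to these values is linear, injective by nondegeneracy and
  hence surjective by dimension. So points of \<open>V\<close> realise every substitution for the
  basis variables.\<close>

lemma exists_dual: "\<exists>p. \<forall>i<d. \<omega> (e i) p = z i"
proof -
  define f where "f p = (\<Sum>i<d. \<omega> (e i) p *s e i)" for p
  have lin: "Vector_Spaces.linear scale scale f"
    by unfold_locales (simp_all add: f_def form_linear scale_left_distrib sum.distrib scale_sum_right)
  have co: "coord j (\<Sum>i<d. a i *s e i) = a j" if "j < d" for a j
  proof -
    interpret l: Vector_Spaces.linear scale "(*)" "coord j"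
      by unfold_locales (use coord_linear[of j 1 _ 1] coord_linear[of j _ _ 0 0] in \<open>simp_all add: algebra_simps\<close>)
    have "coord j (\<Sum>i<d. a i *s e i) = (\<Sum>i<d. if i = j then a i else 0)"
      unfolding l.sum by (intro sum.cong refl) (use that in \<open>auto simp: l.scale coord_e\<close>)
    thus ?thesis using that by simp
  qed
  have "inj f"
  proof (rule injI)
    fix p q assume "f p = f q"
    hence *: "\<omega> (e i) p = \<omega> (e i) q" if "i < d" for i
      using co[OF that, of "\<lambda>i. \<omega> (e i) p"] co[OF that, of "\<lambda>i. \<omega> (e i) q"] by (simp add: f_def)
    have "\<omega> (p - q) v = 0" for v
    proof -
      have "\<omega> v (p - q) = (\<Sum>i<d. coord i v * \<omega> (e i) (p - q))"
        by (rule form_expand)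
      also have "\<dots> = 0" using * by (simp add: form_linear)
      finally show ?thesis using form_skew[of "p - q" v] by simp
    qed
    thus "p = q" using form_nondegenerate[of "p - q"] by simp
  qed
  hence "surj f" by (rule linear_inj_imp_surj[OF lin])
  then obtain p where "f p = (\<Sum>i<d. z i *s e i)" by (metis surjD)
  hence "\<omega> (e i) p = z i" if "i < d" for i
    using co[OF that, of "\<lambda>i. \<omega> (e i) p"] co[OF that, of z] by (simp add: f_def)
  thus ?thesis by blast
qed

text \<open>Modulo \<open>K\<close> a multiple of \<open>x\<close> equals its trace over the group,
  whose plain symbol is \<open>top\<close> of \<open>x\<close>. In the sorted form of the trace the
  coefficients \<open>b\<close> then define a polynomial with all values zero, so
  \<open>b = 0\<close> by \<open>monomials_independent\<close>.\<close>

lemma top_zero_imp_lower: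
  assumes x: "deg_le k n x" and top: "\<And>p. top k n p x = 0"
  shows "\<exists>y. deg_le (Suc k) n y \<and> x - y \<in> K"
proof -
  let ?x = "\<Sum>g\<in>carrier G. act g x"
  have "deg_le k n (act g x)" for g
    using x
    by (induction rule: deg_le_induct) (simp_all add: free_map_hom deg_le_single deg_le_add)
  hence "deg_le k n ?x" by (intro deg_le_sum)
  then obtain b where b: "\<forall>m\<in>Poly_Mapping.keys b. set_mset m \<subseteq> {..<d} \<and> size m + k = n"
    "?x - push canon b \<in> Low k n" "\<And>p. plain k n p ?x = plain k n p (push canon b)"
    using reducible_all unfolding reducible_def by blast
  have "lin_ext (\<lambda>m. prod_mset (image_mset z m)) b = 0" for z
  proof -
    obtain p where p: "\<And>i. i < d \<Longrightarrow> \<omega> (e i) p = z i" using exists_dual by blast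
    have "lin_ext (\<lambda>m. prod_mset (image_mset z m)) b = plain k n p (push canon b)"
      unfolding plain_def lin_ext_push
    proof (rule lin_ext_cong)
      fix m assume "m \<in> Poly_Mapping.keys b"
      hence m: "set_mset m \<subseteq> {..<d}" "size m + k = n" using b(1) by auto
      have "length (letters (canon m)) = size m"
        unfolding canon_def by (simp flip: size_mset)
      moreover have "word_val p (letters (canon m)) = prod_mset (image_mset (\<lambda>i. \<omega> (e i) p) m)"
        by (simp add: canon_def word_val_mset)
      moreover have "image_mset (\<lambda>i. \<omega> (e i) p) m = image_mset z m"
        by (intro image_mset_cong) (use m p in auto)
      ultimately show "prod_mset (image_mset z m) =
        (if length (letters (canon m)) + k = n then word_val p (letters (canon m)) else 0)"
        using m by simp
    qed
    also have "\<dots> = 0"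
      using top[of p] by (simp add: plain_linear(5) plain_act flip: b(3))
    finally show ?thesis .
  qed
  hence "b = 0" by (rule monomials_independent)
  hence "?x \<in> Low k n" using b(2) by simp
  moreover have "(\<Sum>g\<in>carrier G. x - act g x) \<in> Low k n"
    by (intro Low_sum Low_K K_act)
  ultimately have "(\<Sum>g\<in>carrier G. x - act g x) + ?x \<in> Low k n" by (intro Low_add)
  moreover have "(\<Sum>g\<in>carrier G. x - act g x) + ?x = free_scalar (of_nat N) * x"
    by (simp add: sum_subtractf free_scalar_def)
  ultimately have "free_scalar (1 / of_nat N) * (free_scalar (of_nat N) * x) \<in> Low k n"
    using Low_scale by simp
  moreover have "free_scalar (1 / of_nat N) * (free_scalar (of_nat N) * x) = x"
    using N_pos by (simp add: free_scalar_mult flip: mult.assoc)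
  ultimately show ?thesis by (simp add: Low_def)
qed

subsection \<open>The leading term of a commutator\<close>

text \<open>This is the contribution of the crossing of \<open>w ! i\<close> and
  \<open>u ! j\<close> while the letters of \<open>w\<close>, the last one first, move to the right
  through \<open>u\<close>. At that moment the later letters of \<open>w\<close> already stand
  behind \<open>u\<close>, so \<open>g\<close> acts on the rest of \<open>u\<close> followed by the
  rest of \<open>w\<close>.\<close>

definition corr :: "'v list \<Rightarrow> 'v list \<Rightarrow> 'v list \<Rightarrow> nat \<Rightarrow> nat \<Rightarrow> 'v free_alg"
  where "corr pre w u i j = (\<Sum>g\<in>carrier G. free_scalar (\<kappa> g (w ! i) (u ! j)) *
    W (pre @ take i w @ take j u @ map (\<rho> g) (drop (Suc j) u @ drop (Suc i) w)))"

lemma K_move_letter: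
  "W (pre @ x # u @ post) - W (pre @ u @ x # post)
    - (\<Sum>j<length u. corr pre (x # post) u 0 j) \<in> K"
proof (induction u arbitrary: pre)
  case (Cons y u)
  have c: "corr (pre @ [y]) (x # post) u 0 j = corr pre (x # post) (y # u) 0 (Suc j)" for j
    by (simp add: corr_def)
  have "W (pre @ [x,y] @ (u @ post)) - W (pre @ [y,x] @ (u @ post)) - corr pre (x # post) (y # u) 0 0 \<in> K"
    using K_relation[of pre x y "u @ post"] by (simp add: corr_def)
  from K_add[OF this Cons.IH[of "pre @ [y]"]] show ?case
    by (simp add: c sum.lessThan_Suc_shift algebra_simps del: sum.lessThan_Suc)
qed (simp add: K_0)

lemma K_commute_words:
  "W (pre @ w @ u) - W (pre @ u @ w) - (\<Sum>i<length w. \<Sum>j<length u. corr pre w u i j) \<in> K"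
proof (induction w arbitrary: pre)
  case (Cons x w)
  have c: "corr (pre @ [x]) w u i j = corr pre (x # w) u (Suc i) j" for i j
    by (simp add: corr_def)
  from K_add[OF Cons.IH[of "pre @ [x]"] K_move_letter[of pre x u w]] show ?case
    by (simp add: c sum.lessThan_Suc_shift algebra_simps del: sum.lessThan_Suc)
qed (simp add: K_0)

definition lead :: "'v list \<Rightarrow> 'v list \<Rightarrow> 'v free_alg"
  where "lead w u = (\<Sum>h\<in>carrier G. \<Sum>i<length w. \<Sum>j<length u. corr [] w (map (\<rho> h) u) i j)"

text \<open>Modulo \<open>K\<close> a word may be moved by a group element, which turns
  \<open>u\<close> followed by the translate of \<open>w\<close> under \<open>inv g\<close> into the
  translate of \<open>u\<close> under \<open>g\<close> followed by \<open>w\<close>. The two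
  products then contain the same blocks in opposite order.\<close>

lemma cm_lead: "cm (W w) (W u) - lead w u \<in> K"
proof -
  have "star (W u) (W w) = (\<Sum>g\<in>carrier G. W (u @ map (\<rho> (inv g)) w))"
    unfolding star_single using sum_inv[of "\<lambda>g. W (u @ map (\<rho> g) w)"] by simp
  moreover have "act g (W (u @ map (\<rho> (inv g)) w)) = W (map (\<rho> g) u @ w)" if "g \<in> carrier G" for g
    using that by (simp add: free_map_hom) (simp add: o_def map_idI)
  moreover have "(\<Sum>g\<in>carrier G. W (u @ map (\<rho> (inv g)) w) - act g (W (u @ map (\<rho> (inv g)) w))) \<in> K"
    by (intro K_sum K_act)
  ultimately have 1: "star (W u) (W w) - (\<Sum>g\<in>carrier G. W (map (\<rho> g) u @ w)) \<in> K"
    by (simp add: sum_subtractf)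
  have "(\<Sum>g\<in>carrier G. W ([] @ w @ map (\<rho> g) u) - W ([] @ map (\<rho> g) u @ w)
      - (\<Sum>i<length w. \<Sum>j<length (map (\<rho> g) u). corr [] w (map (\<rho> g) u) i j)) \<in> K"
    by (intro K_sum K_commute_words)
  hence 2: "star (W w) (W u) - (\<Sum>g\<in>carrier G. W (map (\<rho> g) u @ w)) - lead w u \<in> K"
    by (simp add: sum_subtractf lead_def star_single)
  from K_diff[OF 2 1] show ?thesis by (simp add: cm_def algebra_simps)
qed

lemma deg_lead: "deg_le 2 (length w + length u) (lead w u)"
  unfolding lead_def corr_def
  by (intro deg_le_sum deg_le_scale deg_le_single) auto

lemma kappa_sum:
  assumes "g \<in> carrier G"
  shows "\<kappa> g (\<Sum>i\<in>A. a i *s x i) y = (\<Sum>i\<in>A. a i * \<kappa> g (x i) y)"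
    "\<kappa> g y (\<Sum>i\<in>A. a i *s x i) = (\<Sum>i\<in>A. a i * \<kappa> g y (x i))"
proof -
  have 0: "\<kappa> g 0 y = 0" "\<kappa> g y 0 = 0"
    using kappa_linear(1)[OF assms, of 0 0 0 0 y] kappa_linear(2)[OF assms, of y 0 0 0 0] by simp_all
  have 1: "\<kappa> g (a *s x + z) y = a * \<kappa> g x y + \<kappa> g z y" for a x z
    using kappa_linear(1)[OF assms, of a x 1 z y] by simp
  have 2: "\<kappa> g y (a *s x + z) = a * \<kappa> g y x + \<kappa> g y z" for a x z
    using kappa_linear(2)[OF assms, of y a x 1 z] by simp
  show "\<kappa> g (\<Sum>i\<in>A. a i *s x i) y = (\<Sum>i\<in>A. a i * \<kappa> g (x i) y)"
    "\<kappa> g y (\<Sum>i\<in>A. a i *s x i) = (\<Sum>i\<in>A. a i * \<kappa> g y (x i))"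
    by (induction A rule: infinite_finite_induct) (simp_all add: 0 1 2)
qed

text \<open>The symbol averages over one more element \<open>f\<close>. Conjugating \<open>g\<close>
  by \<open>f\<close> and absorbing \<open>f\<close> into \<open>h\<close> decouples the actions on
  the two words. For fixed \<open>g\<close> the sums over positions and group elements are then
  collected by the bilinear \<open>\<kappa> g\<close> into \<open>slides\<close> of either
  word.\<close>

lemma top_lead: "top 2 (length w + length u) p (lead w u) = (\<Sum>g\<in>carrier G. \<kappa> g (slides p g w) (slides p g u))"
proof -
  let ?v = "word_val p"
  let ?m = "\<lambda>f w. map (\<rho> f) w"
  define T where "T i j f h g = \<kappa> g (\<rho> f (w ! i)) (\<rho> h (u ! j)) *
     ((?v (?m f (take i w)) * ?v (?m (g \<otimes> f) (drop (Suc i) w))) * (?v (?m h (take j u)) * ?v (?m (g \<otimes> h) (drop (Suc j) u))))"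
    for i j f h g
  have inner: "top 2 (length w + length u) p (corr [] w (?m h u) i j) =
      (\<Sum>f\<in>carrier G. \<Sum>g\<in>carrier G. T i j f (f \<otimes> h) g)"
    if h: "h \<in> carrier G" and ij: "i < length w" "j < length u" for h i j
  proof -
    have len: "Suc (Suc (length u + length w - 2)) = length w + length u"
      using ij by linarith
    have "top 2 (length w + length u) p (corr [] w (?m h u) i j) =
      (\<Sum>g\<in>carrier G. \<kappa> g (w ! i) (\<rho> h (u ! j)) *
        \<sigma> p (take i w @ take j (?m h u) @ ?m g (drop (Suc j) (?m h u) @ drop (Suc i) w)))"
      unfolding corr_def top_sum top_scale using ij len by (intro sum.cong refl) simp
    also have "\<dots> = (\<Sum>f\<in>carrier G. \<Sum>g\<in>carrier G. \<kappa> g (w ! i) (\<rho> h (u ! j)) *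
        ?v (?m f (take i w @ take j (?m h u) @ ?m g (drop (Suc j) (?m h u) @ drop (Suc i) w))))"
      unfolding \<sigma>_def sum_distrib_left by (rule sum.swap)
    also have "\<dots> = (\<Sum>f\<in>carrier G. \<Sum>g\<in>carrier G. T i j f (f \<otimes> h) (f \<otimes> g \<otimes> inv f))"
    proof (intro sum.cong refl)
      fix f g assume fg: "f \<in> carrier G" "g \<in> carrier G"
      have "\<kappa> g (w ! i) (\<rho> h (u ! j)) = \<kappa> (f \<otimes> g \<otimes> inv f) (\<rho> f (w ! i)) (\<rho> (f \<otimes> h) (u ! j))"
        using fg h by (simp add: rho_mult kappa_conj)
      moreover have "?m f (take i w @ take j (?m h u) @ ?m g (drop (Suc j) (?m h u) @ drop (Suc i) w)) =
        ?m f (take i w) @ ?m (f \<otimes> h) (take j u) @ ?m (f \<otimes> g \<otimes> inv f \<otimes> (f \<otimes> h)) (drop (Suc j) u)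
        @ ?m (f \<otimes> g \<otimes> inv f \<otimes> f) (drop (Suc i) w)"
        using fg h by (simp add: rho_mult take_map drop_map)
      ultimately show "\<kappa> g (w ! i) (\<rho> h (u ! j)) *
        ?v (?m f (take i w @ take j (?m h u) @ ?m g (drop (Suc j) (?m h u) @ drop (Suc i) w))) = T i j f (f \<otimes> h) (f \<otimes> g \<otimes> inv f)"
        by (simp only: T_def word_val_append mult_ac)
    qed
    also have "\<dots> = (\<Sum>f\<in>carrier G. \<Sum>g\<in>carrier G. T i j f (f \<otimes> h) g)"
      by (rule sum.cong[OF refl], rule sum_conj[where g = "\<lambda>g. T i j _ (_ \<otimes> h) g"])
    finally show ?thesis .
  qed
  have "top 2 (length w + length u) p (lead w u) =
    (\<Sum>h\<in>carrier G. \<Sum>i<length w. \<Sum>j<length u. \<Sum>f\<in>carrier G. \<Sum>g\<in>carrier G. T i j f (f \<otimes> h) g)"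
    unfolding lead_def top_sum by (intro sum.cong refl inner) auto
  also have "\<dots> = (\<Sum>i<length w. \<Sum>j<length u. \<Sum>f\<in>carrier G. \<Sum>g\<in>carrier G. \<Sum>h\<in>carrier G. T i j f (f \<otimes> h) g)"
    by (subst sum.swap, rule sum.cong[OF refl], subst sum.swap, rule sum.cong[OF refl],
        subst sum.swap, rule sum.cong[OF refl], rule sum.swap)
  also have "\<dots> = (\<Sum>i<length w. \<Sum>j<length u. \<Sum>f\<in>carrier G. \<Sum>g\<in>carrier G. \<Sum>h\<in>carrier G. T i j f h g)"
    by (rule sum.cong[OF refl], rule sum.cong[OF refl], rule sum.cong[OF refl], rule sum.cong[OF refl],
        rule sum_mult_left[where g = "\<lambda>h. T _ _ _ h _"])
  also have "\<dots> = (\<Sum>g\<in>carrier G. \<Sum>f\<in>carrier G. \<Sum>h\<in>carrier G. \<Sum>i<length w. \<Sum>j<length u. T i j f h g)"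
  proof -
    have "(\<Sum>i<length w. \<Sum>j<length u. \<Sum>f\<in>carrier G. \<Sum>g\<in>carrier G. \<Sum>h\<in>carrier G. T i j f h g) =
      (\<Sum>(i,j,f,g,h) \<in> {..<length w} \<times> {..<length u} \<times> carrier G \<times> carrier G \<times> carrier G. T i j f h g)"
      by (simp add: sum.cartesian_product)
    also have "\<dots> = (\<Sum>(g,f,h,i,j) \<in> carrier G \<times> carrier G \<times> carrier G \<times> {..<length w} \<times> {..<length u}. T i j f h g)"
      by (rule sum.reindex_bij_witness[of _ "\<lambda>(g,f,h,i,j). (i,j,f,g,h)" "\<lambda>(i,j,f,g,h). (g,f,h,i,j)"]) auto
    also have "\<dots> = (\<Sum>g\<in>carrier G. \<Sum>f\<in>carrier G. \<Sum>h\<in>carrier G. \<Sum>i<length w. \<Sum>j<length u. T i j f h g)"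
      by (simp add: sum.cartesian_product)
    finally show ?thesis .
  qed
  also have "\<dots> = (\<Sum>g\<in>carrier G. \<kappa> g (slides p g w) (slides p g u))"
  proof (rule sum.cong[OF refl])
    fix g assume g: "g \<in> carrier G"
    have s: "slides p g w = (\<Sum>f\<in>carrier G. 1 *s slide p g f w)" for w by (simp add: slides_def)
    have "\<kappa> g (slides p g w) (slides p g u) = (\<Sum>f\<in>carrier G. \<Sum>h\<in>carrier G. \<kappa> g (slide p g f w) (slide p g h u))"
      unfolding s kappa_sum(1)[OF g] kappa_sum(2)[OF g] mult_1 by (rule sum.swap)
    also have "\<dots> = (\<Sum>f\<in>carrier G. \<Sum>h\<in>carrier G. \<Sum>i<length w. \<Sum>j<length u. T i j f h g)"
      unfolding slide_def kappa_sum(1)[OF g] unfolding kappa_sum(2)[OF g] sum_distrib_left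
      by (intro sum.cong refl) (simp add: T_def mult_ac)
    finally show "(\<Sum>f\<in>carrier G. \<Sum>h\<in>carrier G. \<Sum>i<length w. \<Sum>j<length u. T i j f h g) =
      \<kappa> g (slides p g w) (slides p g u)" by simp
  qed
  finally show ?thesis .
qed

lemma top_lead_regular:
  assumes "regular p"
  shows "top 2 (length w + length u) p (lead w u) = t * \<omega> (slides p \<one> w) (slides p \<one> u)"
proof -
  have pr1: "pr \<one> x = 0" for x by (simp add: pr_def avg_fixed rho_one)
  have "\<kappa> g (slides p g w) (slides p g u) = 0" if g: "g \<in> carrier G - {\<one>}" for g
  proof (cases "g \<in> refls")
    case True
    have "refl_form g (slides p g w) (slides p g u) = 0"
      by (rule refl_form_eq_0[OF True, of p]) (use assms g slides_orthogonal in \<open>auto simp: regular_def\<close>)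
    thus ?thesis using g by (simp add: \<kappa>_def)
  qed (use g in \<open>simp add: \<kappa>_def\<close>)
  hence "(\<Sum>g\<in>carrier G. \<kappa> g (slides p g w) (slides p g u)) = \<kappa> \<one> (slides p \<one> w) (slides p \<one> u)"
    using fin by (subst sum.remove[of _ \<one>]) auto
  also have "\<dots> = t * \<omega> (slides p \<one> w) (slides p \<one> u)"
    by (simp add: \<kappa>_def refl_form_eq pr1 form_linear)
  finally show ?thesis by (simp add: top_lead)
qed

text \<open>The differential of the trace of a power of \<open>v\<close>. Varying \<open>r\<close>
  yields the power sums of the numbers \<open>\<omega> (\<rho> h v) p\<close>, which can be
  separated.\<close>

lemma slides_replicate:
  "slides p \<one> (replicate (Suc r) v) = (\<Sum>h\<in>carrier G. (of_nat (Suc r) * \<omega> (\<rho> h v) p ^ r) *s \<rho> h v)"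
proof -
  have wv: "word_val p (replicate n x) = \<omega> x p ^ n" for x n
    by (induction n) (simp_all add: word_val_def)
  have "slide p \<one> h (replicate (Suc r) v) = (of_nat (Suc r) * \<omega> (\<rho> h v) p ^ r) *s \<rho> h v" if "h \<in> carrier G" for h
  proof -
    have "slide p \<one> h (replicate (Suc r) v) = (\<Sum>i<Suc r. (\<omega> (\<rho> h v) p ^ i * \<omega> (\<rho> h v) p ^ (r - i)) *s \<rho> h v)"
      unfolding slide_def length_replicate
      by (intro sum.cong refl) (use that in \<open>simp add: wv nth_replicate take_replicate drop_replicate min_def del: replicate_Suc\<close>)
    also have "\<dots> = (\<Sum>i<Suc r. (\<omega> (\<rho> h v) p ^ r) *s \<rho> h v)"
      by (intro sum.cong refl) (simp flip: power_add)
    also have "\<dots> = (of_nat (Suc r) * \<omega> (\<rho> h v) p ^ r) *s \<rho> h v"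
      by (simp only: sum_constant_scale card_lessThan scale_scale)
    finally show ?thesis .
  qed
  thus ?thesis unfolding slides_def by (intro sum.cong refl)
qed

subsection \<open>Noncommutativity for nonzero t\<close>

text \<open>If \<open>t\<close> were nonzero, the differentials of all invariants at a regular point
  would be pairwise orthogonal. Those of traces of powers detect every generic vector, and generic
  vectors suffice to conclude \<omega> = 0.\<close>

lemma commutative_imp_t_eq_0:
  assumes comm: "\<And>x y. cm x y \<in> K" and nt: "\<exists>v::'v. v \<noteq> 0"
  shows "t = 0"
proof (rule ccontr)
  assume t: "t \<noteq> 0"
  obtain p where p: "regular p" using exists_regular by blast
  have lead: "\<omega> (slides p \<one> w) (slides p \<one> u) = 0" for w u
  proof -
    have "cm (W w) (W u) - (cm (W w) (W u) - lead w u) \<in> K" by (rule K_diff[OF comm cm_lead])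
    hence "lead w u \<in> K" by simp
    hence "top 2 (length w + length u) p (lead w u) = 0" by (rule top_K) (rule deg_lead)
    thus ?thesis using t by (simp add: top_lead_regular[OF p])
  qed
  \<comment> \<open>Genericity of \<open>v\<close> isolates the value belonging to the identity, so
    its summand is extracted from the power sums.\<close>
  have sep: "\<omega> v y = 0" if v: "\<Delta> p v \<noteq> 0" and y: "\<And>r. \<omega> (slides p \<one> (replicate (Suc r) v)) y = 0" for v y
  proof -
    have "\<omega> (\<rho> \<one> v) y = 0"
    proof (rule power_sums_eq_0[OF fin])
      fix r :: nat
      have "0 = \<omega> (slides p \<one> (replicate (Suc r) v)) y" by (simp only: y)
      also have "\<dots> = of_nat (Suc r) * (\<Sum>h\<in>carrier G. \<omega> (\<rho> h v) y * \<omega> (\<rho> h v) p ^ r)"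
        unfolding slides_replicate by (simp add: form_linear sum_distrib_left mult_ac del: of_nat_Suc)
      finally show "(\<Sum>h\<in>carrier G. \<omega> (\<rho> h v) y * \<omega> (\<rho> h v) p ^ r) = 0"
        by (simp del: of_nat_Suc)
    next
      fix h assume "h \<in> carrier G" "h \<noteq> \<one>"
      thus "\<omega> (\<rho> h v) p \<noteq> \<omega> (\<rho> \<one> v) p"
        using v unfolding Delta_nonzero_iff rho_one by (metis DiffI singletonD)
    qed simp
    thus ?thesis by (simp add: rho_one)
  qed
  have gen: "\<omega> v u = 0" if "\<Delta> p v \<noteq> 0" "\<Delta> p u \<noteq> 0" for v u
  proof -
    have "\<omega> (slides p \<one> w) u = 0" for w
      using sep[OF that(2), of "slides p \<one> w"] lead form_skew[of u "slides p \<one> w"] by simp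
    thus ?thesis by (rule sep[OF that(1)])
  qed
  obtain u where u: "\<Delta> p u \<noteq> 0" using exists_generic[OF p] by blast
  have "\<omega> v u' = 0" if u': "\<Delta> p u' \<noteq> 0" for v u'
  proof -
    obtain \<mu> where "\<Delta> p (v + \<mu> *s u) \<noteq> 0" using exists_generic_shift[OF u] by blast
    thus ?thesis using gen[OF _ u', of "v + \<mu> *s u"] gen[OF u u'] by (simp add: form_linear)
  qed
  note half = this
  have "\<omega> v y = 0" for v y
  proof -
    obtain \<mu> where "\<Delta> p (y + \<mu> *s u) \<noteq> 0" using exists_generic_shift[OF u] by blast
    thus ?thesis using half[of "y + \<mu> *s u" v] half[OF u, of v] by (simp add: form_linear)
  qed
  hence "v = 0" for v :: 'v by (rule form_nondegenerate)
  thus False using nt by blast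
qed

subsection \<open>Commutativity for t = 0\<close>

definition drops :: "nat \<Rightarrow> bool"
  where "drops k \<longleftrightarrow> (\<forall>u w. \<exists>z. deg_le k (length u + length w) z \<and> cm (W u) (W w) - z \<in> K)"

lemma drops_elements:
  assumes k: "drops k" and x: "deg_le j m x" and y: "deg_le 0 n y"
  shows "\<exists>z. deg_le (j + k) (m + n) z \<and> cm x y - z \<in> K"
  using x
proof (induction rule: deg_le_induct)
  case (single u a)
  show ?case using y
  proof (induction rule: deg_le_induct)
    case (single w b)
    obtain z where z: "deg_le k (length u + length w) z" "cm (W u) (W w) - z \<in> K"
      using k unfolding drops_def by blast
    have "deg_le (j + k) (m + n) z"
      using z(1) single \<open>length u + j \<le> m\<close> unfolding deg_le_def by fastforce
    hence "deg_le (j + k) (m + n) (free_scalar (a * b) * z)" by (rule deg_le_scale)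
    moreover have "cm (Poly_Mapping.single (Word u) a) (Poly_Mapping.single (Word w) b) = free_scalar (a * b) * cm (W u) (W w)"
      using cm_scale(1)[of a "W u" "free_scalar b * W w"] cm_scale(2)[of "W u" b "W w"]
      by (simp add: free_scalar_mult flip: mult.assoc)
    hence "cm (Poly_Mapping.single (Word u) a) (Poly_Mapping.single (Word w) b) - free_scalar (a * b) * z \<in> K"
      using K_scale[OF z(2), of "a * b"] by (simp add: right_diff_distrib)
    ultimately show ?case by blast
  next
    case (add y1 y2)
    then obtain z1 z2 where "deg_le (j + k) (m + n) z1" "cm (Poly_Mapping.single (Word u) a) y1 - z1 \<in> K"
      "deg_le (j + k) (m + n) z2" "cm (Poly_Mapping.single (Word u) a) y2 - z2 \<in> K" by blast
    thus ?case
      using K_add[of "cm (Poly_Mapping.single (Word u) a) y1 - z1" "cm (Poly_Mapping.single (Word u) a) y2 - z2"]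
      by (intro exI[of _ "z1 + z2"]) (simp add: deg_le_add cm_add algebra_simps)
  qed (auto simp: cm_zero K_0 intro!: exI[of _ 0])
next
  case (add x1 x2)
  then obtain z1 z2 where "deg_le (j + k) (m + n) z1" "cm x1 y - z1 \<in> K"
    "deg_le (j + k) (m + n) z2" "cm x2 y - z2 \<in> K" by blast
  thus ?case
    using K_add[of "cm x1 y - z1" "cm x2 y - z2"]
    by (intro exI[of _ "z1 + z2"]) (simp add: deg_le_add cm_add algebra_simps)
qed (auto simp: cm_zero K_0 intro!: exI[of _ 0])

text \<open>The choice of \<open>z\<close> is immaterial: two candidates differ by an element of
  \<open>K\<close> within the same degree bound, whose symbol is 0 by \<open>top_K\<close>.\<close>

definition symb :: "nat \<Rightarrow> 'v \<Rightarrow> nat \<Rightarrow> 'v free_alg \<Rightarrow> 'v free_alg \<Rightarrow> complex"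
  where "symb k p n x y = top k n p (SOME z. deg_le k n z \<and> cm x y - z \<in> K)"

lemma symb_eq:
  assumes z: "deg_le k n z" "cm x y - z \<in> K"
  shows "symb k p n x y = top k n p z"
proof -
  define z' where "z' = (SOME z. deg_le k n z \<and> cm x y - z \<in> K)"
  have z': "deg_le k n z' \<and> cm x y - z' \<in> K"
    unfolding z'_def by (rule someI[of _ z]) (use z in simp)
  have "z' - z \<in> K" using K_diff[OF z(2), of "cm x y - z'"] z' by simp
  moreover have "deg_le k n (z' - z)" using z z' by (simp add: deg_le_diff)
  ultimately have "top k n p (z' - z) = 0" by (rule top_K)
  thus ?thesis by (simp add: symb_def top_diff flip: z'_def)
qed

lemma symb_K: "x \<in> K \<Longrightarrow> symb k p n x y = 0"
  using symb_eq[of k n 0 x y p] by (simp add: K_cm)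

context
  fixes k assumes k: "drops k"
begin

lemma symb_witness:
  assumes "deg_le 0 m x" "deg_le 0 n y"
  obtains z where "deg_le k (m + n) z" "cm x y - z \<in> K" "\<And>p. symb k p (m + n) x y = top k (m + n) p z"
  using drops_elements[OF k assms] symb_eq that by auto

lemma symb_add:
  assumes "deg_le 0 m x" "deg_le 0 m x'" "deg_le 0 n y"
  shows "symb k p (m + n) (x + x') y = symb k p (m + n) x y + symb k p (m + n) x' y"
proof -
  obtain z where z: "deg_le k (m + n) z" "cm x y - z \<in> K" "symb k p (m + n) x y = top k (m + n) p z"
    using symb_witness[OF assms(1,3)] by metis
  obtain z' where z': "deg_le k (m + n) z'" "cm x' y - z' \<in> K" "symb k p (m + n) x' y = top k (m + n) p z'"
    using symb_witness[OF assms(2,3)] by metis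
  have "cm (x + x') y - (z + z') \<in> K"
    using K_add[OF z(2) z'(2)] by (simp add: cm_add algebra_simps)
  thus ?thesis using symb_eq[OF deg_le_add[OF z(1) z'(1)]] by (simp add: z z' top_add)
qed

lemma symb_scale:
  assumes "deg_le 0 m x" "deg_le 0 n y"
  shows "symb k p (m + n) (free_scalar a * x) y = a * symb k p (m + n) x y"
proof -
  obtain z where z: "deg_le k (m + n) z" "cm x y - z \<in> K" "symb k p (m + n) x y = top k (m + n) p z"
    using symb_witness[OF assms] by metis
  have "cm (free_scalar a * x) y - free_scalar a * z \<in> K"
    using K_scale[OF z(2), of a] by (simp add: cm_scale right_diff_distrib)
  thus ?thesis using symb_eq[OF deg_le_scale[OF z(1)]] by (simp add: z top_scale)
qed

lemma symb_sum:
  assumes "\<And>i. i \<in> A \<Longrightarrow> deg_le 0 m (f i)" "deg_le 0 n y"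
  shows "symb k p (m + n) (\<Sum>i\<in>A. f i) y = (\<Sum>i\<in>A. symb k p (m + n) (f i) y)"
  using assms(1)
proof (induction A rule: infinite_finite_induct)
  case (insert i A)
  thus ?case by (simp add: symb_add[OF _ _ assms(2)] deg_le_sum)
qed (simp_all add: symb_K K_0)

lemma symb_skew:
  assumes "deg_le 0 m x" "deg_le 0 n y"
  shows "symb k p (m + n) x y = - symb k p (m + n) y x"
proof -
  obtain z where z: "deg_le k (m + n) z" "cm x y - z \<in> K" "symb k p (m + n) x y = top k (m + n) p z"
    using symb_witness[OF assms] by metis
  have "cm y x - (- z) \<in> K"
    using K_uminus[OF z(2)] cm_skew[of y x] by simp
  thus ?thesis using symb_eq[OF deg_le_uminus[OF z(1)]] by (simp add: z top_uminus)
qed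

text \<open>A change of \<open>x\<close> by lower terms alters the commutator by lower terms. So the
  symbol depends only on the class of \<open>x\<close> in the associated graded algebra, where the
  order of letters is forgotten and multisets can replace words.\<close>

lemma symb_cong:
  assumes "deg_le 0 m x" "deg_le 0 m x'" "deg_le 0 n y" and L: "x - x' \<in> Low 0 m"
  shows "symb k p (m + n) x y = symb k p (m + n) x' y"
proof -
  obtain l where l: "deg_le 1 m l" "x - x' - l \<in> K" using L by (auto simp: Low_def)
  obtain z where z: "deg_le k (m + n) z" "cm x' y - z \<in> K" "symb k p (m + n) x' y = top k (m + n) p z"
    using symb_witness[OF assms(2,3)] by metis
  obtain r where r: "deg_le (Suc k) (m + n) r" "cm l y - r \<in> K"
    using drops_elements[OF k l(1) assms(3)] by auto
  have r': "deg_le k (m + n) r" using r(1) by (auto simp: deg_le_def)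
  have "cm (x - x' - l) y + (cm x' y - z) + (cm l y - r) \<in> K"
    by (intro K_add K_cm l z r)
  moreover have "cm (x - x' - l) y + (cm x' y - z) + (cm l y - r) = cm x y - (z + r)"
    by (simp only: cm_diff) simp
  ultimately have "cm x y - (z + r) \<in> K" by simp
  thus ?thesis
    using symb_eq[OF deg_le_add[OF z(1) r']] by (simp add: z top_add top_lower[OF r(1)])
qed

definition \<beta> :: "'v \<Rightarrow> 'v multiset \<Rightarrow> 'v multiset \<Rightarrow> complex"
  where "\<beta> p M M' = symb k p (size M + size M') (W (SOME l. mset l = M)) (W (SOME l. mset l = M'))"

lemma deg_le_W: "deg_le 0 (length w) (W w)"
  by (simp add: deg_le_single)

lemma symb_mset:
  assumes "mset u = mset u'" "deg_le 0 n y"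
  shows "symb k p (length u + n) (W u) y = symb k p (length u + n) (W u') y"
proof (rule symb_cong)
  have "length u' = length u" using mset_eq_length[OF assms(1)] by simp
  thus "deg_le 0 (length u) (W u')" using deg_le_W[of u'] by simp
  show "W u - W u' \<in> Low 0 (length u)"
    using Low_permute[OF assms(1), of "[]" 0 "length u"] by simp
qed (use assms deg_le_W in auto)

lemma beta_mset: "\<beta> p (mset u) (mset w) = symb k p (length u + length w) (W u) (W w)"
proof -
  define u' w' where "u' = (SOME l. mset l = mset u)" and "w' = (SOME l. mset l = mset w)"
  have uw: "mset u' = mset u" "mset w' = mset w"
    unfolding u'_def w'_def by (rule someI_ex, blast)+
  hence l: "length u' = length u" "length w' = length w" using mset_eq_length by metis+
  have "\<beta> p (mset u) (mset w) = symb k p (length u + length w) (W u') (W w')"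
    by (simp add: \<beta>_def u'_def w'_def)
  also have "\<dots> = symb k p (length u + length w) (W u) (W w')"
    using symb_mset[OF uw(1) deg_le_W[of w']] by (simp add: l)
  also have "\<dots> = - symb k p (length w + length u) (W w') (W u)"
    using symb_skew[OF deg_le_W[of u] deg_le_W[of w']] by (simp add: l add.commute)
  also have "\<dots> = - symb k p (length w + length u) (W w) (W u)"
    using symb_mset[OF uw(2) deg_le_W[of u]] by (simp add: l)
  also have "\<dots> = symb k p (length u + length w) (W u) (W w)"
    using symb_skew[OF deg_le_W[of u] deg_le_W[of w]] by (simp add: add.commute)
  finally show ?thesis .
qed

lemma beta_biderivation:
  assumes k3: "k \<ge> 3"
  shows "graded_biderivation scale Basis G \<omega> \<rho> k \<beta>"
proof unfold_locales
  show "3 \<le> k" by (rule k3)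
next
  fix p a x b y M M'
  obtain u w :: "'v list" where uw: "M = mset u" "M' = mset w" using ex_mset by metis
  let ?d = "Suc (length u) + length w"
  have d: "deg_le 0 (Suc (length u)) (W (v # u))" for v by (simp add: deg_le_single)
  have "symb k p ?d (W ((a *s x + b *s y) # u)) (W w) =
    symb k p ?d (free_scalar a * W (x # u) + free_scalar b * W (y # u)) (W w)"
    using K_linear[of "[]" a x b y u]
    by (intro symb_cong deg_le_add deg_le_scale d deg_le_W Low_K) simp
  also have "\<dots> = a * symb k p ?d (W (x # u)) (W w) + b * symb k p ?d (W (y # u)) (W w)"
    by (simp only: symb_add symb_scale deg_le_scale d deg_le_W)
  finally show "\<beta> p (add_mset (a *s x + b *s y) M) M' = a * \<beta> p (add_mset x M) M' + b * \<beta> p (add_mset y M) M'"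
    using beta_mset[of p "_ # u" w] by (simp add: uw)
next
  fix g p M M' assume g: "g \<in> carrier G"
  obtain u w :: "'v list" where uw: "M = mset u" "M' = mset w" using ex_mset by metis
  have "symb k p (length u + length w) (W u) (W w) = symb k p (length u + length w) (W (map (\<rho> g) u)) (W w)"
    using K_act[OF g, of "W u"] deg_le_W[of "map (\<rho> g) u"]
    by (intro symb_cong deg_le_W Low_K) (simp_all add: free_map_hom)
  thus "\<beta> p (image_mset (\<rho> g) M) M' = \<beta> p M M'"
    using beta_mset[of p "map (\<rho> g) u" w] by (simp add: uw beta_mset)
next
  fix p M1 M2 M'
  obtain u1 u2 w :: "'v list" where uw: "M1 = mset u1" "M2 = mset u2" "M' = mset w" using ex_mset by metis
  let ?d = "(length u1 + length u2) + length w"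
  have S: "top 0 (length u) p (W u) = (\<Sum>h\<in>carrier G. monom_val p (image_mset (\<rho> h) (mset u)))" for u
    by (simp add: \<sigma>_def word_val_def monom_val_def image_mset.compositionality o_def flip: prod_mset_prod_list)
  obtain z1 where z1: "deg_le k (length u1 + length w) z1" "cm (W u1) (W w) - z1 \<in> K"
    "symb k p (length u1 + length w) (W u1) (W w) = top k (length u1 + length w) p z1"
    using symb_witness[OF deg_le_W[of u1] deg_le_W[of w]] by metis
  obtain z2 where z2: "deg_le k (length u2 + length w) z2" "cm (W u2) (W w) - z2 \<in> K"
    "symb k p (length u2 + length w) (W u2) (W w) = top k (length u2 + length w) p z2"
    using symb_witness[OF deg_le_W[of u2] deg_le_W[of w]] by metis
  have dstar: "deg_le k (m + n) (star x y) \<and> deg_le k (m + n) (star y x)" if x: "deg_le 0 m x" and y: "deg_le k n y" for m n x y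
    using x
  proof (induction rule: deg_le_induct)
    case (single u a)
    show ?case using y
    proof (induction rule: deg_le_induct)
      case (single w b)
      thus ?case using \<open>length u + 0 \<le> m\<close>
        by (auto simp: star_single intro!: deg_le_sum deg_le_single)
    qed (simp_all add: star_zero star_add deg_le_add)
  qed (simp_all add: star_zero star_add deg_le_add)
  \<comment> \<open>The Leibniz rule \<open>cm_star\<close> for commutators suggests this
    representative for the product, and \<open>top_star\<close> computes its symbol.\<close>
  let ?z = "star (W u1) z2 + star z1 (W u2)"
  have "cm (star (W u1) (W u2)) (W w) - ?z =
    star (W u1) (cm (W u2) (W w) - z2) + star (cm (W u1) (W w) - z1) (W u2)"
    by (simp add: cm_star star_diff)
  hence "cm (star (W u1) (W u2)) (W w) - ?z \<in> K"
    by (simp add: K_add K_star z1 z2)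
  moreover have "deg_le k ?d ?z"
    using dstar[OF deg_le_W[of u1] z2(1)] dstar[OF deg_le_W[of u2] z1(1)]
    by (simp add: deg_le_add add_ac)
  ultimately have "symb k p ?d (star (W u1) (W u2)) (W w) = top k ?d p ?z"
    by (intro symb_eq)
  also have "\<dots> = top 0 (length u1) p (W u1) * symb k p (length u2 + length w) (W u2) (W w) +
    top 0 (length u2) p (W u2) * symb k p (length u1 + length w) (W u1) (W w)"
    using top_star(1)[OF deg_le_W[of u1] z2(1), of p] top_star(2)[OF deg_le_W[of u2] z1(1), of p]
    by (simp add: top_add z1 z2 add_ac del: top_single)
  finally have main: "symb k p ?d (star (W u1) (W u2)) (W w) = \<dots>" .
  have "symb k p ?d (star (W u1) (W u2)) (W w) = (\<Sum>g\<in>carrier G. symb k p ?d (W (u1 @ map (\<rho> g) u2)) (W w))"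
    unfolding star_single mult_1 by (intro symb_sum deg_le_W deg_le_single) simp
  also have "\<dots> = (\<Sum>g\<in>carrier G. \<beta> p (M1 + image_mset (\<rho> g) M2) M')"
  proof (intro sum.cong refl)
    fix g
    show "symb k p ?d (W (u1 @ map (\<rho> g) u2)) (W w) = \<beta> p (M1 + image_mset (\<rho> g) M2) M'"
      using beta_mset[of p "u1 @ map (\<rho> g) u2" w] by (simp add: uw)
  qed
  finally show "(\<Sum>g\<in>carrier G. \<beta> p (M1 + image_mset (\<rho> g) M2) M') =
      (\<Sum>h\<in>carrier G. monom_val p (image_mset (\<rho> h) M1)) * \<beta> p M2 M' +
      (\<Sum>h\<in>carrier G. monom_val p (image_mset (\<rho> h) M2)) * \<beta> p M1 M'"
    using main unfolding S by (simp add: uw beta_mset)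
next
  fix p M M'
  obtain u w :: "'v list" where uw: "M = mset u" "M' = mset w" using ex_mset by metis
  show "\<beta> p M M' = - \<beta> p M' M"
    using symb_skew[OF deg_le_W[of u] deg_le_W[of w]] by (simp add: uw beta_mset add.commute)
next
  fix p q M M'
  obtain u w :: "'v list" where uw: "M = mset u" "M' = mset w" using ex_mset by metis
  obtain z where z: "deg_le k (length u + length w) z"
    "\<And>p. symb k p (length u + length w) (W u) (W w) = top k (length u + length w) p z"
    using symb_witness[OF deg_le_W[of u] deg_le_W[of w]] by metis
  show "\<exists>P. (P = 0 \<or> Polynomial.degree P + k \<le> size M + size M') \<and> (\<forall>\<tau>. \<beta> (p + \<tau> *s q) M M' = poly P \<tau>)"
    using top_poly[OF z(1), of p q] by (simp add: uw beta_mset z(2))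
qed

lemma drops_Suc:
  assumes k3: "k \<ge> 3"
  shows "drops (Suc k)"
  unfolding drops_def
proof (intro allI)
  fix u w
  interpret graded_biderivation scale Basis G \<omega> \<rho> k \<beta> by (rule beta_biderivation[OF k3])
  obtain z where z: "deg_le k (length u + length w) z" "cm (W u) (W w) - z \<in> K"
    "\<And>p. symb k p (length u + length w) (W u) (W w) = top k (length u + length w) p z"
    using symb_witness[OF deg_le_W[of u] deg_le_W[of w]] by metis
  have "top k (length u + length w) p z = 0" for p
  proof (rule vanish_of_regular)
    show "top k (length u + length w) p z = 0" if "regular p" for p
      using biderivation_eq_0[OF that, of "mset u" "mset w"] by (simp add: beta_mset z(3))
    show "\<exists>P. \<forall>\<tau>. top k (length u + length w) (p + \<tau> *s q) z = poly P \<tau>" for p q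
      using top_poly[OF z(1)] by blast
  qed
  then obtain y where y: "deg_le (Suc k) (length u + length w) y" "z - y \<in> K"
    using top_zero_imp_lower[OF z(1)] by blast
  have "cm (W u) (W w) - y \<in> K" using K_add[OF z(2) y(2)] by simp
  thus "\<exists>z. deg_le (Suc k) (length u + length w) z \<and> cm (W u) (W w) - z \<in> K" using y(1) by blast
qed

end

lemma t_eq_0_imp_commutative:
  assumes t: "t = 0"
  shows "cm x y \<in> K"
proof -
  \<comment> \<open>The loss of two letters holds for every \<open>t\<close>. With
    \<open>t = 0\<close> the symbol of \<open>lead\<close> vanishes at regular points, hence
    everywhere, which gains one more degree.\<close>
  have "drops 3"
    unfolding drops_def
  proof (intro allI)
    fix u w
    have "top 2 (length u + length w) p (lead u w) = 0" for p
    proof (rule vanish_of_regular)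
      show "top 2 (length u + length w) p (lead u w) = 0" if "regular p" for p
        by (subst top_lead_regular[OF that]) (use t in simp)
      show "\<exists>P. \<forall>\<tau>. top 2 (length u + length w) (p + \<tau> *s q) (lead u w) = poly P \<tau>" for p q
        using top_poly[OF deg_lead] by blast
    qed
    then obtain y where "deg_le (Suc 2) (length u + length w) y" "lead u w - y \<in> K"
      using top_zero_imp_lower[OF deg_lead] by blast
    thus "\<exists>z. deg_le 3 (length u + length w) z \<and> cm (W u) (W w) - z \<in> K"
      using K_add[OF cm_lead[of u w], of "lead u w - y"] by (intro exI[of _ y]) simp
  qed
  hence dr: "drops (3 + n)" for n
  proof (induction n)
    case (Suc n)
    thus ?case using drops_Suc[of "3 + n"] by simp
  qed simp
  have W: "cm (W u) (W w) \<in> K" for u w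
  proof -
    \<comment> \<open>A loss larger than the total length leaves nothing, so the commutator itself
      is in \<open>K\<close>.\<close>
    obtain z where z: "deg_le (3 + (length u + length w)) (length u + length w) z" "cm (W u) (W w) - z \<in> K"
      using dr unfolding drops_def by blast
    have "Poly_Mapping.keys z = {}" using z(1) by (auto simp: deg_le_def)
    hence "z = 0" by simp
    thus ?thesis using z(2) by simp
  qed
  show ?thesis
  proof (induction x rule: poly_mapping_additive_induct)
    case (single u a)
    show ?case
    proof (induction y rule: poly_mapping_additive_induct)
      case (single w b)
      have "cm (free_scalar a * W (letters u)) (free_scalar b * W (letters w)) \<in> K"
        unfolding cm_scale by (intro K_scale W)
      thus ?case by (cases u; cases w) simp
    qed (simp_all add: cm_zero cm_add K_0 K_add)
  qed (simp_all add: cm_zero cm_add K_0 K_add)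
qed

theorem commutative_iff:
  assumes "\<exists>v::'v. v \<noteq> 0"
  shows "(\<forall>x y. cm x y \<in> K) \<longleftrightarrow> t = 0"
  using commutative_imp_t_eq_0 t_eq_0_imp_commutative assms by blast

end

section \<open>The symplectic reflection algebra\<close>

lemma free_scalar_diff: "free_scalar (a - b) = free_scalar a - free_scalar b"
  by (simp add: free_scalar_def single_diff)

lemma free_map_1: "free_map f 1 = 1"
  using free_map_hom(7)[of f 1] by simp

lemma free_algebra_simps [simp]:
  "carrier free_algebra = UNIV" "x \<otimes>\<^bsub>free_algebra\<^esub> y = x * y" "x \<oplus>\<^bsub>free_algebra\<^esub> y = x + y"
  "\<zero>\<^bsub>free_algebra\<^esub> = 0" "\<one>\<^bsub>free_algebra\<^esub> = 1"
  by (simp_all add: free_algebra_def ring_of_type_algebra_def)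

lemma ring_free_algebra: "ring (free_algebra :: 'v free_alg ring)"
proof (rule ringI)
  show "abelian_group (free_algebra :: 'v free_alg ring)"
  proof (rule abelian_groupI)
    fix x :: "'v free_alg"
    show "\<exists>y\<in>carrier free_algebra. y \<oplus>\<^bsub>free_algebra\<^esub> x = \<zero>\<^bsub>free_algebra\<^esub>"
      by (intro bexI[of _ "- x"]) simp_all
  qed (simp_all add: algebra_simps)
  show "Group.monoid (free_algebra :: 'v free_alg ring)"
    by (rule monoidI) (simp_all add: mult.assoc)
qed (simp_all add: algebra_simps)

lemma ideal_closed:
  assumes "ideal I R"
  shows "\<zero>\<^bsub>R\<^esub> \<in> I" "x \<in> I \<Longrightarrow> y \<in> I \<Longrightarrow> x \<oplus>\<^bsub>R\<^esub> y \<in> I"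
    "x \<in> I \<Longrightarrow> a \<in> carrier R \<Longrightarrow> a \<otimes>\<^bsub>R\<^esub> x \<in> I" "x \<in> I \<Longrightarrow> a \<in> carrier R \<Longrightarrow> x \<otimes>\<^bsub>R\<^esub> a \<in> I"
proof -
  interpret ideal I R by fact
  show "\<zero>\<^bsub>R\<^esub> \<in> I" "x \<in> I \<Longrightarrow> y \<in> I \<Longrightarrow> x \<oplus>\<^bsub>R\<^esub> y \<in> I"
    "x \<in> I \<Longrightarrow> a \<in> carrier R \<Longrightarrow> a \<otimes>\<^bsub>R\<^esub> x \<in> I" "x \<in> I \<Longrightarrow> a \<in> carrier R \<Longrightarrow> x \<otimes>\<^bsub>R\<^esub> a \<in> I"
    by (simp_all add: I_l_closed I_r_closed)
qed

lemma idealI_closed: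
  fixes R (structure)
  assumes "ring R" "I \<subseteq> carrier R" "I \<noteq> {}" "\<And>x y. x \<in> I \<Longrightarrow> y \<in> I \<Longrightarrow> x \<oplus> y \<in> I" "\<And>x. x \<in> I \<Longrightarrow> \<ominus> x \<in> I"
    "\<And>x a. x \<in> I \<Longrightarrow> a \<in> carrier R \<Longrightarrow> a \<otimes> x \<in> I" "\<And>x a. x \<in> I \<Longrightarrow> a \<in> carrier R \<Longrightarrow> x \<otimes> a \<in> I"
  shows "ideal I R"
proof (rule idealI)
  interpret ring R by fact
  show "subgroup I (add_monoid R)"
    by (rule add.subgroupI) (use assms in auto)
qed (use assms in auto)

lemma quotient_simps:
  fixes R (structure)
  assumes "ideal I R"
  shows "carrier (R Quot I) = (\<lambda>x. I +> x) ` carrier R" "\<zero>\<^bsub>R Quot I\<^esub> = I +> \<zero>" "\<one>\<^bsub>R Quot I\<^esub> = I +> \<one>"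
    "x \<in> carrier R \<Longrightarrow> y \<in> carrier R \<Longrightarrow> (I +> x) \<otimes>\<^bsub>R Quot I\<^esub> (I +> y) = I +> (x \<otimes> y)"
    "x \<in> carrier R \<Longrightarrow> y \<in> carrier R \<Longrightarrow> (I +> x) \<oplus>\<^bsub>R Quot I\<^esub> (I +> y) = I +> (x \<oplus> y)"
proof -
  interpret ideal I R by fact
  show "carrier (R Quot I) = (\<lambda>x. I +> x) ` carrier R" by (auto simp: FactRing_def A_RCOSETS_def')
  show "\<zero>\<^bsub>R Quot I\<^esub> = I +> \<zero>" using a_coset_add_zero[OF a_subset] by (simp add: FactRing_def)
  show "\<one>\<^bsub>R Quot I\<^esub> = I +> \<one>" by (simp add: FactRing_def)
  show "x \<in> carrier R \<Longrightarrow> y \<in> carrier R \<Longrightarrow> (I +> x) \<otimes>\<^bsub>R Quot I\<^esub> (I +> y) = I +> (x \<otimes> y)"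
    by (simp add: FactRing_def rcoset_mult_add)
  show "x \<in> carrier R \<Longrightarrow> y \<in> carrier R \<Longrightarrow> (I +> x) \<oplus>\<^bsub>R Quot I\<^esub> (I +> y) = I +> (x \<oplus> y)"
    by (simp add: FactRing_def a_rcos_sum)
qed

lemma free_algebra_a_inv [simp]: "\<ominus>\<^bsub>free_algebra\<^esub> x = - x"
proof -
  interpret ring "free_algebra :: 'v free_alg ring" by (rule ring_free_algebra)
  show ?thesis by (rule minus_equality) simp_all
qed

lemma free_algebra_minus [simp]: "x \<ominus>\<^bsub>free_algebra\<^esub> y = x - y"
  by (simp add: a_minus_def)

lemma ideal_free_algebraI:
  fixes I :: "'v free_alg set"
  assumes "0 \<in> I" "\<And>x y. x \<in> I \<Longrightarrow> y \<in> I \<Longrightarrow> x + y \<in> I" "\<And>x a. x \<in> I \<Longrightarrow> a * x \<in> I" "\<And>x a. x \<in> I \<Longrightarrow> x * a \<in> I"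
  shows "ideal I free_algebra"
proof (rule idealI_closed[OF ring_free_algebra])
  show "\<ominus>\<^bsub>free_algebra\<^esub> x \<in> I" if "x \<in> I" for x using assms(3)[OF that, of "-1"] by simp
qed (use assms in auto)

lemma finsum_eqI:
  assumes "abelian_monoid R" "\<And>i. h i \<in> carrier R" "F {} = \<zero>\<^bsub>R\<^esub>" "\<And>S. infinite S \<Longrightarrow> F S = \<zero>\<^bsub>R\<^esub>"
    "\<And>i S. finite S \<Longrightarrow> i \<notin> S \<Longrightarrow> F (insert i S) = h i \<oplus>\<^bsub>R\<^esub> F S"
  shows "(\<Oplus>\<^bsub>R\<^esub>i\<in>S. h i) = F S"
proof -
  interpret abelian_monoid R by fact
  show ?thesis
    by (induction S rule: infinite_finite_induct) (simp_all add: assms finsum_infinite)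
qed

context symplectic_action
begin

section \<open>Representatives for the tensor algebra\<close>

abbreviation "TI \<equiv> tensor_ideal scale"
abbreviation "TT \<equiv> tensor_algebra scale"
abbreviation "AA \<equiv> smash_tensor_algebra scale G \<rho>"

definition qt :: "'v free_alg \<Rightarrow> 'v free_alg set" where "qt x = TI +>\<^bsub>free_algebra\<^esub> x"

lemma TI_ideal: "ideal TI free_algebra"
  unfolding tensor_ideal_def by (rule ring.genideal_ideal[OF ring_free_algebra]) simp

lemma TI_generators: "linearity_relations scale \<subseteq> TI"
  unfolding tensor_ideal_def by (rule ring.genideal_self[OF ring_free_algebra]) simp

lemma TI_minimal: "ideal I free_algebra \<Longrightarrow> linearity_relations scale \<subseteq> I \<Longrightarrow> TI \<subseteq> I"
  unfolding tensor_ideal_def by (rule ring.genideal_minimal[OF ring_free_algebra])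

lemma TI_closed:
  "0 \<in> TI" "x \<in> TI \<Longrightarrow> y \<in> TI \<Longrightarrow> x + y \<in> TI" "x \<in> TI \<Longrightarrow> a * x \<in> TI" "x \<in> TI \<Longrightarrow> x * a \<in> TI"
  using ideal_closed[OF TI_ideal] by auto

lemma TI_sum: "(\<And>i. i \<in> A \<Longrightarrow> f i \<in> TI) \<Longrightarrow> (\<Sum>i\<in>A. f i) \<in> TI"
  by (induction A rule: infinite_finite_induct) (simp_all add: TI_closed)

lemma TI_act:
  assumes g: "g \<in> carrier G" and x: "x \<in> TI"
  shows "act g x \<in> TI"
proof -
  have "ideal {x. act g x \<in> TI} free_algebra"
    by (rule ideal_free_algebraI) (simp_all add: free_map_hom TI_closed)
  moreover have "linearity_relations scale \<subseteq> {x. act g x \<in> TI}"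
  proof
    fix r assume "r \<in> linearity_relations scale"
    hence "act g r \<in> linearity_relations scale"
      using g by (fastforce simp: linearity_relations_def free_map_hom free_vec_def rho_lin)
    thus "r \<in> {x. act g x \<in> TI}" using TI_generators by auto
  qed
  ultimately have "TI \<subseteq> {x. act g x \<in> TI}" by (rule TI_minimal)
  thus ?thesis using x by blast
qed

lemma qt_eq_iff: "qt x = qt y \<longleftrightarrow> x - y \<in> TI"
  unfolding qt_def using ring.quotient_eq_iff_same_a_r_cos[OF ring_free_algebra TI_ideal, of x y] by simp

lemma ring_TT: "ring TT"
  unfolding tensor_algebra_def by (rule ideal.quotient_is_ring[OF TI_ideal])

lemma TT_simps:
  "carrier TT = range qt" "qt x \<otimes>\<^bsub>TT\<^esub> qt y = qt (x * y)" "qt x \<oplus>\<^bsub>TT\<^esub> qt y = qt (x + y)"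
  "\<zero>\<^bsub>TT\<^esub> = qt 0" "\<one>\<^bsub>TT\<^esub> = qt 1"
  using quotient_simps[OF TI_ideal] by (simp_all add: tensor_algebra_def qt_def[abs_def])

lemma abelian_monoid_TT: "abelian_monoid TT"
  using ring_TT by (simp add: ring_def abelian_group_def)

lemma finsum_TT: "(\<Oplus>\<^bsub>TT\<^esub>i\<in>S. qt (h i)) = qt (\<Sum>i\<in>S. h i)"
  by (rule finsum_eqI[OF abelian_monoid_TT]) (simp_all add: TT_simps)

lemma mem_qt: "y \<in> qt x \<longleftrightarrow> y - x \<in> TI"
proof
  assume "y \<in> qt x"
  then obtain i where "i \<in> TI" "y = i + x" by (auto simp: qt_def a_r_coset_def')
  thus "y - x \<in> TI" by simp
next
  assume "y - x \<in> TI"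
  thus "y \<in> qt x" unfolding qt_def a_r_coset_def' by (auto intro!: bexI[of _ "y - x"])
qed

lemma tensor_map_qt:
  assumes g: "g \<in> carrier G"
  shows "tensor_map (\<rho> g) (qt x) = qt (act g x)"
proof
  show "tensor_map (\<rho> g) (qt x) \<subseteq> qt (act g x)"
    using TI_act[OF g] by (auto simp: tensor_map_def mem_qt simp flip: free_map_hom)
  show "qt (act g x) \<subseteq> tensor_map (\<rho> g) (qt x)"
  proof
    fix y assume "y \<in> qt (act g x)"
    hence "act (inv g) (y - act g x) \<in> TI" using g by (intro TI_act) (simp_all add: mem_qt)
    hence "act (inv g) y \<in> qt x"
      using g by (simp add: mem_qt free_map_hom act_mult act_one)
    moreover have "act g (act (inv g) y) = y" using g by (simp add: act_mult act_one)
    ultimately show "y \<in> tensor_map (\<rho> g) (qt x)" unfolding tensor_map_def by (metis image_eqI)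
  qed
qed

section \<open>The smash product on representatives\<close>

definition \<Phi> :: "('g \<Rightarrow> 'v free_alg) \<Rightarrow> 'g \<Rightarrow> 'v free_alg set"
  where "\<Phi> f = (\<lambda>k\<in>carrier G. qt (f k))"

text \<open>The smash product multiplication before passing to cosets. The value 0 outside the
  carrier makes associativity an equality of functions.\<close>

definition conv :: "('g \<Rightarrow> 'v free_alg) \<Rightarrow> ('g \<Rightarrow> 'v free_alg) \<Rightarrow> 'g \<Rightarrow> 'v free_alg"
  where "conv f f' k = (if k \<in> carrier G then \<Sum>g\<in>carrier G. f g * act g (f' (inv g \<otimes> k)) else 0)"

definition delta :: "'g \<Rightarrow> 'v free_alg \<Rightarrow> 'g \<Rightarrow> 'v free_alg"
  where "delta g x k = (if k = g then x else 0)"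

lemma Phi_eq_iff: "\<Phi> f = \<Phi> f' \<longleftrightarrow> (\<forall>k\<in>carrier G. f k - f' k \<in> TI)"
  by (auto simp: \<Phi>_def restrict_def fun_eq_iff qt_eq_iff)

lemma Phi_cong: "(\<And>k. k \<in> carrier G \<Longrightarrow> f k = f' k) \<Longrightarrow> \<Phi> f = \<Phi> f'"
  by (simp add: Phi_eq_iff TI_closed)

lemma AA_carrier: "carrier AA = range \<Phi>"
proof
  show "carrier AA \<subseteq> range \<Phi>"
  proof
    fix F assume "F \<in> carrier AA"
    hence F: "F \<in> carrier G \<rightarrow>\<^sub>E range qt"
      by (simp add: smash_tensor_algebra_def smash_product_def TT_simps)
    hence "\<forall>k. \<exists>x. k \<in> carrier G \<longrightarrow> F k = qt x" by (auto simp: PiE_iff)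
    then obtain f where "\<And>k. k \<in> carrier G \<Longrightarrow> F k = qt (f k)" by metis
    hence "F = \<Phi> f" using F unfolding \<Phi>_def by (intro extensionalityI[of _ "carrier G"]) (auto simp: PiE_iff)
    thus "F \<in> range \<Phi>" by blast
  qed
  show "range \<Phi> \<subseteq> carrier AA"
    by (auto simp: smash_tensor_algebra_def smash_product_def TT_simps \<Phi>_def)
qed

lemma AA_mult: "\<Phi> f \<otimes>\<^bsub>AA\<^esub> \<Phi> f' = \<Phi> (conv f f')"
proof -
  have "\<Phi> f \<otimes>\<^bsub>AA\<^esub> \<Phi> f' = (\<lambda>k\<in>carrier G. \<Oplus>\<^bsub>TT\<^esub>g\<in>carrier G. qt (f g * act g (f' (inv g \<otimes> k))))"
    unfolding smash_tensor_algebra_def smash_product_def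
  proof (simp, rule restrict_ext)
    fix k assume k: "k \<in> carrier G"
    have "\<Phi> f g \<otimes>\<^bsub>TT\<^esub> tensor_map (\<rho> g) (\<Phi> f' (inv g \<otimes> k)) = qt (f g * act g (f' (inv g \<otimes> k)))"
      if "g \<in> carrier G" for g
      using that k by (simp add: \<Phi>_def tensor_map_qt TT_simps)
    thus "(\<Oplus>\<^bsub>TT\<^esub>g\<in>carrier G. \<Phi> f g \<otimes>\<^bsub>TT\<^esub> tensor_map (\<rho> g) (\<Phi> f' (inv g \<otimes> k))) =
      (\<Oplus>\<^bsub>TT\<^esub>g\<in>carrier G. qt (f g * act g (f' (inv g \<otimes> k))))"
      by (intro abelian_monoid.finsum_cong'[OF abelian_monoid_TT]) (auto simp: TT_simps)
  qed
  thus ?thesis by (simp add: finsum_TT \<Phi>_def conv_def cong: restrict_cong)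
qed

lemma AA_simps:
  "\<Phi> f \<oplus>\<^bsub>AA\<^esub> \<Phi> f' = \<Phi> (\<lambda>k. f k + f' k)" "\<zero>\<^bsub>AA\<^esub> = \<Phi> (\<lambda>k. 0)" "\<one>\<^bsub>AA\<^esub> = \<Phi> (delta \<one> 1)"
  by (auto simp: smash_tensor_algebra_def smash_product_def TT_simps \<Phi>_def delta_def intro!: restrict_ext)

lemma conv_assoc: "conv (conv f f') f'' = conv f (conv f' f'')"
proof
  fix k
  show "conv (conv f f') f'' k = conv f (conv f' f'') k"
  proof (cases "k \<in> carrier G")
    case k: True
    have "conv f (conv f' f'') k = (\<Sum>g\<in>carrier G. \<Sum>h\<in>carrier G. f g * act g (f' h) * act (g \<otimes> h) (f'' (inv (g \<otimes> h) \<otimes> k)))"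
      unfolding conv_def using k
      by (auto intro!: sum.cong simp: free_map_hom sum_distrib_left act_mult mult.assoc inv_mult_group m_assoc)
    also have "\<dots> = (\<Sum>g\<in>carrier G. \<Sum>h\<in>carrier G. f g * act g (f' (inv g \<otimes> (g \<otimes> h))) * act (g \<otimes> h) (f'' (inv (g \<otimes> h) \<otimes> k)))"
      by (intro sum.cong refl) (simp add: mult_inv_cancel)
    also have "\<dots> = (\<Sum>g\<in>carrier G. \<Sum>h\<in>carrier G. f g * act g (f' (inv g \<otimes> h)) * act h (f'' (inv h \<otimes> k)))"
      by (rule sum.cong[OF refl], rule sum_mult_left[where g = "\<lambda>h. f _ * act _ (f' (inv _ \<otimes> h)) * act h (f'' (inv h \<otimes> k))"])
    also have "\<dots> = conv (conv f f') f'' k"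
      using k unfolding conv_def by (simp add: sum_distrib_right) (rule sum.swap)
    finally show ?thesis by simp
  qed (simp add: conv_def)
qed

lemma sum_delta: "g \<in> carrier G \<Longrightarrow> (\<Sum>k\<in>carrier G. F k (delta g x k)) = F g x + (\<Sum>k\<in>carrier G - {g}. F k 0)"
  using fin by (subst sum.remove[of _ g]) (auto simp: delta_def intro!: sum.cong)

lemma conv_delta_left:
  assumes "g \<in> carrier G" "k \<in> carrier G"
  shows "conv (delta g x) f k = x * act g (f (inv g \<otimes> k))"
proof -
  have "conv (delta g x) f k = (\<Sum>h\<in>carrier G. delta g x h * act h (f (inv h \<otimes> k)))"
    using assms by (simp add: conv_def)
  also have "\<dots> = x * act g (f (inv g \<otimes> k)) + (\<Sum>h\<in>carrier G - {g}. 0 * act h (f (inv h \<otimes> k)))"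
    by (rule sum_delta[OF assms(1), where F = "\<lambda>h z. z * act h (f (inv h \<otimes> k))"])
  finally show ?thesis by simp
qed

lemma conv_delta_one_right:
  assumes "k \<in> carrier G"
  shows "conv f (delta \<one> x) k = f k * act k x"
proof -
  have "inv g \<otimes> k = \<one> \<longleftrightarrow> g = k" if "g \<in> carrier G" for g
    using that assms by (metis inv_closed inv_equality inv_inv l_inv)
  hence "conv f (delta \<one> x) k = (\<Sum>g\<in>carrier G. if g = k then f k * act k x else 0)"
    using assms unfolding conv_def
    by (auto intro!: sum.cong simp: delta_def free_map_hom)
  thus ?thesis using assms fin by simp
qed

lemma conv_linear:
  "conv (\<lambda>k. f k + f' k) h = (\<lambda>k. conv f h k + conv f' h k)"
  "conv h (\<lambda>k. f k + f' k) = (\<lambda>k. conv h f k + conv h f' k)"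
  by (auto simp: conv_def fun_eq_iff ring_distribs sum.distrib free_map_hom)

lemma ring_AA: "ring AA"
proof (rule ringI)
  show "abelian_group AA"
  proof (rule abelian_groupI)
    fix x assume "x \<in> carrier AA"
    then obtain f where "x = \<Phi> f" by (auto simp: AA_carrier)
    thus "\<exists>y\<in>carrier AA. y \<oplus>\<^bsub>AA\<^esub> x = \<zero>\<^bsub>AA\<^esub>"
      by (intro bexI[of _ "\<Phi> (\<lambda>k. - f k)"]) (simp_all add: AA_carrier AA_simps)
  qed (auto simp: AA_carrier AA_simps add_ac)
  show "Group.monoid AA"
  proof (rule monoidI)
    fix x assume "x \<in> carrier AA"
    then obtain f where f: "x = \<Phi> f" by (auto simp: AA_carrier)
    show "\<one>\<^bsub>AA\<^esub> \<otimes>\<^bsub>AA\<^esub> x = x"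
      unfolding f AA_simps AA_mult by (rule Phi_cong) (simp add: conv_delta_left act_one)
    show "x \<otimes>\<^bsub>AA\<^esub> \<one>\<^bsub>AA\<^esub> = x"
      unfolding f AA_simps AA_mult
      by (rule Phi_cong) (simp add: conv_delta_one_right free_map_1)
  qed (auto simp: AA_carrier AA_simps AA_mult conv_assoc)
qed (auto simp: AA_carrier AA_simps AA_mult conv_linear)

lemma AA_a_inv: "\<ominus>\<^bsub>AA\<^esub> \<Phi> f = \<Phi> (\<lambda>k. - f k)"
  by (rule abelian_group.minus_equality[OF ring.is_abelian_group[OF ring_AA]])
    (simp_all add: AA_simps AA_carrier)

lemma abelian_monoid_AA: "abelian_monoid AA"
  using ring_AA by (simp add: ring_def abelian_group_def)

lemma AA_minus: "\<Phi> f \<ominus>\<^bsub>AA\<^esub> \<Phi> f' = \<Phi> (\<lambda>k. f k - f' k)"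
  by (simp add: a_minus_def AA_a_inv AA_simps)

lemma finsum_AA: "(\<Oplus>\<^bsub>AA\<^esub>i\<in>S. \<Phi> (h i)) = \<Phi> (\<lambda>k. \<Sum>i\<in>S. h i k)"
  by (rule finsum_eqI[OF abelian_monoid_AA]) (simp_all add: AA_simps AA_carrier)

lemma sra_elements:
  "sra_vec scale G v = \<Phi> (delta \<one> (free_vec v))" "sra_scalar scale G z = \<Phi> (delta \<one> (free_scalar z))"
  "g \<in> carrier G \<Longrightarrow> sra_group scale G g = \<Phi> (delta g 1)"
  by (auto simp: sra_vec_def sra_scalar_def sra_group_def smash_ring_elt_def smash_group_elt_def
      tensor_vec_def tensor_scalar_def TT_simps \<Phi>_def delta_def intro!: restrict_ext simp flip: qt_def)

end

context symplectic_reflection_data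
begin

definition rel :: "'v \<Rightarrow> 'v \<Rightarrow> 'g \<Rightarrow> 'v free_alg"
  where "rel x y k = delta \<one> (free_vec x * free_vec y - free_vec y * free_vec x) k - free_scalar (\<kappa> k x y)"

lemma sra_relation_eq: "sra_relation scale \<omega> G \<rho> t c x y = \<Phi> (rel x y)"
proof -
  have s: "sra_scalar scale G a \<otimes>\<^bsub>AA\<^esub> sra_group scale G g = \<Phi> (delta g (free_scalar a))" if "g \<in> carrier G" for a g
    unfolding sra_elements(2) sra_elements(3)[OF that] AA_mult
    by (rule Phi_cong) (simp add: conv_delta_left act_one, simp add: delta_def)
  have f: "(\<Oplus>\<^bsub>AA\<^esub>s\<in>refls. sra_scalar scale G (c s * refl_form s x y) \<otimes>\<^bsub>AA\<^esub> sra_group scale G s) =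
    \<Phi> (\<lambda>k. \<Sum>s\<in>refls. delta s (free_scalar (c s * refl_form s x y)) k)"
    unfolding finsum_AA[symmetric]
    by (rule abelian_monoid.finsum_cong'[OF abelian_monoid_AA]) (auto simp: s refls_carrier AA_carrier)
  have fr: "finite refls" using fin by (rule finite_subset[rotated]) (auto simp: refls_carrier)
  show ?thesis
    unfolding sra_relation_def Let_def f unfolding sra_elements AA_mult AA_minus
  proof (rule Phi_cong)
    fix k assume k: "k \<in> carrier G"
    have "\<kappa> k x y = (if k = \<one> then t * \<omega> x y else 0) - (if k \<in> refls then 2 * (c k * refl_form k x y) else 0)"
      by (simp add: \<kappa>_def)
    hence kappa: "free_scalar (\<kappa> k x y) = delta \<one> (free_scalar (t * \<omega> x y)) k -
      free_scalar 2 * (if k \<in> refls then free_scalar (c k * refl_form k x y) else 0)"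
      by (simp only: free_scalar_diff free_scalar_mult delta_def if_distrib[of free_scalar] free_scalar_0 if_distrib[of "(*) _"] mult_zero_right)
    have "(\<Sum>s\<in>refls. delta s (free_scalar (c s * refl_form s x y)) k) =
      (if k \<in> refls then free_scalar (c k * refl_form k x y) else 0)"
      using fr by (simp add: delta_def)
    thus "conv (delta \<one> (free_vec x)) (delta \<one> (free_vec y)) k - conv (delta \<one> (free_vec y)) (delta \<one> (free_vec x)) k -
      (delta \<one> (free_scalar (t * \<omega> x y)) k -
       conv (delta \<one> (free_scalar 2)) (\<lambda>k. \<Sum>s\<in>refls. delta s (free_scalar (c s * refl_form s x y)) k) k) = rel x y k"
      using k by (simp add: conv_delta_left act_one rel_def kappa) (simp add: delta_def)
  qed
qed

abbreviation "JJ \<equiv> sra_ideal scale \<omega> G \<rho> t c"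
abbreviation "HH \<equiv> symplectic_reflection_algebra scale \<omega> G \<rho> t c"

lemma JJ_ideal: "ideal JJ AA"
  unfolding sra_ideal_def
  by (rule ring.genideal_ideal[OF ring_AA]) (auto simp: sra_relation_eq AA_carrier)

lemma JJ_rel: "\<Phi> (rel x y) \<in> JJ"
proof -
  have "{sra_relation scale \<omega> G \<rho> t c x y |x y. True} \<subseteq> JJ"
    unfolding sra_ideal_def by (rule ring.genideal_self[OF ring_AA]) (auto simp: sra_relation_eq AA_carrier)
  thus ?thesis by (force simp: sra_relation_eq)
qed

lemma JJ_closed:
  "\<Phi> (\<lambda>k. 0) \<in> JJ" "\<Phi> f \<in> JJ \<Longrightarrow> \<Phi> f' \<in> JJ \<Longrightarrow> \<Phi> (\<lambda>k. f k + f' k) \<in> JJ"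
  "\<Phi> f \<in> JJ \<Longrightarrow> \<Phi> (conv f f') \<in> JJ" "\<Phi> f \<in> JJ \<Longrightarrow> \<Phi> (conv f' f) \<in> JJ"
  using ideal_closed[OF JJ_ideal] by (auto simp: AA_carrier simp flip: AA_simps AA_mult)

lemma JJ_minimal: "ideal J AA \<Longrightarrow> (\<And>x y. \<Phi> (rel x y) \<in> J) \<Longrightarrow> JJ \<subseteq> J"
  unfolding sra_ideal_def by (rule ring.genideal_minimal[OF ring_AA]) (auto simp: sra_relation_eq)

text \<open>Up to the scalar \<open>N\<^sup>2\<close>, \<open>\<Phi> (\<lambda>k. tr x)\<close> is the element \<open>e x e\<close>.\<close>

definition tr :: "'v free_alg \<Rightarrow> 'v free_alg" where "tr x = (\<Sum>g\<in>carrier G. act g x)"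

lemma tr_linear: "tr (x + y) = tr x + tr y" "tr (x - y) = tr x - tr y" "tr 0 = 0"
  "tr (free_scalar a * x) = free_scalar a * tr x" "tr (sum f A) = (\<Sum>i\<in>A. tr (f i))"
  by (simp_all add: tr_def free_map_hom sum.distrib sum_subtractf sum_distrib_left)
    (rule sum.swap)

lemma act_tr:
  assumes g: "g \<in> carrier G"
  shows "act g (tr x) = tr x"
proof -
  have "act g (tr x) = (\<Sum>h\<in>carrier G. act (g \<otimes> h) x)"
    using g by (simp add: tr_def free_map_hom act_mult)
  thus ?thesis unfolding tr_def using sum_mult_left[OF g, of "\<lambda>h. act h x"] by simp
qed

lemma tr_act:
  assumes g: "g \<in> carrier G"
  shows "tr (act g x) = tr x"
proof -
  have "tr (act g x) = (\<Sum>h\<in>carrier G. act (h \<otimes> g) x)"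
    using g by (simp add: tr_def act_mult)
  thus ?thesis unfolding tr_def using sum_mult_right[OF g, of "\<lambda>h. act h x"] by simp
qed

lemma tr_star: "tr (star x y) = tr x * tr y"
proof -
  have "tr (star x y) = (\<Sum>h\<in>carrier G. \<Sum>g\<in>carrier G. act h x * act (h \<otimes> g) y)"
    by (simp add: tr_def star_def free_map_hom act_mult)
  also have "\<dots> = (\<Sum>h\<in>carrier G. \<Sum>g\<in>carrier G. act h x * act g y)"
    by (rule sum.cong[OF refl], rule sum_mult_left[where g = "\<lambda>g. act _ x * act g y"])
  also have "\<dots> = tr x * tr y" by (simp add: tr_def sum_product)
  finally show ?thesis .
qed

text \<open>Since \<open>tr x\<close> represents a nonzero multiple of \<open>e x e\<close>, these
  are the \<open>x\<close> for which \<open>e x e\<close> is zero in \<open>HH\<close>.\<close>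

definition KK :: "'v free_alg set" where "KK = {x. \<Phi> (\<lambda>k. tr x) \<in> JJ}"

lemma KK_scale:
  assumes "x \<in> KK"
  shows "free_scalar a * x \<in> KK"
proof -
  have "\<Phi> (conv (delta \<one> (free_scalar a)) (\<lambda>k. tr x)) \<in> JJ"
    using assms by (intro JJ_closed) (simp add: KK_def)
  also have "\<Phi> (conv (delta \<one> (free_scalar a)) (\<lambda>k. tr x)) = \<Phi> (\<lambda>k. tr (free_scalar a * x))"
    by (rule Phi_cong) (simp add: conv_delta_left act_one tr_linear)
  finally show ?thesis by (simp add: KK_def)
qed

lemma KK_unscale:
  assumes "free_scalar a * x \<in> KK" "a \<noteq> 0"
  shows "x \<in> KK"
  using KK_scale[OF assms(1), of "1 / a"] assms(2) by (simp add: free_scalar_mult flip: mult.assoc)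

lemma conv_tr: "k \<in> carrier G \<Longrightarrow> conv (\<lambda>k. tr x) (\<lambda>k. tr y) k = free_scalar (of_nat N) * tr (star x y)"
  by (simp add: conv_def act_tr tr_star free_scalar_def)

definition eps :: "'g \<Rightarrow> 'v free_alg" where "eps k = free_scalar (1 / of_nat N)"

text \<open>Group elements are absorbed by the symmetrizer on the right, so only the sum of the
  values of \<open>f\<close> counts, and the symmetrizer on the left averages it. The scalar is the
  product of the constants in the two factors \<open>eps\<close>.\<close>

lemma conv_eps:
  assumes "k \<in> carrier G"
  shows "conv (conv eps f) eps k = tr (free_scalar (1 / of_nat N ^ 2) * (\<Sum>h\<in>carrier G. f h))"
proof -
  have "conv (conv eps f) eps k = (\<Sum>h\<in>carrier G. conv eps f h * free_scalar (1 / of_nat N))"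
    using assms by (simp add: conv_def[of "conv eps f"] eps_def free_map_hom)
  also have "\<dots> = (\<Sum>h\<in>carrier G. \<Sum>g\<in>carrier G. free_scalar (1 / of_nat N ^ 2) * act g (f (inv g \<otimes> h)))"
  proof (intro sum.cong refl)
    fix h assume h: "h \<in> carrier G"
    have "free_scalar (1 / of_nat N) * (free_scalar (1 / of_nat N) * y) = free_scalar (1 / of_nat N ^ 2) * y" for y :: "'v free_alg"
      by (simp add: free_scalar_mult power2_eq_square flip: mult.assoc)
    thus "conv eps f h * free_scalar (1 / of_nat N) = (\<Sum>g\<in>carrier G. free_scalar (1 / of_nat N ^ 2) * act g (f (inv g \<otimes> h)))"
      using h by (simp add: conv_def eps_def free_scalar_commute sum_distrib_left)
  qed
  also have "\<dots> = (\<Sum>g\<in>carrier G. \<Sum>h\<in>carrier G. free_scalar (1 / of_nat N ^ 2) * act g (f (inv g \<otimes> h)))"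
    by (rule sum.swap)
  also have "\<dots> = (\<Sum>g\<in>carrier G. \<Sum>h\<in>carrier G. free_scalar (1 / of_nat N ^ 2) * act g (f h))"
  proof (rule sum.cong[OF refl])
    fix g assume "g \<in> carrier G"
    thus "(\<Sum>h\<in>carrier G. free_scalar (1 / of_nat N ^ 2) * act g (f (inv g \<otimes> h))) =
      (\<Sum>h\<in>carrier G. free_scalar (1 / of_nat N ^ 2) * act g (f h))"
      by (intro sum_mult_left[where g = "\<lambda>h. free_scalar (1 / of_nat N ^ 2) * act g (f h)"]) simp
  qed
  also have "\<dots> = tr (free_scalar (1 / of_nat N ^ 2) * (\<Sum>h\<in>carrier G. f h))"
    by (simp add: tr_def free_map_hom sum_distrib_left)
  finally show ?thesis .
qed

text \<open>Multiplication by the symmetrizer on both sides stays in the ideal and collapses the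
  group variable.\<close>

lemma JJ_sum_KK:
  assumes "\<Phi> f \<in> JJ"
  shows "(\<Sum>h\<in>carrier G. f h) \<in> KK"
proof -
  have "\<Phi> (conv (conv eps f) eps) \<in> JJ" using assms by (intro JJ_closed)
  also have "\<Phi> (conv (conv eps f) eps) = \<Phi> (\<lambda>k. tr (free_scalar (1 / of_nat N ^ 2) * (\<Sum>h\<in>carrier G. f h)))"
    by (rule Phi_cong) (rule conv_eps)
  finally have "free_scalar (1 / of_nat N ^ 2) * (\<Sum>h\<in>carrier G. f h) \<in> KK" by (simp add: KK_def)
  thus ?thesis by (rule KK_unscale) (use N_pos in simp)
qed

lemma TI_KK:
  assumes "x \<in> TI"
  shows "x \<in> KK"
proof -
  have "\<Phi> (\<lambda>k. tr x) = \<Phi> (\<lambda>k. 0)"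
    unfolding Phi_eq_iff using assms by (auto simp: tr_def intro!: TI_sum TI_act)
  thus ?thesis by (simp add: KK_def JJ_closed)
qed

lemma W_append: "W (u @ w) = W u * W w"
  by (simp add: mult_single)

lemma W_Cons: "W (x # w) = free_vec x * W w"
  by (simp add: free_vec_def mult_single)

lemma linear_in_TI: "free_vec (a *s x + b *s y) - (free_scalar a * free_vec x + free_scalar b * free_vec y) \<in> TI"
proof -
  have "free_vec (a *s x + b *s y) - (free_vec (a *s x) + free_vec (b *s y)) \<in> TI"
    "free_vec (a *s x) - free_scalar a * free_vec x \<in> TI" "free_vec (b *s y) - free_scalar b * free_vec y \<in> TI"
    using TI_generators by (auto simp: linearity_relations_def)
  from TI_closed(2)[OF this(1) TI_closed(2)[OF this(2,3)]] show ?thesis by (simp add: algebra_simps)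
qed

lemma KK_linear: "W (u @ (a *s x + b *s y) # f) - (free_scalar a * W (u @ x # f) + free_scalar b * W (u @ y # f)) \<in> KK"
proof (rule TI_KK)
  have c: "W u * (free_scalar r * z) = free_scalar r * (W u * z)" for r and z :: "'v free_alg"
    by (metis free_scalar_commute mult.assoc)
  have "W u * ((free_vec (a *s x + b *s y) - (free_scalar a * free_vec x + free_scalar b * free_vec y)) * W f) \<in> TI"
    by (intro TI_closed linear_in_TI)
  thus "W (u @ (a *s x + b *s y) # f) - (free_scalar a * W (u @ x # f) + free_scalar b * W (u @ y # f)) \<in> TI"
    by (simp only: W_append W_Cons ring_distribs left_diff_distrib right_diff_distrib mult.assoc c)
qed

lemma sum_conv_delta: 
  assumes "g \<in> carrier G"
  shows "(\<Sum>k\<in>carrier G. conv (delta g x) f k) = x * act g (\<Sum>k\<in>carrier G. f k)"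
proof -
  have "(\<Sum>k\<in>carrier G. conv (delta g x) f k) = (\<Sum>k\<in>carrier G. x * act g (f (inv g \<otimes> k)))"
    using assms by (intro sum.cong refl) (rule conv_delta_left)
  also have "\<dots> = (\<Sum>k\<in>carrier G. x * act g (f k))"
    using assms by (intro sum_mult_left[where g = "\<lambda>k. x * act g (f k)"]) simp
  finally show ?thesis by (simp add: free_map_hom sum_distrib_left)
qed

lemma sum_conv: "(\<Sum>k\<in>carrier G. conv f f' k) = (\<Sum>g\<in>carrier G. f g * act g (\<Sum>k\<in>carrier G. f' k))"
proof -
  have "(\<Sum>k\<in>carrier G. conv f f' k) = (\<Sum>k\<in>carrier G. \<Sum>g\<in>carrier G. f g * act g (f' (inv g \<otimes> k)))"
    by (intro sum.cong refl) (simp add: conv_def)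
  also have "\<dots> = (\<Sum>g\<in>carrier G. \<Sum>k\<in>carrier G. f g * act g (f' (inv g \<otimes> k)))"
    by (rule sum.swap)
  also have "\<dots> = (\<Sum>g\<in>carrier G. \<Sum>k\<in>carrier G. f g * act g (f' k))"
  proof (rule sum.cong[OF refl])
    fix g assume "g \<in> carrier G"
    thus "(\<Sum>k\<in>carrier G. f g * act g (f' (inv g \<otimes> k))) = (\<Sum>k\<in>carrier G. f g * act g (f' k))"
      by (intro sum_mult_left[where g = "\<lambda>k. f g * act g (f' k)"]) simp
  qed
  finally show ?thesis by (simp add: free_map_hom sum_distrib_left)
qed

lemma sum_rel_conv:
  "(\<Sum>k\<in>carrier G. conv (rel x y) f k) = (free_vec x * free_vec y - free_vec y * free_vec x) * (\<Sum>k\<in>carrier G. f k)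
    - (\<Sum>g\<in>carrier G. free_scalar (\<kappa> g x y) * act g (\<Sum>k\<in>carrier G. f k))"
proof -
  let ?S = "\<Sum>k\<in>carrier G. f k"
  have "(\<Sum>g\<in>carrier G. delta \<one> z g * act g ?S) = z * ?S" for z :: "'v free_alg"
    using sum_delta[of \<one> "\<lambda>g z. z * act g ?S" z] by (simp add: act_one)
  thus ?thesis
    unfolding sum_conv rel_def left_diff_distrib sum_subtractf by (simp add: left_diff_distrib)
qed

text \<open>Placed between two words, the relation stays in the ideal. Summing out the group
  variable makes each \<open>g\<close> act on the letters to its right.\<close>

lemma KK_relation: "W (u @ [x,y] @ f) - W (u @ [y,x] @ f)
  - (\<Sum>g\<in>carrier G. free_scalar (\<kappa> g x y) * W (u @ map (\<rho> g) f)) \<in> KK"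
proof -
  have "\<Phi> (conv (delta \<one> (W u)) (conv (rel x y) (delta \<one> (W f)))) \<in> JJ"
    by (intro JJ_closed JJ_rel)
  hence "(\<Sum>h\<in>carrier G. conv (delta \<one> (W u)) (conv (rel x y) (delta \<one> (W f))) h) \<in> KK"
    by (rule JJ_sum_KK)
  moreover have "(\<Sum>h\<in>carrier G. delta \<one> (W f) h) = W f"
    using fin by (simp add: delta_def)
  moreover have "W u * (free_scalar r * z) = free_scalar r * (W u * z)" for r and z :: "'v free_alg"
    by (metis free_scalar_commute mult.assoc)
  ultimately show ?thesis
    by (simp add: sum_conv_delta act_one sum_rel_conv right_diff_distrib left_diff_distrib sum_distrib_left
        free_map_hom free_vec_def mult_single rho_one o_def)
qed

section \<open>Functionals that vanish on the ideals\<close>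

definition \<Lambda> :: "('v list \<Rightarrow> complex) \<Rightarrow> 'v free_alg \<Rightarrow> complex"
  where "\<Lambda> \<l> = lin_ext (\<lambda>w. \<l> (letters w))"

lemma Lambda_linear: "\<Lambda> \<l> (x + y) = \<Lambda> \<l> x + \<Lambda> \<l> y" "\<Lambda> \<l> (x - y) = \<Lambda> \<l> x - \<Lambda> \<l> y" "\<Lambda> \<l> 0 = 0"
  "\<Lambda> \<l> (sum f A) = (\<Sum>i\<in>A. \<Lambda> \<l> (f i))" "\<Lambda> \<l> (free_scalar a * x) = a * \<Lambda> \<l> x"
  "\<Lambda> \<l> (Poly_Mapping.single (Word w) a) = a * \<l> w"
  by (simp_all add: \<Lambda>_def lin_ext_add lin_ext_diff lin_ext_sum free_scalar_def lin_ext_scale)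

text \<open>The largest two-sided ideal inside the kernel of the functional contains the generators:
  flanked by words they express linearity in a single slot.\<close>

lemma Lambda_TI:
  assumes ml: "multilinear \<l>" and x: "x \<in> TI"
  shows "\<Lambda> \<l> x = 0"
proof -
  let ?I = "{x. \<forall>a b. \<Lambda> \<l> (a * x * b) = 0}"
  have "ideal ?I free_algebra"
  proof (rule ideal_free_algebraI)
    fix x r assume "x \<in> ?I"
    hence "\<Lambda> \<l> ((a * r) * x * b) = 0" "\<Lambda> \<l> (a * x * (r * b)) = 0" for a b by blast+
    thus "r * x \<in> ?I" "x * r \<in> ?I" by (simp_all add: mult.assoc)
  qed (auto simp: Lambda_linear ring_distribs)
  moreover have "linearity_relations scale \<subseteq> ?I"
  proof -
    have "\<Lambda> \<l> (a * r * b) = 0" if r: "r \<in> linearity_relations scale" for a b r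
    proof (induction a rule: poly_mapping_additive_induct)
      case (single u \<alpha>)
      show ?case
      proof (induction b rule: poly_mapping_additive_induct)
        case (single v \<beta>)
        obtain u' v' where uv: "u = Word u'" "v = Word v'" by (cases u; cases v) auto
        show ?case
          using r unfolding linearity_relations_def uv
          by (auto simp: free_vec_def free_scalar_def mult_single ring_distribs left_diff_distrib right_diff_distrib
              Lambda_linear multilinear_add[OF ml] multilinear_scale[OF ml])
      qed (simp_all add: Lambda_linear ring_distribs)
    qed (simp_all add: Lambda_linear ring_distribs)
    thus ?thesis by blast
  qed
  ultimately have "TI \<subseteq> ?I" by (rule TI_minimal)
  hence "\<Lambda> \<l> (1 * x * 1) = 0" using x by blast
  thus ?thesis by simp
qed

lemma conj_mult: "g \<in> carrier G \<Longrightarrow> s \<in> carrier G \<Longrightarrow> g \<otimes> s \<otimes> inv g \<otimes> g = g \<otimes> s"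
  by (simp add: m_assoc)

text \<open>Applying \<open>g\<close> to the relation for \<open>x\<close> and \<open>y\<close>
  gives the relation for their translates: the sum over \<open>s\<close> is reindexed by
  conjugation, and \<open>kappa_conj\<close> matches the coefficients.\<close>

lemma Lambda_relation:
  assumes pbw: "\<And>n. pbw_relation n \<l>" and g: "g \<in> carrier G"
  shows "\<Lambda> \<l> (a * act g ((free_vec x * free_vec y - free_vec y * free_vec x) * b
    - (\<Sum>s\<in>carrier G. free_scalar (\<kappa> s x y) * act s b))) = 0"
proof (induction a rule: poly_mapping_additive_induct)
  case (single u \<alpha>)
  show ?case
  proof (induction b rule: poly_mapping_additive_induct)
    case (single v \<beta>)
    obtain u' v' where uv: "u = Word u'" "v = Word v'" by (cases u; cases v) auto
    have "(\<Sum>s\<in>carrier G. \<kappa> s x y * \<l> (u' @ map (\<rho> (g \<otimes> s)) v')) =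
      (\<Sum>s\<in>carrier G. \<kappa> (g \<otimes> s \<otimes> inv g) (\<rho> g x) (\<rho> g y) * \<l> (u' @ map (\<rho> (g \<otimes> s \<otimes> inv g)) (map (\<rho> g) v')))"
      using g by (intro sum.cong refl) (simp add: kappa_conj map_rho_map conj_mult del: map_map)
    also have "\<dots> = (\<Sum>s\<in>carrier G. \<kappa> s (\<rho> g x) (\<rho> g y) * \<l> (u' @ map (\<rho> s) (map (\<rho> g) v')))"
      by (rule sum_conj[OF g, where g = "\<lambda>s. \<kappa> s (\<rho> g x) (\<rho> g y) * \<l> (u' @ map (\<rho> s) (map (\<rho> g) v'))"])
    also have "\<dots> = \<l> (u' @ [\<rho> g x, \<rho> g y] @ map (\<rho> g) v') - \<l> (u' @ [\<rho> g y, \<rho> g x] @ map (\<rho> g) v')"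
      using pbw[of "length u' + length v' + 2"] unfolding pbw_relation_def by simp
    finally have *: "(\<Sum>s\<in>carrier G. \<kappa> s x y * \<l> (u' @ map (\<rho> (g \<otimes> s)) v')) = \<dots>" .
    have sc: "Poly_Mapping.single (Word w) r * (free_scalar q * z) = free_scalar q * (Poly_Mapping.single (Word w) r * z)" for w r q z
      by (metis free_scalar_commute mult.assoc)
    have "\<Lambda> \<l> (Poly_Mapping.single u \<alpha> * act g ((free_vec x * free_vec y - free_vec y * free_vec x) * Poly_Mapping.single v \<beta>
      - (\<Sum>s\<in>carrier G. free_scalar (\<kappa> s x y) * act s (Poly_Mapping.single v \<beta>)))) =
      \<alpha> * \<beta> * (\<l> (u' @ [\<rho> g x, \<rho> g y] @ map (\<rho> g) v') - \<l> (u' @ [\<rho> g y, \<rho> g x] @ map (\<rho> g) v'))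
      - (\<Sum>s\<in>carrier G. \<kappa> s x y * (\<alpha> * \<beta> * \<l> (u' @ map (\<rho> g) (map (\<rho> s) v'))))"
      unfolding uv
      by (simp add: free_map_hom free_vec_def mult_single left_diff_distrib right_diff_distrib sum_distrib_left
          sc Lambda_linear del: map_map)
    also have "(\<Sum>s\<in>carrier G. \<kappa> s x y * (\<alpha> * \<beta> * \<l> (u' @ map (\<rho> g) (map (\<rho> s) v')))) =
      \<alpha> * \<beta> * (\<Sum>s\<in>carrier G. \<kappa> s x y * \<l> (u' @ map (\<rho> (g \<otimes> s)) v'))"
      unfolding sum_distrib_left using g by (intro sum.cong refl) (simp add: map_rho_map del: map_map)
    finally show ?case unfolding * by simp
  qed (simp_all add: Lambda_linear free_map_hom ring_distribs sum.distrib algebra_simps)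
qed (simp_all add: Lambda_linear ring_distribs)

text \<open>Summing out the group variable and applying \<open>\<Lambda>\<close> gives a functional
  \<open>T\<close> on the smash product. Its largest two-sided ideal of zeros, \<open>ann\<close> on
  representatives, contains the relations and hence all of \<open>JJ\<close>.\<close>

lemma JJ_functional:
  assumes ml: "multilinear \<l>" and pbw: "\<And>n. pbw_relation n \<l>" and f: "\<Phi> f \<in> JJ"
  shows "(\<Sum>k\<in>carrier G. \<Lambda> \<l> (f k)) = 0"
proof -
  define T where "T f = (\<Sum>k\<in>carrier G. \<Lambda> \<l> (f k))" for f
  define ann where "ann = {f. \<forall>a b. T (conv a (conv f b)) = 0}"
  have T_TI: "T f = 0" if "\<And>k. k \<in> carrier G \<Longrightarrow> f k \<in> TI" for f
    using that by (simp add: T_def Lambda_TI[OF ml])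
  have conv_TI: "conv a f k \<in> TI" "conv f a k \<in> TI" if "\<And>k. k \<in> carrier G \<Longrightarrow> f k \<in> TI" for a f k
  proof -
    show "conv a f k \<in> TI" using that by (auto simp: conv_def TI_closed(1) intro!: TI_sum TI_closed(3) TI_act)
    show "conv f a k \<in> TI" using that by (auto simp: conv_def TI_closed(1) intro!: TI_sum TI_closed(4))
  qed
  have ann_add: "(\<lambda>k. f k + f' k) \<in> ann" if "f \<in> ann" "f' \<in> ann" for f f'
    using that by (simp add: ann_def conv_linear T_def Lambda_linear sum.distrib)
  have ann_TI: "f \<in> ann" if "\<And>k. k \<in> carrier G \<Longrightarrow> f k \<in> TI" for f
    unfolding ann_def by (clarify, rule T_TI, rule conv_TI(1), rule conv_TI(2), rule that)
  \<comment> \<open>Functions with values in \<open>TI\<close> belong to \<open>ann\<close>, so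
    membership is independent of the representative.\<close>
  have ann_iff: "\<Phi> f \<in> \<Phi> ` ann \<longleftrightarrow> f \<in> ann" for f
  proof
    assume "\<Phi> f \<in> \<Phi> ` ann"
    then obtain f' where f': "\<Phi> f = \<Phi> f'" "f' \<in> ann" by blast
    have "(\<lambda>k. f' k + (f k - f' k)) \<in> ann"
      by (rule ann_add[OF f'(2)], rule ann_TI) (use f'(1) in \<open>simp add: Phi_eq_iff\<close>)
    thus "f \<in> ann" by simp
  qed auto
  have ann_conv: "conv a f \<in> ann" "conv f a \<in> ann" if "f \<in> ann" for f a
    using that by (simp_all add: ann_def conv_assoc) (simp flip: conv_assoc)
  have "ideal (\<Phi> ` ann) AA"
  proof (rule idealI_closed[OF ring_AA])
    show "\<Phi> ` ann \<subseteq> carrier AA" by (auto simp: AA_carrier)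
    show "\<Phi> ` ann \<noteq> {}" using ann_TI[of "\<lambda>k. 0"] TI_closed(1) by auto
    show "a \<oplus>\<^bsub>AA\<^esub> b \<in> \<Phi> ` ann" if "a \<in> \<Phi> ` ann" "b \<in> \<Phi> ` ann" for a b
      using that by (auto simp: AA_simps ann_iff ann_add)
    show "\<ominus>\<^bsub>AA\<^esub> a \<in> \<Phi> ` ann" if a: "a \<in> \<Phi> ` ann" for a
    proof -
      obtain f where f: "a = \<Phi> f" "f \<in> ann" using a by blast
      have "conv (delta \<one> (-1)) f \<in> ann" using f by (intro ann_conv)
      moreover have "\<Phi> (conv (delta \<one> (-1)) f) = \<ominus>\<^bsub>AA\<^esub> a"
        unfolding f AA_a_inv by (rule Phi_cong) (simp add: conv_delta_left act_one)
      ultimately show ?thesis by (metis image_eqI)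
    qed
  qed (auto simp: AA_carrier AA_mult ann_iff ann_conv)
  moreover have "\<Phi> (rel x y) \<in> \<Phi> ` ann" for x y
  proof -
    have "T (conv a (conv (rel x y) b)) = 0" for a b
    proof -
      have "T (conv a (conv (rel x y) b)) = \<Lambda> \<l> (\<Sum>k\<in>carrier G. conv a (conv (rel x y) b) k)"
        by (simp add: T_def Lambda_linear)
      also have "\<dots> = (\<Sum>g\<in>carrier G. 0)"
        unfolding sum_conv[of a] sum_rel_conv Lambda_linear(4)
        by (intro sum.cong refl Lambda_relation pbw)
      finally show ?thesis by simp
    qed
    thus ?thesis by (simp add: ann_def)
  qed
  ultimately have "JJ \<subseteq> \<Phi> ` ann" by (rule JJ_minimal)
  hence "f \<in> ann" using f ann_iff by blast
  hence "T (conv (delta \<one> 1) (conv f (delta \<one> 1))) = 0" by (simp add: ann_def)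
  also have "T (conv (delta \<one> 1) (conv f (delta \<one> 1))) = T f"
    unfolding T_def
    by (intro sum.cong refl) (simp add: conv_delta_left conv_delta_one_right act_one free_map_1)
  finally show ?thesis by (simp add: T_def)
qed

lemma spherical_kernel_KK: "spherical_kernel scale Basis G \<omega> \<rho> t c KK"
proof unfold_locales
  show "0 \<in> KK" by (rule TI_KK) (rule TI_closed)
  show "x + y \<in> KK" if "x \<in> KK" "y \<in> KK" for x y
    using JJ_closed(2)[of "\<lambda>k. tr x" "\<lambda>k. tr y"] that by (simp add: KK_def tr_linear)
  show "free_scalar r * x \<in> KK" if "x \<in> KK" for x r using that by (rule KK_scale)
  show "x - act g x \<in> KK" if "g \<in> carrier G" for g x
    using that JJ_closed(1) by (simp add: KK_def tr_linear tr_act)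
  have Nn: "(of_nat N :: complex) \<noteq> 0" using N_pos by simp
  have prod: "\<Phi> (conv (\<lambda>k. tr x) (\<lambda>k. tr y)) = \<Phi> (\<lambda>k. tr (free_scalar (of_nat N) * star x y))" for x y
    by (rule Phi_cong) (simp add: conv_tr tr_linear)
  show "star x y \<in> KK" if "x \<in> KK" for x y
    by (rule KK_unscale[OF _ Nn]) (use that JJ_closed(3) in \<open>simp add: KK_def flip: prod\<close>)
  show "star y x \<in> KK" if "x \<in> KK" for x y
    by (rule KK_unscale[OF _ Nn]) (use that JJ_closed(4) in \<open>simp add: KK_def flip: prod\<close>)
  show "lin_ext (\<lambda>w. \<Sum>g\<in>carrier G. \<l> (map (\<rho> g) (letters w))) x = 0"
    if x: "x \<in> KK" and ml: "multilinear \<l>" and pbw: "\<And>n. pbw_relation n \<l>" for x \<l>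
  proof -
    have "(\<Sum>k\<in>carrier G. \<Lambda> \<l> (tr x)) = 0"
      by (rule JJ_functional[OF ml pbw]) (use x in \<open>simp add: KK_def\<close>)
    hence "\<Lambda> \<l> (tr x) = 0" using N_pos by simp
    moreover have "lin_ext (\<lambda>w. \<Sum>g\<in>carrier G. \<l> (map (\<rho> g) (letters w))) x = \<Lambda> \<l> (tr x)"
    proof (induction x rule: poly_mapping_additive_induct)
      case (single w a)
      thus ?case by (cases w) (simp add: tr_def free_map_hom Lambda_linear sum_distrib_left)
    qed (simp_all add: tr_linear Lambda_linear lin_ext_add)
    ultimately show ?thesis by simp
  qed
qed (rule KK_linear KK_relation)+

section \<open>The spherical subalgebra in terms of representatives\<close>

abbreviation "BB \<equiv> spherical_subalgebra scale \<omega> G \<rho> t c"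

definition cl :: "('g \<Rightarrow> 'v free_alg) \<Rightarrow> ('g \<Rightarrow> 'v free_alg set) set"
  where "cl f = JJ +>\<^bsub>AA\<^esub> \<Phi> f"

lemma cl_eq_iff: "cl f = cl f' \<longleftrightarrow> \<Phi> (\<lambda>k. f k - f' k) \<in> JJ"
  unfolding cl_def using ring.quotient_eq_iff_same_a_r_cos[OF ring_AA JJ_ideal, of "\<Phi> f" "\<Phi> f'"]
  by (simp add: AA_carrier AA_minus)

lemma cl_cong: "(\<And>k. k \<in> carrier G \<Longrightarrow> f k = f' k) \<Longrightarrow> cl f = cl f'"
  unfolding cl_def by (simp add: Phi_cong[of f f'])

lemma HH_simps: "carrier HH = range cl" "cl f \<otimes>\<^bsub>HH\<^esub> cl f' = cl (conv f f')"
  using quotient_simps[OF JJ_ideal]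
  by (simp_all add: symplectic_reflection_algebra_def cl_def[abs_def] AA_carrier AA_mult image_image)

lemma symmetrizer_eq: "symmetrizer scale \<omega> G \<rho> t c = cl eps"
proof -
  have "(\<Oplus>\<^bsub>AA\<^esub>g\<in>carrier G. sra_group scale G g) = \<Phi> (\<lambda>k. \<Sum>g\<in>carrier G. delta g 1 k)"
    unfolding finsum_AA[symmetric] by (rule abelian_monoid.finsum_cong'[OF abelian_monoid_AA]) (auto simp: sra_elements AA_carrier)
  also have "\<dots> = \<Phi> (\<lambda>k. 1)"
    by (rule Phi_cong) (use fin in \<open>simp add: delta_def\<close>)
  finally have "sra_scalar scale G (1 / of_nat N) \<otimes>\<^bsub>AA\<^esub> (\<Oplus>\<^bsub>AA\<^esub>g\<in>carrier G. sra_group scale G g) =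
    \<Phi> (conv (delta \<one> (free_scalar (1 / of_nat N))) (\<lambda>k. 1))"
    by (simp add: sra_elements AA_mult)
  also have "\<dots> = \<Phi> eps"
    by (rule Phi_cong) (simp add: conv_delta_left eps_def free_map_1)
  finally show ?thesis by (simp add: symmetrizer_def Let_def cl_def)
qed

lemma BB_carrier: "carrier BB = range (\<lambda>x. cl (\<lambda>k. tr x))"
proof -
  have e: "cl eps \<otimes>\<^bsub>HH\<^esub> cl f \<otimes>\<^bsub>HH\<^esub> cl eps = cl (\<lambda>k. tr (free_scalar (1 / of_nat N ^ 2) * (\<Sum>h\<in>carrier G. f h)))" for f
    unfolding HH_simps by (rule cl_cong) (rule conv_eps)
  have "carrier BB = range (\<lambda>f. cl eps \<otimes>\<^bsub>HH\<^esub> cl f \<otimes>\<^bsub>HH\<^esub> cl eps)"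
    by (auto simp: spherical_subalgebra_def corner_ring_def symmetrizer_eq HH_simps(1))
  also have "\<dots> = range (\<lambda>x. cl (\<lambda>k. tr x))"
  proof (intro equalityI image_subsetI)
    fix x
    \<comment> \<open>The square of \<open>N\<close> compensates for the constant in
      \<open>conv_eps\<close>.\<close>
    let ?f = "delta \<one> (free_scalar (of_nat N ^ 2) * x)"
    have "(\<Sum>h\<in>carrier G. ?f h) = free_scalar (of_nat N ^ 2) * x"
      using fin by (simp add: delta_def)
    hence "free_scalar (1 / of_nat N ^ 2) * (\<Sum>h\<in>carrier G. ?f h) = x"
      using N_pos by (simp add: free_scalar_mult flip: mult.assoc)
    hence "cl (\<lambda>k. tr x) = cl eps \<otimes>\<^bsub>HH\<^esub> cl ?f \<otimes>\<^bsub>HH\<^esub> cl eps" unfolding e by simp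
    thus "cl (\<lambda>k. tr x) \<in> range (\<lambda>f. cl eps \<otimes>\<^bsub>HH\<^esub> cl f \<otimes>\<^bsub>HH\<^esub> cl eps)" by blast
  qed (auto simp: e)
  finally show ?thesis .
qed

lemma BB_mult: "cl (\<lambda>k. tr x) \<otimes>\<^bsub>BB\<^esub> cl (\<lambda>k. tr y) = cl (\<lambda>k. tr (free_scalar (of_nat N) * star x y))"
proof -
  have "cl (\<lambda>k. tr x) \<otimes>\<^bsub>BB\<^esub> cl (\<lambda>k. tr y) = cl (conv (\<lambda>k. tr x) (\<lambda>k. tr y))"
    by (simp add: spherical_subalgebra_def corner_ring_def HH_simps)
  also have "\<dots> = cl (\<lambda>k. tr (free_scalar (of_nat N) * star x y))"
    by (rule cl_cong) (simp add: conv_tr tr_linear)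
  finally show ?thesis .
qed

lemma BB_commutative_iff:
  "(\<forall>a\<in>carrier BB. \<forall>b\<in>carrier BB. a \<otimes>\<^bsub>BB\<^esub> b = b \<otimes>\<^bsub>BB\<^esub> a) \<longleftrightarrow> (\<forall>x y. cm x y \<in> KK)"
proof -
  have Nn: "(of_nat N :: complex) \<noteq> 0" using N_pos by simp
  have "cl (\<lambda>k. tr (free_scalar (of_nat N) * star x y)) = cl (\<lambda>k. tr (free_scalar (of_nat N) * star y x)) \<longleftrightarrow>
    cm x y \<in> KK" for x y
  proof -
    have "cl (\<lambda>k. tr (free_scalar (of_nat N) * star x y)) = cl (\<lambda>k. tr (free_scalar (of_nat N) * star y x)) \<longleftrightarrow>
      free_scalar (of_nat N) * cm x y \<in> KK"
      by (simp add: cl_eq_iff KK_def cm_def right_diff_distrib tr_linear)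
    also have "\<dots> \<longleftrightarrow> cm x y \<in> KK" using KK_scale KK_unscale[OF _ Nn] by blast
    finally show ?thesis .
  qed
  thus ?thesis by (simp add: BB_carrier BB_mult)
qed

end

theorem proposition8p6:
  fixes scale :: "complex \<Rightarrow> 'v::ab_group_add \<Rightarrow> 'v"
    and \<omega> :: "'v \<Rightarrow> 'v \<Rightarrow> complex"
    and G :: "('g, 'm) monoid_scheme"
    and \<rho> :: "'g \<Rightarrow> 'v \<Rightarrow> 'v"
    and c :: "'g \<Rightarrow> complex"
    and t :: complex
  assumes "\<exists>Basis. finite_dimensional_vector_space scale Basis"
    and "\<exists>v::'v. v \<noteq> 0"
    and "symplectic_form scale \<omega>"
    and "faithful_action G UNIV \<rho>"
    and "finite (carrier G)"
    and "\<forall>g\<in>carrier G. Vector_Spaces.linear scale scale (\<rho> g)"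
    and "invariant_form G \<rho> \<omega>"
    and "{B. skew_bilinear_form scale B \<and> invariant_form G \<rho> B} = {(\<lambda>x y. z * \<omega> x y) | z. True}"
    and "\<forall>g\<in>carrier G. \<forall>s\<in>symplectic_reflections scale G \<rho>.
           c (g \<otimes>\<^bsub>G\<^esub> s \<otimes>\<^bsub>G\<^esub> inv\<^bsub>G\<^esub> g) = c s"
  shows "(\<forall>a \<in> carrier (spherical_subalgebra scale \<omega> G \<rho> t c).
          \<forall>b \<in> carrier (spherical_subalgebra scale \<omega> G \<rho> t c).
            a \<otimes>\<^bsub>spherical_subalgebra scale \<omega> G \<rho> t c\<^esub> b =
            b \<otimes>\<^bsub>spherical_subalgebra scale \<omega> G \<rho> t c\<^esub> a)
         \<longleftrightarrow> t = 0"
proof -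
  obtain Basis where "finite_dimensional_vector_space scale Basis" using assms(1) by blast
  interpret V: finite_dimensional_vector_space scale Basis by fact
  interpret A: faithful_action G UNIV \<rho> by fact
  interpret H: group_hom G "BijGroup UNIV" \<rho> by (rule A.group_hom)
  have one: "\<rho> \<one>\<^bsub>G\<^esub> x = x" for x
    using H.hom_one by (simp add: BijGroup_def)
  have mult: "\<rho> (g \<otimes>\<^bsub>G\<^esub> h) x = \<rho> g (\<rho> h x)" if "g \<in> carrier G" "h \<in> carrier G" for g h x
    using H.hom_mult[OF that] H.hom_closed[OF that(1)] H.hom_closed[OF that(2)]
    by (simp add: BijGroup_def compose_def)
  have "symplectic_action scale Basis G \<omega> \<rho>"
  proof (intro symplectic_action.intro symplectic_action_axioms.intro)
    show "g = \<one>\<^bsub>G\<^esub>" if "g \<in> carrier G" "\<And>x. \<rho> g x = x" for g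
      by (rule inj_onD[OF A.faithful]) (use that one in auto)
  qed (use assms one mult in \<open>auto intro: V.finite_dimensional_vector_space_axioms H.G.is_group\<close>)
  then interpret symplectic_reflection_data scale Basis G \<omega> \<rho> t c
    by (intro symplectic_reflection_data.intro symplectic_reflection_data_axioms.intro) (use assms(9) in auto)
  interpret spherical_kernel scale Basis G \<omega> \<rho> t c KK by (rule spherical_kernel_KK)
  show ?thesis
    unfolding BB_commutative_iff by (rule commutative_iff) (rule assms(2))
qed

end
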